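(* Let $n\geq 1$ be an integer, let $\alpha>0$ and $1<q\leq 1+\frac{\alpha}{n}$ be real numbers. Let $\mathcal L=\sum_{i,j=1}^n\frac{\partial}{\partial x_i}\left[a_{ij}(t,x)\frac{\partial}{\partial x_j}\right]$ be a differential operator on $\mathbb E=\mathbb R\times\mathbb R^n$ whose coefficients satisfy the standing assumptions given in the context, with bounding function $A(t,x)$, and suppose that for this $\alpha$ and some constant $c>0$ one has $$\mathcal A(R):=\operatorname*{ess\,sup}_{(t,x)\in(-\infty,+\infty)\times\{R/2<|x|<R\}}A(t,x)\leq cR^{2-\alpha}\quad\text{for all } R>1.$$ Let $(u,v)$ be a weak solution in $\mathbb E$ of the inequality $$u_t-\mathcal L u-|u|^{q-1}u\geq v_t-\mathcal L v-|v|^{q-1}v$$ such that $u\geq v$ (almost everywhere) in $\mathbb E$. Then $u=v$ (almost everywhere) in $\mathbb E$.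
   Context: Setting: $\mathbb E=\mathbb R\times\mathbb R^n$ with points $(t,x)$, $t\in\mathbb R$, $x\in\mathbb R^n$. Standing assumptions on $\mathcal L=\sum_{i,j=1}^n\frac{\partial}{\partial x_i}\left[a_{ij}(t,x)\frac{\partial}{\partial x_j}\right]$: the real-valued coefficients $a_{ij}$, $i,j=1,\dots,n$, are defined, measurable and locally bounded in $\mathbb E$; $a_{ij}(t,x)=a_{ji}(t,x)$ for almost all $(t,x)\in\mathbb E$; and $$0\leq\sum_{i,j=1}^n a_{ij}(t,x)\xi_i\xi_j\leq A(t,x)|\xi|^2$$ for all $\xi\in\mathbb R^n$ and almost all $(t,x)\in\mathbb E$, where $A$ is a measurable, non-negative, locally bounded function on $\mathbb E$. (No positive lower ellipticity bound is assumed.) Function spaces: let $\hat q=\max\{1,q\}$. For a domain $\Omega\subset\mathbb E$, $W^{\mathcal L,q}(\Omega)$ is the completion of the space $C^\infty(\Omega)$ of infinitely differentiable functions on $\Omega$ (those with finite norm) with respect to the norm $$\|w\|_{W^{\mathcal L,q}(\Omega)}=\int_\Omega|w_t|\,dt\,dx+\left[\int_\Omega\sum_{i,j=1}^n a_{ij}(t,x)\frac{\partial w}{\partial x_i}\frac{\partial w}{\partial x_j}\,dt\,dx\right]^{1/2}+\left[\int_\Omega|w|^{\hat q}\,dt\,dx\right]^{1/\hat q}.$$ A function $w$ belongs to $W^{\mathcal L,q}_{\mathrm{loc}}(\mathbb E)$ if it belongs to $W^{\mathcal L,q}(\Omega)$ for every bounded domain $\Omega\subset\mathbb E$. Weak solution: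 a pair $(u,v)$ of measurable functions on $\mathbb E$ is a weak solution in $\mathbb E$ of $u_t-\mathcal L u-|u|^{q-1}u\geq v_t-\mathcal L v-|v|^{q-1}v$ if $u,v\in W^{\mathcal L,q}_{\mathrm{loc}}(\mathbb E)$ and $$\int_{\mathbb E}\left[u_t\varphi+\sum_{i,j=1}^n a_{ij}\frac{\partial\varphi}{\partial x_i}\frac{\partial u}{\partial x_j}-|u|^{q-1}u\,\varphi\right]dt\,dx\geq\int_{\mathbb E}\left[v_t\varphi+\sum_{i,j=1}^n a_{ij}\frac{\partial\varphi}{\partial x_i}\frac{\partial v}{\partial x_j}-|v|^{q-1}v\,\varphi\right]dt\,dx$$ for every non-negative $\varphi\in C^\infty(\mathbb E)$ with compact support in $\mathbb E$. For elements of the completion, $w_t$ and the integral of $\sum_{i,j}a_{ij}\frac{\partial\varphi}{\partial x_i}\frac{\partial w}{\partial x_j}$ are understood as limits along the sequences of smooth functions, Cauchy in the norm $\|\cdot\|_{W^{\mathcal L,q}(\Omega)}$ on a bounded domain $\Omega\subset\mathbb E$ containing the support of $\varphi$, that represent the element $w$ of the completion. *)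

theory Defs
  imports "HOL-Analysis.Analysis" "HOL-Probability.Essential_Supremum"
begin

type_synonym 'n spacetime = "real \<times> (real ^ 'n)"

text \<open>Meant for open \<open>\<Omega>\<close>; the derivatives are taken at points of \<open>\<Omega>\<close>, not within \<open>\<Omega>\<close>.\<close>

fun Ck_on :: "nat \<Rightarrow> 'e::real_normed_vector set \<Rightarrow> ('e \<Rightarrow> real) \<Rightarrow> bool" where
  "Ck_on 0 \<Omega> f \<longleftrightarrow> continuous_on \<Omega> f"
| "Ck_on (Suc k) \<Omega> f \<longleftrightarrow> (\<forall>z\<in>\<Omega>. f differentiable (at z)) \<and>
     (\<forall>h. Ck_on k \<Omega> (\<lambda>z. frechet_derivative f (at z) h))"

definition smooth_on :: "'e::real_normed_vector set \<Rightarrow> ('e \<Rightarrow> real) \<Rightarrow> bool" where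
  "smooth_on \<Omega> f \<longleftrightarrow> (\<forall>k. Ck_on k \<Omega> f)"

definition D_t :: "('n::finite spacetime \<Rightarrow> real) \<Rightarrow> 'n spacetime \<Rightarrow> real" where
  "D_t w z = frechet_derivative w (at z) (1, 0)"

definition D_x :: "'n::finite \<Rightarrow> ('n spacetime \<Rightarrow> real) \<Rightarrow> 'n spacetime \<Rightarrow> real" where
  "D_x i w z = frechet_derivative w (at z) (0, axis i 1)"

definition bounded_domain :: "'e::real_normed_vector set \<Rightarrow> bool" where
  "bounded_domain \<Omega> \<longleftrightarrow> open \<Omega> \<and> connected \<Omega> \<and> \<Omega> \<noteq> {} \<and> bounded \<Omega>"

definition test_fun :: "('e::real_normed_vector \<Rightarrow> real) \<Rightarrow> bool" where
  "test_fun \<phi> \<longleftrightarrow> smooth_on UNIV \<phi> \<and> compact (closure (support_on UNIV \<phi>))"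

definition locally_bounded :: "('e::metric_space \<Rightarrow> real) \<Rightarrow> bool" where
  "locally_bounded f \<longleftrightarrow> (\<forall>K. compact K \<longrightarrow> bounded (f ` K))"

definition standing_assumptions ::
    "('n::finite spacetime \<Rightarrow> real ^ 'n ^ 'n) \<Rightarrow> ('n spacetime \<Rightarrow> real) \<Rightarrow> bool" where
  "standing_assumptions a A \<longleftrightarrow>
     (\<forall>i j. (\<lambda>z. a z $ i $ j) \<in> borel_measurable lebesgue) \<and>
     (\<forall>i j. locally_bounded (\<lambda>z. a z $ i $ j)) \<and>
     (AE z in lebesgue. \<forall>i j. a z $ i $ j = a z $ j $ i) \<and>
     A \<in> borel_measurable lebesgue \<and> (\<forall>z. 0 \<le> A z) \<and> locally_bounded A \<and>
     (AE z in lebesgue. \<forall>\<xi> :: real ^ 'n.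
        0 \<le> (\<Sum>i\<in>UNIV. \<Sum>j\<in>UNIV. a z $ i $ j * \<xi> $ i * \<xi> $ j) \<and>
        (\<Sum>i\<in>UNIV. \<Sum>j\<in>UNIV. a z $ i $ j * \<xi> $ i * \<xi> $ j) \<le> A z * (norm \<xi>)\<^sup>2)"

definition a_form :: "('n::finite spacetime \<Rightarrow> real ^ 'n ^ 'n) \<Rightarrow>
    ('n spacetime \<Rightarrow> real) \<Rightarrow> ('n spacetime \<Rightarrow> real) \<Rightarrow> 'n spacetime \<Rightarrow> real" where
  "a_form a f g z = (\<Sum>i\<in>UNIV. \<Sum>j\<in>UNIV. a z $ i $ j * D_x i f z * D_x j g z)"

definition hat :: "real \<Rightarrow> real" where
  "hat q = max 1 q"

text \<open>The three integrability conditions say that the norm \<open>W_norm\<close> below is finite.\<close>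

definition W_smooth :: "('n::finite spacetime \<Rightarrow> real ^ 'n ^ 'n) \<Rightarrow> real \<Rightarrow> 'n spacetime set \<Rightarrow>
    ('n spacetime \<Rightarrow> real) set" where
  "W_smooth a q \<Omega> = {w. smooth_on \<Omega> w \<and>
     set_integrable lebesgue \<Omega> (\<lambda>z. \<bar>D_t w z\<bar>) \<and>
     set_integrable lebesgue \<Omega> (a_form a w w) \<and>
     set_integrable lebesgue \<Omega> (\<lambda>z. \<bar>w z\<bar> powr hat q)}"

definition W_norm :: "('n::finite spacetime \<Rightarrow> real ^ 'n ^ 'n) \<Rightarrow> real \<Rightarrow> 'n spacetime set \<Rightarrow>
    ('n spacetime \<Rightarrow> real) \<Rightarrow> real" where
  "W_norm a q \<Omega> w =
     (LINT z:\<Omega>|lebesgue. \<bar>D_t w z\<bar>) +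
     sqrt (LINT z:\<Omega>|lebesgue. a_form a w w z) +
     (LINT z:\<Omega>|lebesgue. \<bar>w z\<bar> powr hat q) powr (1 / hat q)"

text \<open>The completion, built as Cauchy sequences of smooth functions modulo null sequences.
  Values of functions outside \<open>\<Omega>\<close> are irrelevant, since \<open>W_norm\<close> does not see them.\<close>

definition W_Cauchy :: "('n::finite spacetime \<Rightarrow> real ^ 'n ^ 'n) \<Rightarrow> real \<Rightarrow> 'n spacetime set \<Rightarrow>
    (nat \<Rightarrow> 'n spacetime \<Rightarrow> real) set" where
  "W_Cauchy a q \<Omega> = {s. (\<forall>k. s k \<in> W_smooth a q \<Omega>) \<and>
     (\<forall>e>0. \<exists>N. \<forall>k\<ge>N. \<forall>l\<ge>N. W_norm a q \<Omega> (\<lambda>z. s k z - s l z) < e)}"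

definition W_rel :: "('n::finite spacetime \<Rightarrow> real ^ 'n ^ 'n) \<Rightarrow> real \<Rightarrow> 'n spacetime set \<Rightarrow>
    (nat \<Rightarrow> 'n spacetime \<Rightarrow> real) rel" where
  "W_rel a q \<Omega> = {(s, r). s \<in> W_Cauchy a q \<Omega> \<and> r \<in> W_Cauchy a q \<Omega> \<and>
     (\<lambda>k. W_norm a q \<Omega> (\<lambda>z. s k z - r k z)) \<longlonglongrightarrow> 0}"

definition W_space :: "('n::finite spacetime \<Rightarrow> real ^ 'n ^ 'n) \<Rightarrow> real \<Rightarrow> 'n spacetime set \<Rightarrow>
    (nat \<Rightarrow> 'n spacetime \<Rightarrow> real) set set" where
  "W_space a q \<Omega> = W_Cauchy a q \<Omega> // W_rel a q \<Omega>"

text \<open>An element of the completion determines a function, the $L^{\hat q}$ limit of any of its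
  sequences. As the form \<open>a\<close> may degenerate, it need not be closable, so several elements of the
  completion may have the same function; hence the element is kept along with the function.\<close>

definition W_represents :: "('n::finite spacetime \<Rightarrow> real ^ 'n ^ 'n) \<Rightarrow> real \<Rightarrow>
    'n spacetime set \<Rightarrow> (nat \<Rightarrow> 'n spacetime \<Rightarrow> real) set \<Rightarrow> ('n spacetime \<Rightarrow> real) \<Rightarrow> bool" where
  "W_represents a q \<Omega> X w \<longleftrightarrow> X \<in> W_space a q \<Omega> \<and>
     (\<forall>s\<in>X. (\<forall>k. set_integrable lebesgue \<Omega> (\<lambda>z. \<bar>s k z - w z\<bar> powr hat q)) \<and>
            (\<lambda>k. LINT z:\<Omega>|lebesgue. \<bar>s k z - w z\<bar> powr hat q) \<longlonglongrightarrow> 0)"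

text \<open>\<open>X \<Omega>\<close> is the function \<open>w\<close> regarded as an element of the completion over \<open>\<Omega>\<close>. The last
  clause says that it is the same element for all \<open>\<Omega>\<close>: the image of \<open>X \<Omega>'\<close> under \<open>W_rel a q \<Omega>\<close>
  is the restriction of the class \<open>X \<Omega>'\<close> to the smaller domain \<open>\<Omega>\<close>.\<close>

definition W_loc :: "('n::finite spacetime \<Rightarrow> real ^ 'n ^ 'n) \<Rightarrow> real \<Rightarrow>
    ('n spacetime set \<Rightarrow> (nat \<Rightarrow> 'n spacetime \<Rightarrow> real) set) \<Rightarrow> ('n spacetime \<Rightarrow> real) \<Rightarrow> bool" where
  "W_loc a q X w \<longleftrightarrow> w \<in> borel_measurable lebesgue \<and>
     (\<forall>\<Omega>. bounded_domain \<Omega> \<longrightarrow> W_represents a q \<Omega> (X \<Omega>) w) \<and>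
     (\<forall>\<Omega> \<Omega>'. bounded_domain \<Omega> \<longrightarrow> bounded_domain \<Omega>' \<longrightarrow> \<Omega> \<subseteq> \<Omega>' \<longrightarrow>
        X \<Omega> = W_rel a q \<Omega> `` X \<Omega>')"

text \<open>For a sequence \<open>s\<close> of the class over \<open>\<Omega>\<close> of an element \<open>w\<close>, with \<open>\<Omega>\<close> containing the support
  of \<open>\<phi>\<close>, this is the integral of $w_t\varphi + \sum a_{ij} \varphi_{x_i} w_{x_j}
  - |w|^{q-1} w \varphi$. The limit exists since \<open>s\<close> is Cauchy in \<open>W_norm\<close>.\<close>

definition weak_form :: "('n::finite spacetime \<Rightarrow> real ^ 'n ^ 'n) \<Rightarrow> real \<Rightarrow> 'n spacetime set \<Rightarrow>
    (nat \<Rightarrow> 'n spacetime \<Rightarrow> real) \<Rightarrow> ('n spacetime \<Rightarrow> real) \<Rightarrow> ('n spacetime \<Rightarrow> real) \<Rightarrow> real" where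
  "weak_form a q \<Omega> s w \<phi> =
     lim (\<lambda>k. LINT z:\<Omega>|lebesgue. D_t (s k) z * \<phi> z + a_form a \<phi> (s k) z) -
     (LINT z|lebesgue. \<bar>w z\<bar> powr (q - 1) * w z * \<phi> z)"

definition weak_solution :: "('n::finite spacetime \<Rightarrow> real ^ 'n ^ 'n) \<Rightarrow> real \<Rightarrow>
    ('n spacetime \<Rightarrow> real) \<Rightarrow> ('n spacetime \<Rightarrow> real) \<Rightarrow> bool" where
  "weak_solution a q u v \<longleftrightarrow> (\<exists>X Y. W_loc a q X u \<and> W_loc a q Y v \<and>
     (\<forall>\<phi> \<Omega>. test_fun \<phi> \<longrightarrow> (\<forall>z. 0 \<le> \<phi> z) \<longrightarrow>
        bounded_domain \<Omega> \<longrightarrow> closure (support_on UNIV \<phi>) \<subseteq> \<Omega> \<longrightarrow>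
        (\<forall>s\<in>X \<Omega>. \<forall>r\<in>Y \<Omega>. weak_form a q \<Omega> s u \<phi> \<ge> weak_form a q \<Omega> r v \<phi>)))"

end

theory Submission
  imports Defs
begin

text \<open>
  Put $w = u - v \ge 0$. The difference of the reaction terms is at least $2^{-q} w^q$, so $w$ is, in the weak
  sense, a nonnegative solution of $w_t - \mathcal L w \ge 2^{-q} w^q$ on the whole spacetime, and the theorem is
  of Fujita type. The proof is the method of nonlinear capacity. It takes the test function $f(w)\zeta^m$, where
  $\zeta$ is a cutoff of the cylinder $|t| < R^\alpha$, $|x| < R$ and $f$ is a decreasing function with values in
  $[1, M]$ and $f'(s) = -\varepsilon^{-1}(1 + s^2/\varepsilon^2)^{-p/2}$ for some $1 < p < q$
  (\<open>decreasing_profile\<close>). The monotonicity of $f$ produces an energy term that absorbs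
  the cross term of $\nabla w$ and $\nabla\zeta$ (\<open>energy_absorption\<close>, \<open>pairing_upper_bound\<close>). The growth
  condition gives $|\zeta_t| \lesssim R^{-\alpha}$ and
  $a(\nabla\zeta,\nabla\zeta) \lesssim R^{-\alpha}$ alike. The outcome (\<open>reaction_bound\<close>, \<open>cutoff_estimate\<close>) is
  $$\int w^q \zeta^m \le C R^{-\alpha} \varepsilon \int_{\mathbb E \setminus Q} \zeta^{m-2}(1 + w/\varepsilon)^p,$$
  where $Q$ is the half-size cylinder, on which $\zeta = 1$, with $C$ independent of $R > 1$ and $\varepsilon > 0$.

  Because $p < q$, taking $\varepsilon = R^{-\alpha/(q-1)}$ and absorbing the right-hand side shows that
  $\int w^q$ over cylinders is bounded by a constant times $R^{n - \alpha/(q-1)}$; this is bounded exactly when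
  $q \le 1 + \alpha/n$. So $w^q$ is integrable. In the critical case this is not yet a contradiction, but
  with $\varepsilon = \delta R^{-\alpha/(q-1)}$ the right-hand side is at most a multiple of $\delta$ plus
  a term that involves $w^q$ only outside a large cylinder and tends to 0 as $R \to \infty$. Hence $\int w^q = 0$
  (\<open>vanishing_from_cutoff_estimates\<close>).

  Two points need care. Test functions have to be smooth, so $f(w)$ is replaced by $f(w_k)$ with $w_k$ a
  difference of smooth members of sequences representing \<open>u\<close> and \<open>v\<close>; and $\nabla w$ has no meaning as a function,
  so all computations are made for $w_k$. The link is \<open>composed_test_inequality\<close>: the pairing with a
  test function of bounded energy converges uniformly, so that the limit in the weak form may be replaced by the
  pairing with $w_k$ itself.
\<close>

section \<open>Closure properties of smooth functions\<close>

lemma frechet_derivative_cong_open: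
  assumes "open \<Omega>" "z \<in> \<Omega>" "\<And>z. z \<in> \<Omega> \<Longrightarrow> f z = g z"
  shows "frechet_derivative f (at z) = frechet_derivative g (at z)"
proof -
  have "(f has_derivative D) (at z) \<longleftrightarrow> (g has_derivative D) (at z)" for D
    using assms by (metis has_derivative_transform_within_open)
  then show ?thesis
    by (simp add: frechet_derivative_def)
qed

lemma differentiable_cong_open:
  assumes "open \<Omega>" "z \<in> \<Omega>" "\<And>z. z \<in> \<Omega> \<Longrightarrow> f z = g z"
  shows "f differentiable (at z) \<longleftrightarrow> g differentiable (at z)"
  using assms unfolding differentiable_def by (metis has_derivative_transform_within_open)

lemma Ck_on_cong:
  assumes "open \<Omega>" "\<And>z. z \<in> \<Omega> \<Longrightarrow> f z = g z" "Ck_on k \<Omega> f"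
  shows "Ck_on k \<Omega> g"
  using assms(2,3)
proof (induction k arbitrary: f g)
  case 0
  then show ?case using continuous_on_cong by fastforce
next
  case (Suc k)
  have "Ck_on k \<Omega> (\<lambda>z. frechet_derivative g (at z) h)" for h
  proof (rule Suc.IH)
    show "Ck_on k \<Omega> (\<lambda>z. frechet_derivative f (at z) h)" using Suc.prems by simp
    show "frechet_derivative f (at z) h = frechet_derivative g (at z) h" if "z \<in> \<Omega>" for z
      using frechet_derivative_cong_open[OF assms(1) that Suc.prems(1)] by simp
  qed
  then show ?case
    using Suc.prems differentiable_cong_open[OF assms(1) _ Suc.prems(1)] by auto
qed

text \<open>\<open>Ck_on\<close> speaks of one particular function, the \<open>frechet_derivative\<close>; with this rule any
  formula for the derivative that is valid on \<open>\<Omega>\<close> can be used in an induction on the order.\<close>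

lemma Ck_on_SucI:
  assumes "open \<Omega>" "\<And>z. z \<in> \<Omega> \<Longrightarrow> (f has_derivative D z) (at z)"
    "\<And>h. Ck_on k \<Omega> (\<lambda>z. D z h)"
  shows "Ck_on (Suc k) \<Omega> f"
proof -
  have "D z = frechet_derivative f (at z)" if "z \<in> \<Omega>" for z
    using frechet_derivative_at assms(2) that by blast
  then show ?thesis
    using assms Ck_on_cong[OF assms(1), of "\<lambda>z. D z h" "\<lambda>z. frechet_derivative f (at z) h" k for h]
    by (auto simp: differentiable_def)
qed

lemma Ck_on_SucD: "Ck_on (Suc k) \<Omega> f \<Longrightarrow> Ck_on k \<Omega> f"
proof (induction k arbitrary: f)
  case 0
  then show ?case
    by (auto simp: continuous_on_eq_continuous_within intro!: differentiable_imp_continuous_within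
        intro: differentiable_at_withinI)
next
  case (Suc k)
  then show ?case by simp
qed

lemma Ck_on_has_derivative:
  "Ck_on (Suc k) \<Omega> f \<Longrightarrow> z \<in> \<Omega> \<Longrightarrow> (f has_derivative frechet_derivative f (at z)) (at z)"
  by (simp add: frechet_derivative_works)

lemma Ck_on_const: "Ck_on k \<Omega> (\<lambda>z. c)"
proof (induction k arbitrary: c)
  case (Suc k)
  then show ?case by simp
qed simp

lemma Ck_on_bounded_linear:
  assumes "bounded_linear f"
  shows "Ck_on k \<Omega> f"
proof (cases k)
  case 0
  then show ?thesis
    using assms bounded_linear.continuous_on continuous_on_id by fastforce
next
  case (Suc l)
  have D: "(f has_derivative f) (at z)" for z
    using assms by (rule bounded_linear_imp_has_derivative)
  then have "frechet_derivative f (at z) = f" for z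
    using frechet_derivative_at by metis
  then show ?thesis
    using D Suc by (auto simp: differentiable_def intro: Ck_on_const)
qed

lemma Ck_on_add:
  assumes "open \<Omega>"
  shows "Ck_on k \<Omega> f \<Longrightarrow> Ck_on k \<Omega> g \<Longrightarrow> Ck_on k \<Omega> (\<lambda>z. f z + g z)"
proof (induction k arbitrary: f g)
  case 0
  then show ?case by (auto intro: continuous_on_add)
next
  case (Suc k)
  show ?case
  proof (rule Ck_on_SucI[OF assms])
    show "((\<lambda>z. f z + g z) has_derivative
        (\<lambda>h. frechet_derivative f (at z) h + frechet_derivative g (at z) h)) (at z)"
      if "z \<in> \<Omega>" for z
      using Suc.prems that by (intro has_derivative_add Ck_on_has_derivative)
    show "Ck_on k \<Omega> (\<lambda>z. frechet_derivative f (at z) h + frechet_derivative g (at z) h)" for h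
      using Suc by simp
  qed
qed

lemma Ck_on_mult:
  assumes "open \<Omega>"
  shows "Ck_on k \<Omega> f \<Longrightarrow> Ck_on k \<Omega> g \<Longrightarrow> Ck_on k \<Omega> (\<lambda>z. f z * g z)"
proof (induction k arbitrary: f g)
  case 0
  then show ?case by (auto intro: continuous_on_mult)
next
  case (Suc k)
  show ?case
  proof (rule Ck_on_SucI[OF assms])
    show "((\<lambda>z. f z * g z) has_derivative
        (\<lambda>h. f z * frechet_derivative g (at z) h + frechet_derivative f (at z) h * g z)) (at z)"
      if "z \<in> \<Omega>" for z
      using Suc.prems that by (intro has_derivative_mult Ck_on_has_derivative)
    show "Ck_on k \<Omega> (\<lambda>z. f z * frechet_derivative g (at z) h + frechet_derivative f (at z) h * g z)"
      for h
      using Suc.prems by (intro Ck_on_add assms Suc.IH) (auto intro: Ck_on_SucD)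
  qed
qed

lemma Ck_on_compose:
  fixes g :: "real \<Rightarrow> real"
  assumes "open \<Omega>" "open U"
  shows "Ck_on k U g \<Longrightarrow> Ck_on k \<Omega> f \<Longrightarrow> f ` \<Omega> \<subseteq> U \<Longrightarrow> Ck_on k \<Omega> (\<lambda>z. g (f z))"
proof (induction k arbitrary: f g)
  case 0
  then show ?case by (auto intro: continuous_on_compose2)
next
  case (Suc k)
  show ?case
  proof (rule Ck_on_SucI[OF assms(1)])
    show "((\<lambda>z. g (f z)) has_derivative
        (\<lambda>h. frechet_derivative f (at z) h * frechet_derivative g (at (f z)) 1)) (at z)"
      if z: "z \<in> \<Omega>" for z
    proof -
      have "(f has_derivative frechet_derivative f (at z)) (at z)"
        using Suc.prems z Ck_on_has_derivative by blast
      moreover have g: "(g has_derivative frechet_derivative g (at (f z))) (at (f z))"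
        using Suc.prems z Ck_on_has_derivative by blast
      ultimately have "((\<lambda>z. g (f z)) has_derivative
        (\<lambda>h. frechet_derivative g (at (f z)) (frechet_derivative f (at z) h))) (at z)"
        by (rule has_derivative_compose)
      moreover have "frechet_derivative g (at (f z)) y = y * frechet_derivative g (at (f z)) 1" for y
      proof -
        have "frechet_derivative g (at (f z)) (y *\<^sub>R 1) = y *\<^sub>R frechet_derivative g (at (f z)) 1"
          by (rule linear_scale[OF has_derivative_linear[OF g]])
        then show ?thesis by (simp only: real_scaleR_def mult_1_right)
      qed
      ultimately show ?thesis
        by (rule has_derivative_eq_rhs[OF _ ext])
    qed
    show "Ck_on k \<Omega> (\<lambda>z. frechet_derivative f (at z) h * frechet_derivative g (at (f z)) 1)" for h
    proof (intro Ck_on_mult assms Suc.IH[where g="\<lambda>y. frechet_derivative g (at y) 1"])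
      show "Ck_on k \<Omega> f" using Suc.prems(2) by (rule Ck_on_SucD)
    qed (use Suc.prems in auto)
  qed
qed

lemma Ck_on_Un:
  assumes "open S" "open T"
  shows "Ck_on k S f \<Longrightarrow> Ck_on k T f \<Longrightarrow> Ck_on k (S \<union> T) f"
  using assms by (induction k arbitrary: f) (auto intro: continuous_on_open_Un)

lemma Ck_on_subset: "Ck_on k S f \<Longrightarrow> T \<subseteq> S \<Longrightarrow> Ck_on k T f"
  by (induction k arbitrary: f) (auto intro: continuous_on_subset)

lemma smooth_on_cong:
  "open \<Omega> \<Longrightarrow> (\<And>z. z \<in> \<Omega> \<Longrightarrow> f z = g z) \<Longrightarrow> smooth_on \<Omega> f \<Longrightarrow> smooth_on \<Omega> g"
  unfolding smooth_on_def using Ck_on_cong by blast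

lemma smooth_on_const: "smooth_on \<Omega> (\<lambda>z. c)"
  by (simp add: smooth_on_def Ck_on_const)

lemma smooth_on_bounded_linear: "bounded_linear f \<Longrightarrow> smooth_on \<Omega> f"
  by (simp add: smooth_on_def Ck_on_bounded_linear)

lemma smooth_on_ident: "smooth_on \<Omega> (\<lambda>x::real. x)"
  by (simp add: smooth_on_bounded_linear)

lemma smooth_on_add:
  "open \<Omega> \<Longrightarrow> smooth_on \<Omega> f \<Longrightarrow> smooth_on \<Omega> g \<Longrightarrow> smooth_on \<Omega> (\<lambda>z. f z + g z)"
  by (simp add: smooth_on_def Ck_on_add)

lemma smooth_on_mult:
  "open \<Omega> \<Longrightarrow> smooth_on \<Omega> f \<Longrightarrow> smooth_on \<Omega> g \<Longrightarrow> smooth_on \<Omega> (\<lambda>z. f z * g z)"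
  by (simp add: smooth_on_def Ck_on_mult)

lemma smooth_on_diff:
  "open \<Omega> \<Longrightarrow> smooth_on \<Omega> f \<Longrightarrow> smooth_on \<Omega> g \<Longrightarrow> smooth_on \<Omega> (\<lambda>z. f z - g z)"
  using smooth_on_add[of \<Omega> f "\<lambda>z. (-1) * g z"] smooth_on_mult[of \<Omega> "\<lambda>z. -1" g]
  by (simp add: smooth_on_const)

lemma smooth_on_power: "open \<Omega> \<Longrightarrow> smooth_on \<Omega> f \<Longrightarrow> smooth_on \<Omega> (\<lambda>z. f z ^ n)"
  by (induction n) (auto intro: smooth_on_const smooth_on_mult)

lemma smooth_on_sum:
  "open \<Omega> \<Longrightarrow> (\<And>i. i \<in> I \<Longrightarrow> smooth_on \<Omega> (f i)) \<Longrightarrow> smooth_on \<Omega> (\<lambda>z. \<Sum>i\<in>I. f i z)"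
  by (induction I rule: infinite_finite_induct) (auto intro: smooth_on_const smooth_on_add)

lemma smooth_on_compose:
  fixes g :: "real \<Rightarrow> real"
  assumes "open \<Omega>" "open U" "smooth_on U g" "smooth_on \<Omega> f" "f ` \<Omega> \<subseteq> U"
  shows "smooth_on \<Omega> (\<lambda>z. g (f z))"
  using assms by (simp add: smooth_on_def Ck_on_compose)

lemma smooth_on_Un:
  "open S \<Longrightarrow> open T \<Longrightarrow> smooth_on S f \<Longrightarrow> smooth_on T f \<Longrightarrow> smooth_on (S \<union> T) f"
  by (simp add: smooth_on_def Ck_on_Un)

lemma smooth_on_subset: "smooth_on S f \<Longrightarrow> T \<subseteq> S \<Longrightarrow> smooth_on T f"
  unfolding smooth_on_def using Ck_on_subset by blast

lemma smooth_on_has_derivative: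
  "smooth_on \<Omega> f \<Longrightarrow> z \<in> \<Omega> \<Longrightarrow> (f has_derivative frechet_derivative f (at z)) (at z)"
  unfolding smooth_on_def using Ck_on_has_derivative by blast

lemma smooth_on_frechet_derivative:
  "smooth_on \<Omega> f \<Longrightarrow> smooth_on \<Omega> (\<lambda>z. frechet_derivative f (at z) h)"
  unfolding smooth_on_def using Ck_on.simps(2) by blast

lemma smooth_on_continuous_on: "smooth_on \<Omega> f \<Longrightarrow> continuous_on \<Omega> f"
  unfolding smooth_on_def using Ck_on.simps(1) by blast

text \<open>Powers and the flat functions below are not closed under differentiation one by one, but the
  derivative of each is a multiple of another member of the same family. This closure is all that
  smoothness needs, so no formula for the higher derivatives has to be found.\<close>

lemma smooth_on_real_family:
  fixes F :: "'i \<Rightarrow> real \<Rightarrow> real"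
  assumes "open U" "\<And>i. i \<in> I \<Longrightarrow> \<sigma> i \<in> I"
    "\<And>i x. i \<in> I \<Longrightarrow> x \<in> U \<Longrightarrow> (F i has_real_derivative c i * F (\<sigma> i) x) (at x)" "i \<in> I"
  shows "smooth_on U (F i)"
proof -
  have "\<forall>i\<in>I. Ck_on k U (F i)" for k
  proof (induction k)
    case 0
    then show ?case
      using assms(3) by (auto intro!: DERIV_atLeastAtMost_imp_continuous_on
        simp: continuous_on_eq_continuous_at[OF assms(1)] intro: DERIV_isCont)
  next
    case (Suc k)
    show ?case
    proof
      fix i assume i: "i \<in> I"
      show "Ck_on (Suc k) U (F i)"
      proof (rule Ck_on_SucI[OF assms(1)])
        show "(F i has_derivative (\<lambda>h. (c i * F (\<sigma> i) x) * h)) (at x)" if "x \<in> U" for x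
          using assms(3)[OF i that] by (simp add: has_field_derivative_def)
        show "Ck_on k U (\<lambda>x. (c i * F (\<sigma> i) x) * h)" for h
          using Suc assms(2)[OF i] by (intro Ck_on_mult assms Ck_on_const) auto
      qed
    qed
  qed
  then show ?thesis using assms(4) by (simp add: smooth_on_def)
qed

lemma smooth_on_antiderivative:
  fixes f :: "real \<Rightarrow> real"
  assumes "open U" "smooth_on U f'" "\<And>x. x \<in> U \<Longrightarrow> (f has_real_derivative f' x) (at x)"
  shows "smooth_on U f"
proof -
  have "Ck_on (Suc k) U f" for k
  proof (rule Ck_on_SucI[OF assms(1)])
    show "(f has_derivative (\<lambda>h. f' x * h)) (at x)" if "x \<in> U" for x
      using assms(3)[OF that] by (simp add: has_field_derivative_def)
    show "Ck_on k U (\<lambda>x. f' x * h)" for h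
      using assms(2) by (intro Ck_on_mult assms Ck_on_const) (simp add: smooth_on_def)
  qed
  then show ?thesis unfolding smooth_on_def using Ck_on_SucD by blast
qed

lemma smooth_on_powr: "smooth_on {0<..} (\<lambda>x::real. x powr p)"
  by (rule smooth_on_real_family[where I=UNIV and F="\<lambda>p x. x powr p" and \<sigma>="\<lambda>p. p - 1" and c="\<lambda>p. p"])
     (auto intro!: derivative_eq_intros)

section \<open>Cutoff functions\<close>

text \<open>The flat function $e^{-1/x}$ is the case \<open>P = 1\<close>; the polynomial factor makes the family closed
  under differentiation.\<close>

definition flat_exp :: "real poly \<Rightarrow> real \<Rightarrow> real" where
  "flat_exp P x = (if x > 0 then poly P (1 / x) * exp (- (1 / x)) else 0)"

lemma poly_div_exp_tendsto_0:
  fixes P :: "real poly"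
  shows "((\<lambda>y. poly P y * exp (- y)) \<longlongrightarrow> 0) at_top"
proof -
  have "((\<lambda>y. \<Sum>i\<le>degree P. coeff P i * (y ^ i / exp y)) \<longlongrightarrow> (\<Sum>i\<le>degree P. coeff P i * 0)) at_top"
    by (intro tendsto_intros tendsto_power_div_exp_0)
  then show ?thesis
    by (simp add: poly_altdef sum_distrib_right exp_minus divide_inverse mult.assoc)
qed

text \<open>At the origin the difference quotient is again a member of the family, with \<open>P\<close> replaced by
  \<open>pCons 0 P\<close>, and all members tend to 0 there since the exponential beats every polynomial.\<close>

lemma flat_exp_has_derivative:
  "(flat_exp P has_real_derivative flat_exp (pCons 0 (pCons 0 (P - pderiv P))) x) (at x)"
proof -
  consider "x > 0" | "x < 0" | "x = 0" by linarith
  then show ?thesis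
  proof cases
    case 1
    have "((\<lambda>x. poly P (1 / x) * exp (- (1 / x))) has_real_derivative
        flat_exp (pCons 0 (pCons 0 (P - pderiv P))) x) (at x)"
      using 1 by (auto intro!: derivative_eq_intros DERIV_chain2[OF poly_DERIV]
          simp: flat_exp_def field_simps power2_eq_square)
    then show ?thesis
      by (rule DERIV_cong_ev[THEN iffD1, rotated -1])
         (use 1 in \<open>auto simp: flat_exp_def eventually_nhds intro!: exI[of _ "{0<..}"]\<close>)
  next
    case 2
    have "((\<lambda>x. 0) has_real_derivative 0) (at x)" by simp
    then show ?thesis
      by (rule DERIV_cong_ev[THEN iffD1, rotated -1])
         (use 2 in \<open>auto simp: flat_exp_def eventually_nhds intro!: exI[of _ "{..<0}"]\<close>)
  next
    case 3
    have "((\<lambda>h. poly (pCons 0 P) (inverse h) * exp (- inverse h)) \<longlongrightarrow> 0) (at_right 0)"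
      by (rule filterlim_compose[OF poly_div_exp_tendsto_0 filterlim_inverse_at_top_right])
    then have R: "((\<lambda>h. flat_exp P h / h) \<longlongrightarrow> 0) (at_right 0)"
      by (rule Lim_transform_eventually)
         (auto simp: eventually_at_right_field flat_exp_def field_simps intro!: exI[of _ 1])
    have L: "((\<lambda>h. flat_exp P h / h) \<longlongrightarrow> 0) (at_left 0)"
      by (rule Lim_transform_eventually[OF tendsto_const])
         (auto simp: eventually_at_left_field flat_exp_def intro!: exI[of _ "-1"])
    have "((\<lambda>h. flat_exp P h / h) \<longlongrightarrow> 0) (at 0)"
      using L R by (rule filterlim_split_at)
    moreover have "flat_exp P 0 = 0" "flat_exp Q 0 = 0" for Q
      by (auto simp: flat_exp_def)
    ultimately show ?thesis
      using 3 by (simp add: DERIV_def)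
  qed
qed

lemma smooth_on_flat_exp: "smooth_on UNIV (flat_exp P)"
  by (rule smooth_on_real_family[where I=UNIV and F=flat_exp and c="\<lambda>_. 1"
        and \<sigma>="\<lambda>P. pCons 0 (pCons 0 (P - pderiv P))"])
     (auto intro: flat_exp_has_derivative)

text \<open>Any thresholds strictly between $1/4$ and 1 would serve: the step is applied to squares, and the
  margin makes the derivatives of the cutoff vanish up to the boundary of the zones where it is
  constant.\<close>

lemma smooth_step:
  obtains b :: "real \<Rightarrow> real" where "smooth_on UNIV b" "\<And>x. 0 \<le> b x" "\<And>x. b x \<le> 1"
    "\<And>x. x \<le> 1/3 \<Longrightarrow> b x = 1" "\<And>x. x \<ge> 2/3 \<Longrightarrow> b x = 0"
proof
  let ?H = "flat_exp 1"
  let ?b = "\<lambda>x. ?H (2/3 - x) * (?H (2/3 - x) + ?H (x - 1/3)) powr (-1)"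
  have pos: "?H (2/3 - x) + ?H (x - 1/3) > 0" for x
    by (cases "x < 2/3") (auto simp: flat_exp_def add_pos_nonneg)
  have nonneg: "?H x \<ge> 0" for x by (simp add: flat_exp_def)
  have arg: "smooth_on UNIV (\<lambda>x::real. 2/3 - x)" "smooth_on UNIV (\<lambda>x::real. x - 1/3)"
    by (intro smooth_on_diff smooth_on_const smooth_on_ident open_UNIV)+
  have 1: "smooth_on UNIV (\<lambda>x. ?H (2/3 - x))" "smooth_on UNIV (\<lambda>x. ?H (x - 1/3))"
    using smooth_on_compose[OF _ _ smooth_on_flat_exp arg(1)]
      smooth_on_compose[OF _ _ smooth_on_flat_exp arg(2)] by auto
  then have "smooth_on UNIV (\<lambda>x. ?H (2/3 - x) + ?H (x - 1/3))"
    by (intro smooth_on_add) auto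
  then have "smooth_on UNIV (\<lambda>x. (?H (2/3 - x) + ?H (x - 1/3)) powr (-1))"
    using pos by (intro smooth_on_compose[OF _ _ smooth_on_powr]) auto
  with 1 show "smooth_on UNIV ?b"
    by (intro smooth_on_mult) auto
  show "0 \<le> ?b x" for x
    using nonneg[of "2/3 - x"] by simp
  have eq: "?b x = ?H (2/3 - x) / (?H (2/3 - x) + ?H (x - 1/3))" for x
    using pos[of x] powr_minus_divide[of "?H (2/3 - x) + ?H (x - 1/3)" 1] by (simp only: powr_one less_imp_le) simp
  show "?b x \<le> 1" for x
    unfolding eq using nonneg[of "x - 1/3"] pos[of x] by (simp add: divide_le_eq_1)
  show "?b x = 1" if "x \<le> 1/3" for x
    unfolding eq using that pos[of x] by (simp add: flat_exp_def)
  show "?b x = 0" if "x \<ge> 2/3" for x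
    using that by (simp add: flat_exp_def)
qed

lemma D_t_eqI: "(w has_derivative D) (at z) \<Longrightarrow> D_t w z = D (1, 0)"
  unfolding D_t_def using frechet_derivative_at by metis

lemma D_x_eqI: "(w has_derivative D) (at z) \<Longrightarrow> D_x i w z = D (0, axis i 1)"
  unfolding D_x_def using frechet_derivative_at by metis

lemma continuous_on_D:
  assumes "smooth_on \<Omega> w"
  shows "continuous_on \<Omega> (D_t w)" "continuous_on \<Omega> (D_x i w)"
  using smooth_on_continuous_on[OF smooth_on_frechet_derivative[OF assms]]
  by (simp_all add: D_t_def[abs_def] D_x_def[abs_def])

lemma D_eq_0_open:
  assumes "open U" "z \<in> U" "\<And>z. z \<in> U \<Longrightarrow> w z = c"
  shows "D_t w z = 0" "D_x i w z = 0"
proof -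
  have "((\<lambda>z. c) has_derivative (\<lambda>_. 0)) (at z)" by simp
  then have "(w has_derivative (\<lambda>_. 0)) (at z)"
    by (rule has_derivative_transform_within_open) (use assms in auto)
  then show "D_t w z = 0" "D_x i w z = 0"
    by (simp_all add: D_t_eqI D_x_eqI)
qed

lemma smooth_norm_sq: "smooth_on UNIV (\<lambda>x::'a::euclidean_space. (norm x)\<^sup>2)"
proof -
  have "smooth_on UNIV (\<lambda>x::'a. \<Sum>b\<in>Basis. (x \<bullet> b)\<^sup>2)"
    by (intro smooth_on_sum smooth_on_power smooth_on_bounded_linear bounded_linear_inner_left) auto
  moreover have "(\<Sum>b\<in>Basis. (x \<bullet> b)\<^sup>2) = (norm x)\<^sup>2" for x :: 'a
    by (simp add: norm_eq_sqrt_inner euclidean_inner[of x x] power2_eq_square sum_nonneg)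
  ultimately show ?thesis by simp
qed

lemma smooth_on_linear_compose:
  fixes w :: "'b::real_normed_vector \<Rightarrow> real" and L :: "'a::real_normed_vector \<Rightarrow> 'b"
  assumes "bounded_linear L" "smooth_on UNIV w"
  shows "smooth_on UNIV (\<lambda>z. w (L z))"
proof -
  have "Ck_on k UNIV w \<Longrightarrow> Ck_on k UNIV (\<lambda>z. w (L z))" for k
  proof (induction k arbitrary: w)
    case 0
    then show ?case
      using bounded_linear.continuous_on[OF assms(1) continuous_on_id]
      by (auto intro: continuous_on_compose2)
  next
    case (Suc k)
    show ?case
    proof (rule Ck_on_SucI)
      show "((\<lambda>z. w (L z)) has_derivative (\<lambda>h. frechet_derivative w (at (L z)) (L h))) (at z)" for z
        using bounded_linear_imp_has_derivative[OF assms(1)] Ck_on_has_derivative[OF Suc.prems]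
        by (rule has_derivative_compose) simp
      show "Ck_on k UNIV (\<lambda>z. frechet_derivative w (at (L z)) (L h))" for h
      proof (rule Suc.IH)
        show "Ck_on k UNIV (\<lambda>y. frechet_derivative w (at y) (L h))"
          using Suc.prems by simp
      qed
    qed simp
  qed
  then show ?thesis
    using assms(2) by (simp add: smooth_on_def)
qed

definition scaled_cutoff :: "real \<Rightarrow> real \<Rightarrow> real \<Rightarrow> ('n::finite spacetime \<Rightarrow> real) \<Rightarrow> bool" where
  "scaled_cutoff K T R \<zeta> \<longleftrightarrow>
     smooth_on UNIV \<zeta> \<and> (\<forall>z. 0 \<le> \<zeta> z \<and> \<zeta> z \<le> 1) \<and>
     (\<forall>t x. \<bar>t\<bar> \<le> T/2 \<and> norm x \<le> R/2 \<longrightarrow> \<zeta> (t, x) = 1) \<and>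
     (\<forall>t x. \<bar>t\<bar> > T \<or> norm x > R \<longrightarrow> \<zeta> (t, x) = 0) \<and>
     (\<forall>t x. \<bar>t\<bar> \<le> T/2 \<and> norm x \<le> R/2 \<longrightarrow> D_t \<zeta> (t, x) = 0) \<and>
     (\<forall>t x i. norm x \<le> R/2 \<or> norm x \<ge> R \<longrightarrow> D_x i \<zeta> (t, x) = 0) \<and>
     (\<forall>z. \<bar>D_t \<zeta> z\<bar> \<le> K / T) \<and> (\<forall>z i. \<bar>D_x i \<zeta> z\<bar> \<le> K / R)"

text \<open>The cutoffs are the rescalings $\zeta_1(t/T, x/R)$ of one fixed function, so the bounds of their
  derivatives scale like $1/T$ and $1/R$. The spatial derivatives live on the open annulus
  $R/2 < |x| < R$, for all $t$: the only region where the coefficients are controlled.\<close>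

lemma spacetime_cutoff:
  obtains K where "K > 0" "\<forall>T>0. \<forall>R>0. \<exists>\<zeta> :: 'n::finite spacetime \<Rightarrow> real. scaled_cutoff K T R \<zeta>"
proof -
  obtain b :: "real \<Rightarrow> real" where b: "smooth_on UNIV b" "\<And>x. 0 \<le> b x" "\<And>x. b x \<le> 1"
    "\<And>x. x \<le> 1/3 \<Longrightarrow> b x = 1" "\<And>x. x \<ge> 2/3 \<Longrightarrow> b x = 0"
    by (rule smooth_step) blast
  define Z :: "'n spacetime \<Rightarrow> real" where "Z z = b ((fst z)\<^sup>2) * b ((norm (snd z))\<^sup>2)" for z
  have Zs: "smooth_on UNIV Z"
    unfolding Z_def
  proof (intro smooth_on_mult smooth_on_compose[OF _ _ b(1)])
    show "smooth_on UNIV (\<lambda>z::'n spacetime. (fst z)\<^sup>2)"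
      by (intro smooth_on_power smooth_on_bounded_linear bounded_linear_fst) simp
    show "smooth_on UNIV (\<lambda>z::'n spacetime. (norm (snd z))\<^sup>2)"
      by (rule smooth_on_linear_compose[OF bounded_linear_snd smooth_norm_sq])
  qed auto
  let ?U = "{z::'n spacetime. (fst z)\<^sup>2 < 1/3 \<and> (norm (snd z))\<^sup>2 < 1/3}"
  let ?V = "{z::'n spacetime. (fst z)\<^sup>2 > 2/3 \<or> (norm (snd z))\<^sup>2 > 2/3}"
  let ?W = "{z::'n spacetime. (norm (snd z))\<^sup>2 < 1/3}"
  have opens: "open ?U" "open ?V" "open ?W"
    unfolding Collect_conj_eq Collect_disj_eq
    by (intro open_Int open_Un open_Collect_less continuous_intros)+
  \<comment> \<open>\<open>Z\<close> is not constant near such a point, but it is constant along the spatial directions\<close>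
  have ZW: "D_x i Z z = 0" if "z \<in> ?W" for z i
  proof -
    have "(Z has_derivative frechet_derivative Z (at z)) (at z)"
      using Zs smooth_on_has_derivative by blast
    moreover have "((\<lambda>s. z + s *\<^sub>R (0, axis i 1)) has_derivative (\<lambda>s. s *\<^sub>R (0, axis i 1))) (at (0::real))"
      by (auto intro!: derivative_eq_intros)
    ultimately have "((\<lambda>s. Z (z + s *\<^sub>R (0, axis i 1))) has_derivative
        (\<lambda>s. frechet_derivative Z (at z) (s *\<^sub>R (0, axis i 1)))) (at (0::real))"
      using has_derivative_compose[of "\<lambda>s. z + s *\<^sub>R (0, axis i 1)" "\<lambda>s. s *\<^sub>R (0, axis i 1)" 0 UNIV
          Z "frechet_derivative Z (at z)"] by (simp add: zero_prod_def[symmetric])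
    moreover have "((\<lambda>s. Z (z + s *\<^sub>R (0, axis i 1))) has_derivative (\<lambda>s. 0)) (at (0::real))"
    proof (rule has_derivative_transform_within_open)
      let ?S = "{s::real. z + s *\<^sub>R (0, axis i 1) \<in> ?W}"
      show "open ?S"
        unfolding mem_Collect_eq by (intro open_Collect_less continuous_intros)
      show "0 \<in> ?S" using that by simp
      show "((\<lambda>s. b ((fst z)\<^sup>2)) has_derivative (\<lambda>s. 0)) (at (0::real))" by simp
      show "b ((fst z)\<^sup>2) = Z (z + s *\<^sub>R (0, axis i 1))" if "s \<in> ?S" for s
        using that by (simp add: Z_def b(4))
    qed
    ultimately have "(\<lambda>s::real. frechet_derivative Z (at z) (s *\<^sub>R (0, axis i 1))) = (\<lambda>s. 0)"
      by (rule has_derivative_unique)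
    from fun_cong[OF this, of 1] show ?thesis
      by (simp add: D_x_def)
  qed
  have ZV: "D_t Z z = 0" "D_x i Z z = 0" if "z \<in> ?V" for z i
    using that by (intro D_eq_0_open[OF opens(2) that, of Z 0]; auto simp: Z_def b(5))+
  have ZU: "D_t Z z = 0" if "z \<in> ?U" for z
    using that by (intro D_eq_0_open(1)[OF opens(1) that, of Z 1]) (auto simp: Z_def b(4))
  let ?C = "cball (0::real) 1 \<times> cball (0::real^'n) 1"
  have "compact ?C" by (intro compact_Times compact_cball)
  have outside: "z \<in> ?V" if "z \<notin> ?C" for z :: "'n spacetime"
  proof (rule ccontr)
    assume "z \<notin> ?V"
    then have "(fst z)\<^sup>2 \<le> 1\<^sup>2" "(norm (snd z))\<^sup>2 \<le> 1\<^sup>2" by auto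
    then have "\<bar>fst z\<bar> \<le> 1" "norm (snd z) \<le> 1" by (metis abs_le_square_iff abs_one one_power2, metis abs_le_square_iff abs_norm_cancel abs_one one_power2)
    then show False using that by (cases z) auto
  qed
  have bdd: "\<exists>B. \<forall>z. \<bar>g z\<bar> \<le> B" if "continuous_on UNIV g" "\<And>z. z \<in> ?V \<Longrightarrow> g z = 0"
    for g :: "'n spacetime \<Rightarrow> real"
  proof -
    have "bounded (g ` ?C)"
      using \<open>compact ?C\<close> that(1) by (meson compact_continuous_image compact_imp_bounded continuous_on_subset top_greatest)
    then obtain B where "\<And>z. z \<in> ?C \<Longrightarrow> \<bar>g z\<bar> \<le> B" by (auto simp: bounded_iff)
    then have "\<bar>g z\<bar> \<le> max B 0" for z
      using outside[of z] that(2)[of z] by (cases "z \<in> ?C") (auto simp: max.coboundedI1)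
    then show ?thesis by blast
  qed
  obtain B0 where B0: "\<And>z. \<bar>D_t Z z\<bar> \<le> B0"
    using bdd[of "D_t Z"] continuous_on_D[OF Zs] ZV(1) by blast
  have "\<forall>i. \<exists>B. \<forall>z. \<bar>D_x i Z z\<bar> \<le> B"
    using bdd continuous_on_D[OF Zs] ZV(2) by blast
  then obtain B1 where B1: "\<And>i z. \<bar>D_x i Z z\<bar> \<le> B1 i" by metis
  define K where "K = B0 + (\<Sum>i\<in>UNIV. B1 i) + 1"
  have B1_0: "B1 i \<ge> 0" for i
    using abs_ge_zero B1[of i undefined] by (rule order_trans)
  have B0_0: "B0 \<ge> 0"
    using abs_ge_zero B0[of undefined] by (rule order_trans)
  have "B1 i \<le> (\<Sum>i\<in>UNIV. B1 i)" for i
    using B1_0 by (intro member_le_sum) auto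
  moreover have "(\<Sum>i\<in>UNIV. B1 i) \<ge> 0" using B1_0 by (intro sum_nonneg) auto
  ultimately have K: "\<bar>D_t Z z\<bar> \<le> K" "\<bar>D_x i Z z\<bar> \<le> K" "K > 0" for z i
    using B0[of z] B1[of i z] B0_0 unfolding K_def by (smt (verit))+
  show ?thesis
  proof (rule that[OF K(3)], intro allI impI)
    fix T R :: real assume T: "T > 0" and R: "R > 0"
    let ?L = "\<lambda>z::'n spacetime. (fst z / T, snd z /\<^sub>R R)"
    define \<zeta> where "\<zeta> z = Z (?L z)" for z
    have L: "bounded_linear ?L"
      using bounded_linear_Pair[OF bounded_linear_compose[OF bounded_linear_divide bounded_linear_fst]
        bounded_linear_compose[OF bounded_linear_scaleR_right bounded_linear_snd]] .
    have D: "(\<zeta> has_derivative (\<lambda>h. frechet_derivative Z (at (?L z)) (?L h))) (at z)" for z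
      unfolding \<zeta>_def
      using bounded_linear_imp_has_derivative[OF L]
      by (rule has_derivative_compose) (use Zs smooth_on_has_derivative in blast)
    have scale: "frechet_derivative Z (at z) (c *\<^sub>R h) = c * frechet_derivative Z (at z) h" for z c h
      using linear_scale[OF has_derivative_linear[OF smooth_on_has_derivative[OF Zs]]] by simp
    have Dt: "D_t \<zeta> z = D_t Z (?L z) / T" for z
      using scale[of "?L z" "1/T" "(1, 0)"] D_t_eqI[OF D[of z]] by (simp add: D_t_def)
    have Dx: "D_x i \<zeta> z = D_x i Z (?L z) / R" for z i
      using scale[of "?L z" "1/R" "(0, axis i 1)"] D_x_eqI[OF D[of z], of i] by (simp add: D_x_def divide_inverse)
    have sq: "(t / T)\<^sup>2 < 1/3" if "\<bar>t\<bar> \<le> T/2" for t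
    proof -
      have "\<bar>t / T\<bar> \<le> \<bar>1/2\<bar>" using that T by (simp add: field_simps abs_div)
      then have "(t / T)\<^sup>2 \<le> (1/2)\<^sup>2" by (simp only: abs_le_square_iff)
      then show ?thesis by (rule le_less_trans) (simp add: power2_eq_square)
    qed
    have sqx: "(norm (x /\<^sub>R R))\<^sup>2 < 1/3" if "norm x \<le> R/2" for x :: "real^'n"
    proof -
      have "\<bar>norm (x /\<^sub>R R)\<bar> \<le> \<bar>1/2\<bar>" using that R by (simp add: field_simps)
      then have "(norm (x /\<^sub>R R))\<^sup>2 \<le> (1/2)\<^sup>2" by (simp only: abs_le_square_iff)
      then show ?thesis by (rule le_less_trans) (simp add: power2_eq_square)
    qed
    have sq': "(t / T)\<^sup>2 > 2/3" if "\<bar>t\<bar> \<ge> T" for t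
    proof -
      have "\<bar>1\<bar> \<le> \<bar>t / T\<bar>" using that T by (simp add: field_simps abs_div)
      then have "1\<^sup>2 \<le> (t / T)\<^sup>2" by (simp only: abs_le_square_iff)
      then show ?thesis unfolding one_power2 by linarith
    qed
    have sqx': "(norm (x /\<^sub>R R))\<^sup>2 > 2/3" if "norm x \<ge> R" for x :: "real^'n"
    proof -
      have "\<bar>1\<bar> \<le> \<bar>norm (x /\<^sub>R R)\<bar>" using that R by (simp add: field_simps)
      then have "1\<^sup>2 \<le> (norm (x /\<^sub>R R))\<^sup>2" by (simp only: abs_le_square_iff)
      then show ?thesis unfolding one_power2 by linarith
    qed
    have "smooth_on UNIV \<zeta>"
      using smooth_on_linear_compose[OF L Zs] by (simp add: \<zeta>_def[abs_def])
    moreover have "0 \<le> \<zeta> z \<and> \<zeta> z \<le> 1" for z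
      by (simp add: \<zeta>_def Z_def b mult_le_one)
    moreover have "\<zeta> (t, x) = 1" if "\<bar>t\<bar> \<le> T/2 \<and> norm x \<le> R/2" for t x
      using sq[of t] sqx[of x] that by (simp add: \<zeta>_def Z_def b(4))
    moreover have "\<zeta> (t, x) = 0" if "\<bar>t\<bar> > T \<or> norm x > R" for t x
      using sq'[of t] sqx'[of x] that by (auto simp: \<zeta>_def Z_def b(5))
    moreover have "D_t \<zeta> (t, x) = 0" if "\<bar>t\<bar> \<le> T/2 \<and> norm x \<le> R/2" for t x
      using sq[of t] sqx[of x] that ZU[of "?L (t, x)"] by (simp add: Dt)
    moreover have "D_x i \<zeta> (t, x) = 0" if "norm x \<le> R/2 \<or> norm x \<ge> R" for t x i
      using sqx[of x] sqx'[of x] that ZW[of "?L (t, x)" i] ZV(2)[of "?L (t, x)" i] by (auto simp: Dx)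
    moreover have "\<bar>D_t \<zeta> z\<bar> \<le> K / T" for z
      using K(1)[of "?L z"] T by (simp add: Dt divide_right_mono)
    moreover have "\<bar>D_x i \<zeta> z\<bar> \<le> K / R" for z i
      using K(2)[of i "?L z"] R by (simp add: Dx divide_right_mono)
    ultimately show "\<exists>\<zeta> :: 'n spacetime \<Rightarrow> real. scaled_cutoff K T R \<zeta>"
      unfolding scaled_cutoff_def by blast
  qed
qed

section \<open>A slowly decreasing profile\<close>

lemma real_antiderivative:
  fixes f :: "real \<Rightarrow> real"
  assumes "\<And>x. isCont f x"
  obtains F where "\<And>x. (F has_real_derivative f x) (at x)" "F 0 = 0"
proof -
  obtain G where "\<And>x. (G has_real_derivative f x) (at x)"
    using einterval_antiderivative[of "-\<infinity>" "\<infinity>" f] assms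
    by (auto simp: has_real_derivative_iff_has_vector_derivative)
  then have "((\<lambda>x. G x - G 0) has_real_derivative f x) (at x)" for x
    by (auto intro!: derivative_eq_intros)
  then show ?thesis by (rule that) simp
qed

text \<open>Since $(1+x)^2 \le 2(1+x^2)$, the derivative is dominated by $2^{p/2}(1+x)^{-p}$, whose
  antiderivative is explicit and bounded because \<open>p > 1\<close>.\<close>

lemma antiderivative_bounded:
  fixes G :: "real \<Rightarrow> real"
  assumes "p > 1" "\<And>x. (G has_real_derivative (1 + x\<^sup>2) powr (- p / 2)) (at x)" "s \<ge> 0"
  shows "G s - G 0 \<le> 2 powr (p / 2) / (p - 1)"
proof -
  define C where "C = 2 powr (p / 2) / (p - 1)"
  let ?E = "\<lambda>x. G x + C * (1 + x) powr (1 - p)"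
  have "?E s \<le> ?E 0"
  proof (rule DERIV_nonpos_imp_nonincreasing[OF assms(3)])
    fix x :: real assume x: "0 \<le> x" "x \<le> s"
    let ?d = "(1 + x\<^sup>2) powr (- p / 2) + C * ((1 - p) * (1 + x) powr (- p))"
    have D: "(?E has_real_derivative ?d) (at x)"
      using x by (auto intro!: derivative_eq_intros assms(2))
    have "((1 + x)\<^sup>2 / 2) powr (p / 2) \<le> (1 + x\<^sup>2) powr (p / 2)"
    proof (rule powr_mono2)
      have "0 \<le> (1 - x)\<^sup>2" by simp
      then show "(1 + x)\<^sup>2 / 2 \<le> 1 + x\<^sup>2" by (simp add: power2_eq_square algebra_simps)
    qed (use assms in auto)
    moreover have "((1 + x)\<^sup>2 / 2) powr (p / 2) = (1 + x) powr p / 2 powr (p / 2)"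
      using x by (simp add: powr_divide powr_powr flip: powr_numeral)
    ultimately have "(1 + x) powr p / 2 powr (p / 2) \<le> (1 + x\<^sup>2) powr (p / 2)" by simp
    moreover have "0 < 1 + x\<^sup>2" by (simp add: add_pos_nonneg)
    ultimately have "(1 + x\<^sup>2) powr (- p / 2) \<le> 2 powr (p / 2) * (1 + x) powr (- p)"
      using x by (simp add: powr_minus field_simps)
    moreover have "C * ((1 - p) * (1 + x) powr (- p)) = - (2 powr (p / 2) * (1 + x) powr (- p))"
      using assms(1) unfolding C_def by (simp add: field_simps)
    ultimately have "?d \<le> 0" by linarith
    with D show "\<exists>y. (?E has_real_derivative y) (at x) \<and> y \<le> 0" by blast
  qed
  moreover have "C \<ge> 0" unfolding C_def using assms(1) by simp
  ultimately show ?thesis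
    unfolding C_def[symmetric] by (simp add: algebra_simps) (smt (verit) mult_nonneg_nonneg powr_ge_zero)
qed

text \<open>The test functions are of the form $f(w)\,\zeta^m$. Three properties of $f$ matter. It is bounded
  below by 1, so the reaction term is not weakened; it decreases, which turns the second-order term
  into an energy of good sign with weight $-f'$; and $1/|f'|$ grows only like the power \<open>p\<close>, which is
  what the cross terms cost after the energy has been absorbed. Choosing \<open>p\<close> above 1 keeps $f$ bounded, and
  choosing \<open>p\<close> below \<open>q\<close> makes that cost subcritical. Being defined and decreasing on the whole
  line, $f$ accepts approximations of $w$ of either sign. The parameter \<open>\<epsilon>\<close> fixes the size
  of $w$ at which the profile bends.\<close>

definition profile :: "real \<Rightarrow> real \<Rightarrow> real \<Rightarrow> (real \<Rightarrow> real) \<Rightarrow> (real \<Rightarrow> real) \<Rightarrow> bool" where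
  "profile \<epsilon> p M f F \<longleftrightarrow> smooth_on UNIV f \<and>
     (\<forall>s. 1 \<le> f s \<and> f s \<le> M) \<and>
     (\<forall>s. (f has_real_derivative - (1 / \<epsilon>) * (1 + (s / \<epsilon>)\<^sup>2) powr (- p / 2)) (at s)) \<and>
     (\<forall>s. (F has_real_derivative f s) (at s)) \<and> (\<forall>s. \<bar>F s\<bar> \<le> M * \<bar>s\<bar>)"

lemma decreasing_profile:
  fixes p :: real
  assumes "p > 1"
  obtains M where "M \<ge> 1" "\<forall>\<epsilon>>0. \<exists>f F. profile \<epsilon> p M f F"
proof -
  let ?g = "\<lambda>s::real. (1 + s\<^sup>2) powr (- p / 2)"
  have pos: "1 + s\<^sup>2 > 0" for s :: real by (simp add: add_pos_nonneg)
  have g: "smooth_on UNIV ?g"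
    using pos
    by (intro smooth_on_compose[OF _ _ smooth_on_powr] smooth_on_add smooth_on_const smooth_on_power smooth_on_ident) auto
  have "isCont ?g x" for x
    using smooth_on_continuous_on[OF g] by (simp add: continuous_on_eq_continuous_at)
  then obtain G where G: "\<And>x. (G has_real_derivative ?g x) (at x)" "G 0 = 0"
    by (rule real_antiderivative) blast
  define C where "C = 2 powr (p / 2) / (p - 1)"
  have C: "C \<ge> 0" unfolding C_def using assms by simp
  have up: "H s \<le> C" if "\<And>x. (H has_real_derivative ?g x) (at x)" "H 0 = 0" for s and H :: "real \<Rightarrow> real"
  proof (cases "s \<ge> 0")
    case True
    then show ?thesis
      using antiderivative_bounded[OF assms that(1), of s] that(2) by (simp add: C_def)
  next
    case False
    then have "H s \<le> H 0"
      using that(1) by (intro DERIV_nonneg_imp_nondecreasing[of s 0 H]) (auto intro!: exI)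
    then show ?thesis using that(2) C by simp
  qed
  have "((\<lambda>x. - G (- x)) has_real_derivative ?g x) (at x)" for x
  proof -
    have "((\<lambda>x. G (- x)) has_real_derivative ?g (- x) * (- 1)) (at x)"
      by (rule DERIV_chain2[OF G(1)]) (auto intro!: derivative_eq_intros)
    from DERIV_minus[OF this] show ?thesis by simp
  qed
  from up[OF this] G(2) have "- G (- s) \<le> C" for s by simp
  from this[of "- s" for s] have lo: "- C \<le> G s" for s
    by (metis minus_le_iff minus_minus)
  have hi: "G s \<le> C" for s using up[OF G] .
  have Gs: "smooth_on UNIV G"
    using smooth_on_antiderivative[OF _ g G(1)] by simp
  show ?thesis
  proof (rule that[of "1 + 2 * C"], goal_cases)
    case 1
    show ?case using C by simp
  next
    case 2
    show ?case
    proof (intro allI impI)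
      fix \<epsilon> :: real assume \<epsilon>: "\<epsilon> > 0"
      define f where "f s = 1 + C - G (s / \<epsilon>)" for s
      have f_smooth: "smooth_on UNIV f"
      proof -
        have "smooth_on UNIV (\<lambda>s. G (s / \<epsilon>))"
          by (rule smooth_on_compose[OF _ _ Gs]) (auto intro: smooth_on_bounded_linear bounded_linear_divide)
        then show ?thesis
          unfolding f_def by (intro smooth_on_diff smooth_on_const) auto
      qed
      have f_bds: "1 \<le> f s" "f s \<le> 1 + 2 * C" for s
        using lo[of "s / \<epsilon>"] hi[of "s / \<epsilon>"] by (auto simp: f_def)
      have f_D: "(f has_real_derivative - (1 / \<epsilon>) * (1 + (s / \<epsilon>)\<^sup>2) powr (- p / 2)) (at s)" for s
      proof -
        have "((\<lambda>s. G (s / \<epsilon>)) has_real_derivative ?g (s / \<epsilon>) * (1 / \<epsilon>)) (at s)"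
          by (rule DERIV_chain2[OF G(1)]) (use \<epsilon> in \<open>auto intro!: derivative_eq_intros\<close>)
        then show ?thesis
          unfolding f_def by (auto intro!: derivative_eq_intros)
      qed
      have "isCont f s" for s using f_D DERIV_isCont by blast
      then obtain F where F: "\<And>x. (F has_real_derivative f x) (at x)" "F 0 = 0"
        by (rule real_antiderivative) blast
      have F_bd: "\<bar>F s\<bar> \<le> (1 + 2 * C) * \<bar>s\<bar>" for s
      proof -
        have "norm (F s - F 0) \<le> (1 + 2 * C) * norm (s - 0)"
        proof (rule field_differentiable_bound[of UNIV])
          show "norm (f x) \<le> 1 + 2 * C" for x using f_bds[of x] by simp
        qed (use F in auto)
        then show ?thesis using F(2) by simp
      qed
      show "\<exists>f F. profile \<epsilon> p (1 + 2 * C) f F"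
        unfolding profile_def using f_smooth f_bds f_D F F_bd by blast
    qed
  qed
qed

section \<open>Integration by parts in time\<close>

text \<open>By Fubini's theorem the integral is computed along the lines in the time direction, where the
  fundamental theorem of calculus gives 0. Since \<open>G\<close> vanishes outside \<open>K\<close> it may be
  differentiated on all of spacetime, although it is only known to be differentiable on \<open>\<Omega>\<close>.\<close>

lemma integral_D_t_eq_0:
  fixes G :: "'n::finite spacetime \<Rightarrow> real"
  assumes "open \<Omega>" "compact K" "K \<subseteq> \<Omega>" "\<And>z. z \<in> \<Omega> \<Longrightarrow> G differentiable (at z)"
    "continuous_on \<Omega> (D_t G)" "\<And>z. z \<notin> K \<Longrightarrow> G z = 0"
  shows "integrable (lebesgue_on \<Omega>) (D_t G)" "(LINT z|lebesgue_on \<Omega>. D_t G z) = 0"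
proof -
  have K: "open (- K)" using assms(2) by (simp add: compact_imp_closed open_Compl)
  have g0: "D_t G z = 0" if "z \<notin> K" for z
    using that by (intro D_eq_0_open[OF K, of _ _ 0]) (auto simp: assms(6))
  have cont: "continuous_on UNIV (D_t G)"
  proof -
    have "continuous_on (- K) (D_t G)"
      using g0 by (subst continuous_on_cong[OF refl, of _ _ "\<lambda>_. 0"]) auto
    then have "continuous_on (\<Omega> \<union> - K) (D_t G)"
      using assms(1,5) K by (intro continuous_on_open_Un)
    moreover have "\<Omega> \<union> - K = UNIV" using assms(3) by auto
    ultimately show ?thesis by simp
  qed
  have diff: "(G has_derivative frechet_derivative G (at z)) (at z)" for z
  proof (cases "z \<in> K")
    case True
    then have "G differentiable (at z)" using assms(3,4) by blast
    then show ?thesis by (simp only: frechet_derivative_works)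
  next
    case False
    have "((\<lambda>z. 0) has_derivative (\<lambda>_. 0)) (at z)" by simp
    then have "(G has_derivative (\<lambda>_. 0)) (at z)"
      by (rule has_derivative_transform_within_open[OF _ K]) (use False assms(6) in auto)
    then show ?thesis
      using differentiableI frechet_derivative_works by blast
  qed
  have "integrable lborel (\<lambda>z. indicator K z *\<^sub>R D_t G z)"
    using assms(2) cont by (intro borel_integrable_compact) (auto intro: continuous_on_subset)
  moreover have "(\<lambda>z. indicator K z *\<^sub>R D_t G z) = D_t G"
    using g0 by (auto split: split_indicator)
  ultimately have int: "integrable lborel (D_t G)" by simp
  obtain L where L: "\<And>z. z \<in> K \<Longrightarrow> norm z \<le> L" "L \<ge> 0"
    using compact_imp_bounded[OF assms(2)] by (metis bounded_iff norm_ge_zero order_trans le_cases)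
  have fst_K: "z \<notin> K" if "\<bar>fst z\<bar> > L" for z
    using L(1)[of z] that norm_fst_le[of "fst z" "snd z"] by auto
  have inner: "(LBINT t. D_t G (t, x)) = 0" for x
  proof -
    have D: "((\<lambda>t. G (t, x)) has_real_derivative D_t G (t, x)) (at t)" for t
    proof -
      have "((\<lambda>t. (t, x)) has_derivative (\<lambda>h. (h, 0))) (at t)"
        by (auto intro!: derivative_eq_intros)
      then have "((\<lambda>t. G (t, x)) has_derivative (\<lambda>h. frechet_derivative G (at (t, x)) (h, 0))) (at t)"
        by (rule has_derivative_compose) (rule diff)
      moreover have "frechet_derivative G (at (t, x)) (h, 0) = D_t G (t, x) * h" for h
        using linear_scale[OF has_derivative_linear[OF diff], of "(t, x)" h "(1, 0)"]
        by (simp add: D_t_def)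
      ultimately show ?thesis by (simp add: has_field_derivative_def)
    qed
    have "(LBINT t. D_t G (t, x) * indicator {-(L+1)..L+1} t) = G (L+1, x) - G (-(L+1), x)"
    proof (rule integral_FTC_Icc_real)
      have "continuous_on UNIV (\<lambda>t. D_t G (t, x))"
        by (rule continuous_on_compose2[OF cont]) (auto intro!: continuous_intros)
      then show "isCont (\<lambda>t. D_t G (t, x)) t" for t
        by (simp add: continuous_on_eq_continuous_at)
    qed (use D L(2) in auto)
    also have "\<dots> = 0"
      using fst_K[of "(L+1, x)"] fst_K[of "(-(L+1), x)"] L(2) by (simp add: assms(6))
    also have "(\<lambda>t. D_t G (t, x) * indicator {-(L+1)..L+1} t) = (\<lambda>t. D_t G (t, x))"
    proof
      fix t
      show "D_t G (t, x) * indicator {-(L+1)..L+1} t = D_t G (t, x)"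
        using fst_K[of "(t, x)"] g0[of "(t, x)"] by (cases "\<bar>t\<bar> > L") (auto split: split_indicator)
    qed
    finally show ?thesis .
  qed
  have "integral\<^sup>L lborel (D_t G) = integral\<^sup>L (lborel \<Otimes>\<^sub>M lborel) (case_prod (\<lambda>t x. D_t G (t, x)))"
    by (simp add: lborel_prod)
  also have "\<dots> = (LBINT x. LBINT t. D_t G (t, x))"
    using int by (intro lborel_pair.integral_snd[symmetric]) (simp add: lborel_prod)
  also have "\<dots> = 0" by (simp add: inner)
  finally have zero: "integral\<^sup>L lborel (D_t G) = 0" .
  have meas: "D_t G \<in> borel_measurable lborel"
    using int by (rule borel_measurable_integrable)
  have ind: "(\<lambda>z. indicator \<Omega> z *\<^sub>R D_t G z) = D_t G"
  proof
    fix z show "indicator \<Omega> z *\<^sub>R D_t G z = D_t G z"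
      using g0[of z] assms(3) by (cases "z \<in> K") (auto simp: indicator_def)
  qed
  have \<Omega>: "\<Omega> \<inter> space lebesgue \<in> sets lebesgue"
    using assms(1) by simp
  show "integrable (lebesgue_on \<Omega>) (D_t G)"
    unfolding integrable_restrict_space[OF \<Omega>] ind using integrable_completion[OF meas] int by simp
  show "(LINT z|lebesgue_on \<Omega>. D_t G z) = 0"
    unfolding integral_restrict_space[OF \<Omega>] ind using integral_completion[OF meas] zero by simp
qed

section \<open>The quadratic form of the coefficients\<close>

definition bil :: "real ^ 'n ^ 'n \<Rightarrow> real ^ 'n \<Rightarrow> real ^ 'n::finite \<Rightarrow> real" where
  "bil m \<xi> \<eta> = (\<Sum>i\<in>UNIV. \<Sum>j\<in>UNIV. m $ i $ j * \<xi> $ i * \<eta> $ j)"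

definition grad_x :: "('n::finite spacetime \<Rightarrow> real) \<Rightarrow> 'n spacetime \<Rightarrow> real ^ 'n" where
  "grad_x w z = (\<chi> i. D_x i w z)"

text \<open>What the standing assumptions say about the coefficients at almost every point.\<close>

definition form_bounds :: "real ^ 'n ^ 'n::finite \<Rightarrow> real \<Rightarrow> bool" where
  "form_bounds m b \<longleftrightarrow> (\<forall>\<xi> \<eta>. bil m \<xi> \<eta> = bil m \<eta> \<xi>) \<and>
     (\<forall>\<xi>. 0 \<le> bil m \<xi> \<xi> \<and> bil m \<xi> \<xi> \<le> b * (norm \<xi>)\<^sup>2)"

lemma a_form_bil: "a_form a f g z = bil (a z) (grad_x f z) (grad_x g z)"
  by (simp add: a_form_def bil_def grad_x_def)

lemma bil_add:
  "bil m (\<xi> + \<xi>') \<eta> = bil m \<xi> \<eta> + bil m \<xi>' \<eta>"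
  "bil m \<xi> (\<eta> + \<eta>') = bil m \<xi> \<eta> + bil m \<xi> \<eta>'"
  by (simp_all add: bil_def ring_distribs sum.distrib)

lemma bil_diff:
  "bil m (\<xi> - \<xi>') \<eta> = bil m \<xi> \<eta> - bil m \<xi>' \<eta>"
  "bil m \<xi> (\<eta> - \<eta>') = bil m \<xi> \<eta> - bil m \<xi> \<eta>'"
  by (simp_all add: bil_def left_diff_distrib right_diff_distrib sum_subtractf)

lemma bil_scale:
  "bil m (c *\<^sub>R \<xi>) \<eta> = c * bil m \<xi> \<eta>"
  "bil m \<xi> (c *\<^sub>R \<eta>) = c * bil m \<xi> \<eta>"
  by (simp_all add: bil_def sum_distrib_left mult_ac)

lemma bil_zero: "bil m 0 \<eta> = 0" "bil m \<xi> 0 = 0"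
  by (simp_all add: bil_def)

lemmas bil_simps = bil_add bil_diff bil_scale bil_zero

lemma form_bounds_AE:
  assumes "standing_assumptions a A"
  shows "AE z in lebesgue. form_bounds (a z) (A z)"
proof -
  have "AE z in lebesgue. \<forall>i j. a z $ i $ j = a z $ j $ i"
    "AE z in lebesgue. \<forall>\<xi>. 0 \<le> bil (a z) \<xi> \<xi> \<and> bil (a z) \<xi> \<xi> \<le> A z * (norm \<xi>)\<^sup>2"
    using assms by (simp_all add: standing_assumptions_def bil_def)
  then show ?thesis
  proof eventually_elim
    case (elim z)
    have "bil (a z) \<xi> \<eta> = bil (a z) \<eta> \<xi>" for \<xi> \<eta>
    proof -
      have "bil (a z) \<xi> \<eta> = (\<Sum>j\<in>UNIV. \<Sum>i\<in>UNIV. a z $ i $ j * \<xi> $ i * \<eta> $ j)"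
        unfolding bil_def by (rule sum.swap)
      also have "\<dots> = bil (a z) \<eta> \<xi>"
        unfolding bil_def using elim(1) by (intro sum.cong refl) (metis mult.commute mult.assoc)
      finally show ?thesis .
    qed
    with elim(2) show ?case by (simp add: form_bounds_def)
  qed
qed

lemma bil_nonneg: "form_bounds m b \<Longrightarrow> 0 \<le> bil m \<xi> \<xi>"
  by (simp add: form_bounds_def)

lemma bil_sym: "form_bounds m b \<Longrightarrow> bil m \<xi> \<eta> = bil m \<eta> \<xi>"
  by (simp add: form_bounds_def)

text \<open>The form is nonnegative at $s\xi + \eta$ and at $s\xi - \eta$. In this weighted form the
  Cauchy-Schwarz inequality can be integrated directly.\<close>

lemma bil_young:
  assumes "form_bounds m b" "s > 0"
  shows "2 * \<bar>bil m \<xi> \<eta>\<bar> \<le> s * bil m \<xi> \<xi> + bil m \<eta> \<eta> / s"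
proof -
  have "0 \<le> bil m (s *\<^sub>R \<xi> - \<eta>) (s *\<^sub>R \<xi> - \<eta>)" "0 \<le> bil m (s *\<^sub>R \<xi> + \<eta>) (s *\<^sub>R \<xi> + \<eta>)"
    using assms(1) bil_nonneg by blast+
  then have "2 * s * \<bar>bil m \<xi> \<eta>\<bar> \<le> s * s * bil m \<xi> \<xi> + bil m \<eta> \<eta>"
    using bil_sym[OF assms(1), of \<eta> \<xi>] assms(2)
    by (simp add: bil_simps abs_if algebra_simps)
  then show ?thesis using assms(2) by (simp add: field_simps)
qed

lemma bil_add_le:
  assumes "form_bounds m b"
  shows "bil m (\<xi> + \<eta>) (\<xi> + \<eta>) \<le> 2 * bil m \<xi> \<xi> + 2 * bil m \<eta> \<eta>"
    and "bil m (\<xi> - \<eta>) (\<xi> - \<eta>) \<le> 2 * bil m \<xi> \<xi> + 2 * bil m \<eta> \<eta>"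
  using bil_young[OF assms, of 1 \<xi> \<eta>] bil_sym[OF assms, of \<eta> \<xi>]
  by (simp_all add: bil_simps)

lemma
  assumes "f differentiable (at z)" "g differentiable (at z)"
  shows D_t_diff: "D_t (\<lambda>z. f z - g z) z = D_t f z - D_t g z"
    and grad_x_diff: "grad_x (\<lambda>z. f z - g z) z = grad_x f z - grad_x g z"
    and D_t_mult: "D_t (\<lambda>z. f z * g z) z = f z * D_t g z + D_t f z * g z"
    and grad_x_mult: "grad_x (\<lambda>z. f z * g z) z = f z *\<^sub>R grad_x g z + g z *\<^sub>R grad_x f z"
proof -
  have f: "(f has_derivative frechet_derivative f (at z)) (at z)"
    and g: "(g has_derivative frechet_derivative g (at z)) (at z)"
    using assms by (simp_all add: frechet_derivative_works)
  show "D_t (\<lambda>z. f z - g z) z = D_t f z - D_t g z"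
    using D_t_eqI[OF has_derivative_diff[OF f g]] by (simp add: D_t_def)
  show "grad_x (\<lambda>z. f z - g z) z = grad_x f z - grad_x g z"
    using D_x_eqI[OF has_derivative_diff[OF f g]] by (simp add: grad_x_def D_x_def vec_eq_iff)
  show "D_t (\<lambda>z. f z * g z) z = f z * D_t g z + D_t f z * g z"
    using D_t_eqI[OF has_derivative_mult[OF f g]] by (simp add: D_t_def)
  show "grad_x (\<lambda>z. f z * g z) z = f z *\<^sub>R grad_x g z + g z *\<^sub>R grad_x f z"
    using D_x_eqI[OF has_derivative_mult[OF f g]] by (simp add: grad_x_def D_x_def vec_eq_iff)
qed

lemma
  assumes "w differentiable (at z)" "(f has_real_derivative d) (at (w z))"
  shows differentiable_chain_real: "(\<lambda>z. f (w z)) differentiable (at z)"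
    and D_t_chain: "D_t (\<lambda>z. f (w z)) z = d * D_t w z"
    and grad_x_chain: "grad_x (\<lambda>z. f (w z)) z = d *\<^sub>R grad_x w z"
proof -
  have "(w has_derivative frechet_derivative w (at z)) (at z)"
    using assms(1) by (simp add: frechet_derivative_works)
  moreover have "(f has_derivative (*) d) (at (w z))"
    using assms(2) by (simp add: has_field_derivative_def)
  ultimately have D: "((\<lambda>z. f (w z)) has_derivative (\<lambda>h. d * frechet_derivative w (at z) h)) (at z)"
    by (rule has_derivative_compose)
  then show "(\<lambda>z. f (w z)) differentiable (at z)" by (rule differentiableI)
  show "D_t (\<lambda>z. f (w z)) z = d * D_t w z"
    using D_t_eqI[OF D] by (simp add: D_t_def)
  show "grad_x (\<lambda>z. f (w z)) z = d *\<^sub>R grad_x w z"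
    using D_x_eqI[OF D] by (simp add: D_x_def grad_x_def vec_eq_iff)
qed

lemma smooth_on_differentiable: "smooth_on \<Omega> f \<Longrightarrow> z \<in> \<Omega> \<Longrightarrow> f differentiable (at z)"
  using smooth_on_has_derivative differentiableI by blast

section \<open>Smooth elements of the energy space\<close>

abbreviation energy :: "('n::finite spacetime \<Rightarrow> real ^ 'n ^ 'n) \<Rightarrow> 'n spacetime set \<Rightarrow>
    ('n spacetime \<Rightarrow> real) \<Rightarrow> real" where
  "energy a \<Omega> w \<equiv> (LINT z|lebesgue_on \<Omega>. a_form a w w z)"

abbreviation signed_powr :: "real \<Rightarrow> real \<Rightarrow> real" where
  "signed_powr q x \<equiv> \<bar>x\<bar> powr (q - 1) * x"

lemma set_integral_lebesgue_on:
  assumes "open \<Omega>"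
  shows "(LINT z:\<Omega>|lebesgue. f z) = (LINT z|lebesgue_on \<Omega>. (f z :: real))"
    and "set_integrable lebesgue \<Omega> f \<longleftrightarrow> integrable (lebesgue_on \<Omega>) f"
  using assms by (simp_all add: set_lebesgue_integral_def set_integrable_def
      integral_restrict_space integrable_restrict_space)

lemma AE_lebesgue_on: "open \<Omega> \<Longrightarrow> AE z in lebesgue. P z \<Longrightarrow> AE z in lebesgue_on \<Omega>. P z"
  by (subst AE_restrict_space_iff) auto

lemma AE_lebesgue_on_mem: "open \<Omega> \<Longrightarrow> AE z in lebesgue_on \<Omega>. z \<in> \<Omega>"
  by (subst AE_restrict_space_iff) auto

lemma measurable_lebesgue_on: "f \<in> borel_measurable lebesgue \<Longrightarrow> f \<in> borel_measurable (lebesgue_on \<Omega>)"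
  by (rule measurable_restrict_space1)

lemma
  assumes "open \<Omega>" "smooth_on \<Omega> w"
  shows smooth_on_measurable: "w \<in> borel_measurable (lebesgue_on \<Omega>)"
    and smooth_on_measurable_D_t: "D_t w \<in> borel_measurable (lebesgue_on \<Omega>)"
    and smooth_on_measurable_D_x: "D_x i w \<in> borel_measurable (lebesgue_on \<Omega>)"
  using assms continuous_on_D smooth_on_continuous_on
  by (auto intro!: continuous_imp_measurable_on_sets_lebesgue)

lemma a_form_measurable:
  assumes "standing_assumptions a A" "open \<Omega>" "smooth_on \<Omega> f" "smooth_on \<Omega> g"
  shows "a_form a f g \<in> borel_measurable (lebesgue_on \<Omega>)"
proof -
  have [measurable]: "(\<lambda>z. a z $ i $ j) \<in> borel_measurable (lebesgue_on \<Omega>)" for i j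
    using assms(1) by (intro measurable_lebesgue_on) (simp add: standing_assumptions_def)
  note [measurable] = smooth_on_measurable_D_x[OF assms(2,3)] smooth_on_measurable_D_x[OF assms(2,4)]
  show ?thesis unfolding a_form_def[abs_def] by measurable
qed

lemma W_smooth_iff:
  assumes "1 < q" "open \<Omega>"
  shows "w \<in> W_smooth a q \<Omega> \<longleftrightarrow> smooth_on \<Omega> w \<and> integrable (lebesgue_on \<Omega>) (D_t w) \<and>
    integrable (lebesgue_on \<Omega>) (a_form a w w) \<and> integrable (lebesgue_on \<Omega>) (\<lambda>z. \<bar>w z\<bar> powr q)"
proof -
  have "integrable (lebesgue_on \<Omega>) (\<lambda>z. \<bar>D_t w z\<bar>) \<longleftrightarrow> integrable (lebesgue_on \<Omega>) (D_t w)"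
    if "smooth_on \<Omega> w"
    using integrable_abs_cancel smooth_on_measurable_D_t[OF assms(2) that] by blast
  then show ?thesis
    using assms by (auto simp: W_smooth_def set_integral_lebesgue_on hat_def max_def)
qed

lemma powr_add_le:
  fixes x y :: real
  assumes "p \<ge> 0" "x \<ge> 0" "y \<ge> 0"
  shows "(x + y) powr p \<le> 2 powr p * (x powr p + y powr p)"
proof -
  have "(x + y) powr p \<le> (2 * max x y) powr p"
    using assms by (intro powr_mono2) auto
  also have "\<dots> = 2 powr p * (max x y) powr p"
    using assms by (simp add: powr_mult)
  also have "\<dots> \<le> 2 powr p * (x powr p + y powr p)"
    by (intro mult_left_mono) (auto simp: max_def)
  finally show ?thesis .
qed

lemma abs_diff_powr_le:
  fixes x y :: real
  assumes "p \<ge> 0"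
  shows "\<bar>x - y\<bar> powr p \<le> 2 powr p * (\<bar>x\<bar> powr p + \<bar>y\<bar> powr p)"
proof -
  have "\<bar>x - y\<bar> powr p \<le> (\<bar>x\<bar> + \<bar>y\<bar>) powr p"
    using assms by (intro powr_mono2) auto
  also have "\<dots> \<le> 2 powr p * (\<bar>x\<bar> powr p + \<bar>y\<bar> powr p)"
    using assms by (intro powr_add_le) auto
  finally show ?thesis .
qed

lemma integrable_powr_diff:
  fixes f g :: "'a \<Rightarrow> real"
  assumes "p \<ge> 0" "integrable M (\<lambda>z. \<bar>f z\<bar> powr p)" "integrable M (\<lambda>z. \<bar>g z\<bar> powr p)"
    "f \<in> borel_measurable M" "g \<in> borel_measurable M"
  shows "integrable M (\<lambda>z. \<bar>f z - g z\<bar> powr p)"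
proof (rule Bochner_Integration.integrable_bound)
  show "integrable M (\<lambda>z. 2 powr p * (\<bar>f z\<bar> powr p + \<bar>g z\<bar> powr p))"
    using assms by auto
  show "(\<lambda>z. \<bar>f z - g z\<bar> powr p) \<in> borel_measurable M"
    using assms(4,5) by measurable
qed (use abs_diff_powr_le[OF assms(1)] in auto)

lemma W_smooth_diff:
  assumes "standing_assumptions a A" "1 < q" "open \<Omega>" "s \<in> W_smooth a q \<Omega>" "r \<in> W_smooth a q \<Omega>"
  shows "(\<lambda>z. s z - r z) \<in> W_smooth a q \<Omega>"
    and "energy a \<Omega> (\<lambda>z. s z - r z) \<le>
      2 * energy a \<Omega> s + 2 * energy a \<Omega> r"
proof -
  let ?d = "\<lambda>z. s z - r z"
  note s = assms(4)[unfolded W_smooth_iff[OF assms(2,3)]] and r = assms(5)[unfolded W_smooth_iff[OF assms(2,3)]]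
  have d: "smooth_on \<Omega> ?d" using s r assms(3) smooth_on_diff by blast
  have diff: "s differentiable (at z)" "r differentiable (at z)" if "z \<in> \<Omega>" for z
    using s r that smooth_on_differentiable by blast+
  have bd: "AE z in lebesgue_on \<Omega>. 0 \<le> a_form a ?d ?d z \<and>
      a_form a ?d ?d z \<le> 2 * a_form a s s z + 2 * a_form a r r z"
    using AE_lebesgue_on[OF assms(3) form_bounds_AE[OF assms(1)]] AE_lebesgue_on_mem[OF assms(3)]
  proof eventually_elim
    case (elim z)
    then show ?case
      using bil_add_le(2)[OF elim(1)] bil_nonneg[OF elim(1)]
      by (simp add: a_form_bil grad_x_diff[OF diff])
  qed
  have int: "integrable (lebesgue_on \<Omega>) (\<lambda>z. 2 * a_form a s s z + 2 * a_form a r r z)"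
    using s r by auto
  have E: "integrable (lebesgue_on \<Omega>) (a_form a ?d ?d)"
    by (rule Bochner_Integration.integrable_bound[OF int a_form_measurable[OF assms(1,3) d d]])
       (use bd in eventually_elim, auto)
  have "integrable (lebesgue_on \<Omega>) (\<lambda>z. D_t s z - D_t r z)"
    using s r by auto
  moreover have "AE z in lebesgue_on \<Omega>. D_t s z - D_t r z = D_t ?d z"
    using AE_lebesgue_on_mem[OF assms(3)]
    by eventually_elim (simp add: D_t_diff diff)
  ultimately have "integrable (lebesgue_on \<Omega>) (D_t ?d)"
    using smooth_on_measurable_D_t[OF assms(3) d] integrable_cong_AE_imp by (metis (mono_tags, lifting) eventually_mono)
  moreover have "integrable (lebesgue_on \<Omega>) (\<lambda>z. \<bar>?d z\<bar> powr q)"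
    using s r assms(2,3) by (intro integrable_powr_diff smooth_on_measurable) auto
  ultimately show "?d \<in> W_smooth a q \<Omega>"
    using d E by (simp add: W_smooth_iff[OF assms(2,3)])
  have "energy a \<Omega> ?d \<le> (LINT z|lebesgue_on \<Omega>. 2 * a_form a s s z + 2 * a_form a r r z)"
    using bd by (intro integral_mono_AE[OF E int]) auto
  then show "energy a \<Omega> ?d \<le>
      2 * energy a \<Omega> s + 2 * energy a \<Omega> r"
    using s r by simp
qed

lemma energy_nonneg:
  assumes "standing_assumptions a A" "open \<Omega>"
  shows "0 \<le> energy a \<Omega> w"
  using AE_lebesgue_on[OF assms(2) form_bounds_AE[OF assms(1)]]
  by (intro integral_nonneg_AE) (auto simp: a_form_bil bil_nonneg elim!: eventually_mono)

text \<open>Each of the three terms of the norm is nonnegative, so each is below the tolerance; the energy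
  enters as a square root, whence the tolerance \<open>min e (sqrt e)\<close>.\<close>

lemma W_Cauchy_small:
  assumes "standing_assumptions a A" "1 < q" "open \<Omega>" "s \<in> W_Cauchy a q \<Omega>" "e > 0"
  shows "\<exists>N. \<forall>k\<ge>N. \<forall>l\<ge>N. (LINT z|lebesgue_on \<Omega>. \<bar>D_t (\<lambda>z. s k z - s l z) z\<bar>) < e \<and>
      energy a \<Omega> (\<lambda>z. s k z - s l z) < e"
proof -
  have "min e (sqrt e) > 0" using assms(5) by simp
  then obtain N where N: "\<And>k l. k \<ge> N \<Longrightarrow> l \<ge> N \<Longrightarrow> W_norm a q \<Omega> (\<lambda>z. s k z - s l z) < min e (sqrt e)"
    using assms(4) unfolding W_Cauchy_def by blast
  show ?thesis
  proof (intro exI[of _ N] allI impI)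
    fix k l assume kl: "k \<ge> N" "l \<ge> N"
    let ?d = "\<lambda>z. s k z - s l z"
    have "(LINT z|lebesgue_on \<Omega>. \<bar>D_t ?d z\<bar>) + sqrt (energy a \<Omega> ?d) +
      (LINT z|lebesgue_on \<Omega>. \<bar>?d z\<bar> powr hat q) powr (1 / hat q) < min e (sqrt e)"
      using N[OF kl] by (simp add: W_norm_def set_integral_lebesgue_on[OF assms(3)])
    moreover have "0 \<le> (LINT z|lebesgue_on \<Omega>. \<bar>D_t ?d z\<bar>)"
      "0 \<le> sqrt (energy a \<Omega> ?d)"
      "0 \<le> (LINT z|lebesgue_on \<Omega>. \<bar>?d z\<bar> powr hat q) powr (1 / hat q)"
      using energy_nonneg[OF assms(1,3)] by simp_all
    ultimately have "(LINT z|lebesgue_on \<Omega>. \<bar>D_t ?d z\<bar>) < e"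
      "sqrt (energy a \<Omega> ?d) < sqrt e" by linarith+
    then show "(LINT z|lebesgue_on \<Omega>. \<bar>D_t ?d z\<bar>) < e \<and>
      energy a \<Omega> ?d < e" by simp
  qed
qed

section \<open>Pairing elements of the completion with test functions\<close>

definition pairing :: "('n::finite spacetime \<Rightarrow> real ^ 'n ^ 'n) \<Rightarrow> 'n spacetime set \<Rightarrow>
    ('n spacetime \<Rightarrow> real) \<Rightarrow> ('n spacetime \<Rightarrow> real) \<Rightarrow> real" where
  "pairing a \<Omega> \<phi> w = (LINT z|lebesgue_on \<Omega>. D_t w z * \<phi> z + a_form a \<phi> w z)"

lemma bounded_open_finite_measure:
  assumes "open \<Omega>" "bounded \<Omega>"
  shows "finite_measure (lebesgue_on (\<Omega> :: 'a::euclidean_space set))"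
proof (rule finite_measureI)
  have "emeasure lebesgue \<Omega> \<noteq> \<infinity>"
    using fmeasurableD2[OF lmeasurable_open[OF assms(2,1)]] by simp
  then show "emeasure (lebesgue_on \<Omega>) (space (lebesgue_on \<Omega>)) \<noteq> \<infinity>"
    using assms by (simp add: emeasure_restrict_space)
qed

lemma pairing_integrable:
  assumes "standing_assumptions a A" "1 < q" "open \<Omega>" "w \<in> W_smooth a q \<Omega>"
    "smooth_on \<Omega> \<phi>" "\<And>z. \<bar>\<phi> z\<bar> \<le> B" "integrable (lebesgue_on \<Omega>) (a_form a \<phi> \<phi>)"
  shows "integrable (lebesgue_on \<Omega>) (\<lambda>z. D_t w z * \<phi> z)"
    "integrable (lebesgue_on \<Omega>) (a_form a \<phi> w)"
proof -
  note w = assms(4)[unfolded W_smooth_iff[OF assms(2,3)]]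
  note \<phi>m = smooth_on_measurable[OF assms(3,5)]
  have "integrable (lebesgue_on \<Omega>) (\<lambda>z. B * D_t w z)" using w by simp
  then show "integrable (lebesgue_on \<Omega>) (\<lambda>z. D_t w z * \<phi> z)"
  proof (rule Bochner_Integration.integrable_bound)
    show "(\<lambda>z. D_t w z * \<phi> z) \<in> borel_measurable (lebesgue_on \<Omega>)"
      using \<phi>m w by auto
    have "\<bar>D_t w z * \<phi> z\<bar> \<le> \<bar>B * D_t w z\<bar>" for z
    proof -
      have "\<bar>\<phi> z\<bar> * \<bar>D_t w z\<bar> \<le> \<bar>B\<bar> * \<bar>D_t w z\<bar>"
        using assms(6)[of z] by (intro mult_right_mono) auto
      then show ?thesis by (simp add: abs_mult mult.commute)
    qed
    then show "AE z in lebesgue_on \<Omega>. norm (D_t w z * \<phi> z) \<le> norm (B * D_t w z)" by simp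
  qed
  have "integrable (lebesgue_on \<Omega>) (\<lambda>z. a_form a \<phi> \<phi> z + a_form a w w z)"
    using w assms(7) by simp
  then show "integrable (lebesgue_on \<Omega>) (a_form a \<phi> w)"
  proof (rule Bochner_Integration.integrable_bound)
    show "a_form a \<phi> w \<in> borel_measurable (lebesgue_on \<Omega>)"
      using a_form_measurable[OF assms(1,3,5)] w by blast
    show "AE z in lebesgue_on \<Omega>. norm (a_form a \<phi> w z) \<le> norm (a_form a \<phi> \<phi> z + a_form a w w z)"
      using AE_lebesgue_on[OF assms(3) form_bounds_AE[OF assms(1)]]
    proof eventually_elim
      case (elim z)
      then show ?case
        using bil_young[OF elim, of 1 "grad_x \<phi> z" "grad_x w z"] bil_nonneg[OF elim]
        by (simp add: a_form_bil)
    qed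
  qed
qed

lemma pairing_bound:
  assumes "standing_assumptions a A" "1 < q" "open \<Omega>" "w \<in> W_smooth a q \<Omega>"
    "smooth_on \<Omega> \<phi>" "\<And>z. \<bar>\<phi> z\<bar> \<le> B" "integrable (lebesgue_on \<Omega>) (a_form a \<phi> \<phi>)" "\<eta> > 0"
  shows "\<bar>pairing a \<Omega> \<phi> w\<bar> \<le> B * (LINT z|lebesgue_on \<Omega>. \<bar>D_t w z\<bar>) +
     (\<eta> * energy a \<Omega> \<phi> + energy a \<Omega> w / \<eta>) / 2"
proof -
  note w = assms(4)[unfolded W_smooth_iff[OF assms(2,3)]]
  note int = pairing_integrable[OF assms(1-7)]
  have "\<bar>pairing a \<Omega> \<phi> w\<bar> \<le> (LINT z|lebesgue_on \<Omega>. \<bar>D_t w z * \<phi> z + a_form a \<phi> w z\<bar>)"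
    unfolding pairing_def by (rule integral_abs_bound)
  also have "\<dots> \<le> (LINT z|lebesgue_on \<Omega>. B * \<bar>D_t w z\<bar> + (\<eta> * a_form a \<phi> \<phi> z + a_form a w w z / \<eta>) / 2)"
  proof (rule integral_mono_AE)
    show "AE z in lebesgue_on \<Omega>. \<bar>D_t w z * \<phi> z + a_form a \<phi> w z\<bar> \<le>
        B * \<bar>D_t w z\<bar> + (\<eta> * a_form a \<phi> \<phi> z + a_form a w w z / \<eta>) / 2"
      using AE_lebesgue_on[OF assms(3) form_bounds_AE[OF assms(1)]]
    proof eventually_elim
      case (elim z)
      have "\<bar>D_t w z * \<phi> z\<bar> \<le> B * \<bar>D_t w z\<bar>"
        using mult_right_mono[OF assms(6), of "\<bar>D_t w z\<bar>" z] by (simp add: abs_mult mult.commute)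
      then show ?case
        using bil_young[OF elim assms(8), of "grad_x \<phi> z" "grad_x w z"]
        unfolding a_form_bil add_divide_distrib by (simp add: abs_le_iff) linarith
    qed
  qed (use int w assms(7) in auto)
  also have "\<dots> = B * (LINT z|lebesgue_on \<Omega>. \<bar>D_t w z\<bar>) +
     (\<eta> * energy a \<Omega> \<phi> + energy a \<Omega> w / \<eta>) / 2"
    using w assms(7) by simp
  finally show ?thesis .
qed

lemma pairing_diff:
  assumes "standing_assumptions a A" "1 < q" "open \<Omega>" "s \<in> W_smooth a q \<Omega>" "r \<in> W_smooth a q \<Omega>"
    "smooth_on \<Omega> \<phi>" "\<And>z. \<bar>\<phi> z\<bar> \<le> B" "integrable (lebesgue_on \<Omega>) (a_form a \<phi> \<phi>)"
  shows "pairing a \<Omega> \<phi> (\<lambda>z. s z - r z) = pairing a \<Omega> \<phi> s - pairing a \<Omega> \<phi> r"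
proof -
  have diff: "s differentiable (at z)" "r differentiable (at z)" if "z \<in> \<Omega>" for z
    using assms(4,5) that smooth_on_differentiable by (auto simp: W_smooth_iff[OF assms(2,3)])
  note s = pairing_integrable[OF assms(1-4,6-8)] and r = pairing_integrable[OF assms(1-3,5-8)]
  have "pairing a \<Omega> \<phi> (\<lambda>z. s z - r z) =
    (LINT z|lebesgue_on \<Omega>. (D_t s z * \<phi> z + a_form a \<phi> s z) - (D_t r z * \<phi> z + a_form a \<phi> r z))"
    unfolding pairing_def
    by (rule Bochner_Integration.integral_cong)
       (auto simp: D_t_diff diff a_form_bil grad_x_diff bil_simps algebra_simps)
  also have "\<dots> = pairing a \<Omega> \<phi> s - pairing a \<Omega> \<phi> r"
    unfolding pairing_def using s r by (intro Bochner_Integration.integral_diff) auto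
  finally show ?thesis .
qed

text \<open>The uniformity in \<open>\<phi>\<close>, over all test functions with common bounds on their size and their
  energy, is essential: the test functions used later depend on the index of the sequence.\<close>

lemma pairing_uniformly_Cauchy:
  assumes "standing_assumptions a A" "1 < q" "open \<Omega>" "s \<in> W_Cauchy a q \<Omega>" "e > 0" "B \<ge> 0" "S \<ge> 0"
  obtains N where "\<And>k l \<phi>. k \<ge> N \<Longrightarrow> l \<ge> N \<Longrightarrow> smooth_on \<Omega> \<phi> \<Longrightarrow> (\<forall>z. \<bar>\<phi> z\<bar> \<le> B) \<Longrightarrow>
    integrable (lebesgue_on \<Omega>) (a_form a \<phi> \<phi>) \<Longrightarrow> energy a \<Omega> \<phi> \<le> S \<Longrightarrow>
    \<bar>pairing a \<Omega> \<phi> (s k) - pairing a \<Omega> \<phi> (s l)\<bar> \<le> e"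
proof -
  define \<eta> where "\<eta> = e / (2 * (S + 1))"
  have \<eta>: "\<eta> > 0" using assms(5,7) by (simp add: \<eta>_def)
  define e' where "e' = min (e / (2 * (B + 1))) (e * \<eta> / 2)"
  have e': "e' > 0" using assms(5,6) \<eta> by (simp add: e'_def)
  obtain N where N: "\<forall>k\<ge>N. \<forall>l\<ge>N. (LINT z|lebesgue_on \<Omega>. \<bar>D_t (\<lambda>z. s k z - s l z) z\<bar>) < e' \<and>
      energy a \<Omega> (\<lambda>z. s k z - s l z) < e'"
    using W_Cauchy_small[OF assms(1-4) e'] ..
  have sW: "s k \<in> W_smooth a q \<Omega>" for k using assms(4) by (simp add: W_Cauchy_def)
  show ?thesis
  proof (rule that[of N])
    fix k l and \<phi> :: "'a spacetime \<Rightarrow> real"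
    assume kl: "k \<ge> N" "l \<ge> N" and \<phi>: "smooth_on \<Omega> \<phi>" "\<forall>z. \<bar>\<phi> z\<bar> \<le> B"
      "integrable (lebesgue_on \<Omega>) (a_form a \<phi> \<phi>)" "energy a \<Omega> \<phi> \<le> S"
    let ?d = "\<lambda>z. s k z - s l z"
    let ?T = "LINT z|lebesgue_on \<Omega>. \<bar>D_t ?d z\<bar>" and ?E = "energy a \<Omega> ?d"
    have B: "\<And>z. \<bar>\<phi> z\<bar> \<le> B" using \<phi>(2) by blast
    have "\<bar>pairing a \<Omega> \<phi> (s k) - pairing a \<Omega> \<phi> (s l)\<bar> = \<bar>pairing a \<Omega> \<phi> ?d\<bar>"
      using pairing_diff[OF assms(1-3) sW sW \<phi>(1) B \<phi>(3)] by simp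
    also have "\<dots> \<le> B * ?T + (\<eta> * energy a \<Omega> \<phi> + ?E / \<eta>) / 2"
      by (rule pairing_bound[OF assms(1-3) W_smooth_diff(1)[OF assms(1-3) sW sW] \<phi>(1) B \<phi>(3) \<eta>])
    also have "\<dots> \<le> e / 2 + (e / 2 + e / 2) / 2"
    proof -
      have "B * ?T \<le> (B + 1) * (e / (2 * (B + 1)))"
        using N[rule_format, OF kl] assms(6) by (intro mult_mono) (auto simp: e'_def)
      also have "\<dots> = e / 2"
        using assms(6) by (simp only: times_divide_eq_right mult.commute[of 2] divide_divide_eq_left[symmetric]) simp
      finally have 1: "B * ?T \<le> e / 2" .
      have "\<eta> * energy a \<Omega> \<phi> \<le> \<eta> * (S + 1)"
        using \<phi>(4) \<eta> by (intro mult_left_mono) auto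
      also have "\<dots> = e / 2"
        unfolding \<eta>_def using assms(7)
        by (simp only: times_divide_eq_left mult.commute[of 2] divide_divide_eq_left[symmetric]) simp
      finally have 2: "\<eta> * energy a \<Omega> \<phi> \<le> e / 2" .
      have "?E \<le> e * \<eta> / 2" using N[rule_format, OF kl] by (simp add: e'_def)
      then have 3: "?E / \<eta> \<le> e / 2" using \<eta> by (simp add: field_simps)
      show ?thesis using 1 2 3 by (intro add_mono divide_right_mono) auto
    qed
    finally show "\<bar>pairing a \<Omega> \<phi> (s k) - pairing a \<Omega> \<phi> (s l)\<bar> \<le> e" by simp
  qed
qed

text \<open>Hence in the limit defining the weak form, one fixed late member of the sequence may be used
  instead, with an error that is uniform over such test functions.\<close>

lemma pairing_lim_close:
  assumes "standing_assumptions a A" "1 < q" "open \<Omega>" "s \<in> W_Cauchy a q \<Omega>" "e > 0" "B \<ge> 0" "S \<ge> 0"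
  obtains N where "\<And>k \<phi>. k \<ge> N \<Longrightarrow> smooth_on \<Omega> \<phi> \<Longrightarrow> (\<forall>z. \<bar>\<phi> z\<bar> \<le> B) \<Longrightarrow>
    integrable (lebesgue_on \<Omega>) (a_form a \<phi> \<phi>) \<Longrightarrow> energy a \<Omega> \<phi> \<le> S \<Longrightarrow>
    \<bar>pairing a \<Omega> \<phi> (s k) - lim (\<lambda>l. pairing a \<Omega> \<phi> (s l))\<bar> \<le> e"
proof -
  obtain N where N: "\<And>k l \<phi>. k \<ge> N \<Longrightarrow> l \<ge> N \<Longrightarrow> smooth_on \<Omega> \<phi> \<Longrightarrow> (\<forall>z. \<bar>\<phi> z\<bar> \<le> B) \<Longrightarrow>
    integrable (lebesgue_on \<Omega>) (a_form a \<phi> \<phi>) \<Longrightarrow> energy a \<Omega> \<phi> \<le> S \<Longrightarrow>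
    \<bar>pairing a \<Omega> \<phi> (s k) - pairing a \<Omega> \<phi> (s l)\<bar> \<le> e"
    using pairing_uniformly_Cauchy[OF assms] by blast
  show ?thesis
  proof (rule that[of N])
    fix k and \<phi> :: "'a spacetime \<Rightarrow> real"
    assume k: "k \<ge> N" and \<phi>: "smooth_on \<Omega> \<phi>" "\<forall>z. \<bar>\<phi> z\<bar> \<le> B"
      "integrable (lebesgue_on \<Omega>) (a_form a \<phi> \<phi>)" "energy a \<Omega> \<phi> \<le> S"
    have "Cauchy (\<lambda>l. pairing a \<Omega> \<phi> (s l))"
    proof (rule metric_CauchyI)
      fix e' :: real assume "e' > 0"
      then have "e' / 2 > 0" by simp
      then obtain N' where "\<And>k l. k \<ge> N' \<Longrightarrow> l \<ge> N' \<Longrightarrow> \<bar>pairing a \<Omega> \<phi> (s k) - pairing a \<Omega> \<phi> (s l)\<bar> \<le> e' / 2"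
        using pairing_uniformly_Cauchy[OF assms(1-4) _ assms(6,7), of "e' / 2"] \<phi> by metis
      then show "\<exists>M. \<forall>m\<ge>M. \<forall>n\<ge>M. dist (pairing a \<Omega> \<phi> (s m)) (pairing a \<Omega> \<phi> (s n)) < e'"
        using \<open>e' > 0\<close> by (intro exI[of _ N'] allI impI) (fastforce simp: dist_real_def)
    qed
    then have "(\<lambda>l. pairing a \<Omega> \<phi> (s l)) \<longlonglongrightarrow> lim (\<lambda>l. pairing a \<Omega> \<phi> (s l))"
      by (simp add: Cauchy_convergent_iff convergent_LIMSEQ_iff)
    then have "(\<lambda>l. \<bar>pairing a \<Omega> \<phi> (s k) - pairing a \<Omega> \<phi> (s l)\<bar>) \<longlonglongrightarrow>
        \<bar>pairing a \<Omega> \<phi> (s k) - lim (\<lambda>l. pairing a \<Omega> \<phi> (s l))\<bar>"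
      by (intro tendsto_intros)
    then show "\<bar>pairing a \<Omega> \<phi> (s k) - lim (\<lambda>l. pairing a \<Omega> \<phi> (s l))\<bar> \<le> e"
      by (rule tendsto_upperbound) (use N k \<phi> in \<open>auto intro!: eventually_sequentiallyI[of N]\<close>)
  qed
qed

lemma W_Cauchy_energy_bounded:
  assumes "standing_assumptions a A" "1 < q" "open \<Omega>" "s \<in> W_Cauchy a q \<Omega>"
  obtains S N where "S \<ge> 0" "\<And>k. k \<ge> N \<Longrightarrow> energy a \<Omega> (s k) \<le> S"
proof -
  have one: "(0::real) < 1" by simp
  obtain N where N: "\<forall>k\<ge>N. \<forall>l\<ge>N. (LINT z|lebesgue_on \<Omega>. \<bar>D_t (\<lambda>z. s k z - s l z) z\<bar>) < 1 \<and>
      energy a \<Omega> (\<lambda>z. s k z - s l z) < 1"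
    using W_Cauchy_small[OF assms one] ..
  have sW: "s k \<in> W_smooth a q \<Omega>" for k using assms(4) by (simp add: W_Cauchy_def)
  let ?E = "\<lambda>w. energy a \<Omega> w"
  show ?thesis
  proof (rule that[of "2 + 4 * ?E (s N)" N])
    show "0 \<le> 2 + 4 * ?E (s N)" using energy_nonneg[OF assms(1,3)] by simp
    fix k assume k: "k \<ge> N"
    let ?d = "\<lambda>z. s N z - s k z"
    have dW: "?d \<in> W_smooth a q \<Omega>" by (rule W_smooth_diff(1)[OF assms(1-3) sW sW])
    have "?E (\<lambda>z. s N z - ?d z) \<le> 2 * ?E (s N) + 2 * ?E ?d"
      by (rule W_smooth_diff(2)[OF assms(1-3) sW dW])
    moreover have "(\<lambda>z. s N z - ?d z) = s k" by auto
    ultimately show "?E (s k) \<le> 2 + 4 * ?E (s N)"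
      using N[rule_format, OF order_refl k] energy_nonneg[OF assms(1,3), of "s N"] by simp
  qed
qed

lemma W_representative:
  assumes "W_represents a q \<Omega> X w"
  obtains s where "s \<in> X" "s \<in> W_Cauchy a q \<Omega>"
proof -
  obtain s where s: "s \<in> W_Cauchy a q \<Omega>" "X = W_rel a q \<Omega> `` {s}"
    using assms by (auto simp: W_represents_def W_space_def quotient_def)
  have "W_norm a q \<Omega> (\<lambda>z. s k z - s k z) = 0" for k
  proof -
    have "((\<lambda>z. 0::real) has_derivative (\<lambda>_. 0)) (at z)" for z :: "'a spacetime" by simp
    then have "D_t (\<lambda>z. 0) z = 0" "D_x i (\<lambda>z. 0) z = 0" for z :: "'a spacetime" and i
      using D_t_eqI D_x_eqI by fastforce+
    then show ?thesis by (simp add: W_norm_def a_form_def set_lebesgue_integral_def)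
  qed
  then have "s \<in> X" using s by (simp add: W_rel_def)
  with s(1) show ?thesis by (rule that[rotated])
qed

lemma powr_signed_integrable:
  fixes w \<phi> :: "'a \<Rightarrow> real" and q :: real
  assumes "w \<in> borel_measurable M" "integrable M (\<lambda>z. \<bar>w z\<bar> powr q)"
    "\<phi> \<in> borel_measurable M" "\<And>z. \<bar>\<phi> z\<bar> \<le> B"
  shows "integrable M (\<lambda>z. signed_powr q (w z) * \<phi> z)"
proof (rule Bochner_Integration.integrable_bound)
  show "integrable M (\<lambda>z. B * \<bar>w z\<bar> powr q)" using assms(2) by simp
  show "(\<lambda>z. signed_powr q (w z) * \<phi> z) \<in> borel_measurable M"
    by (intro borel_measurable_times measurable_abs_powr assms)
  have "norm (signed_powr q (w z) * \<phi> z) \<le> norm (B * \<bar>w z\<bar> powr q)" for z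
  proof -
    have "\<bar>w z\<bar> powr (q - 1) * \<bar>w z\<bar> = \<bar>w z\<bar> powr q"
      using powr_mult_base[of "\<bar>w z\<bar>" "q - 1"] by (simp add: mult.commute)
    then have "norm (signed_powr q (w z) * \<phi> z) = \<bar>w z\<bar> powr q * \<bar>\<phi> z\<bar>"
      by (simp add: abs_mult)
    also have "\<dots> \<le> \<bar>w z\<bar> powr q * B"
      by (intro mult_left_mono assms(4)) simp
    also have "\<dots> \<le> norm (B * \<bar>w z\<bar> powr q)" by (simp add: mult.commute)
    finally show ?thesis .
  qed
  then show "AE z in M. norm (signed_powr q (w z) * \<phi> z) \<le> norm (B * \<bar>w z\<bar> powr q)" by simp
qed

lemma W_represents_integrable:
  assumes "1 < q" "open \<Omega>" "W_represents a q \<Omega> X w" "w \<in> borel_measurable lebesgue" "s \<in> X" "s \<in> W_Cauchy a q \<Omega>"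
  shows "integrable (lebesgue_on \<Omega>) (\<lambda>z. \<bar>w z\<bar> powr q)"
    "integrable (lebesgue_on \<Omega>) (\<lambda>z. \<bar>s k z - w z\<bar> powr q)"
    "(\<lambda>k. LINT z|lebesgue_on \<Omega>. \<bar>s k z - w z\<bar> powr q) \<longlonglongrightarrow> 0"
proof -
  have hat: "hat q = q" using assms(1) by (simp add: hat_def)
  have s: "integrable (lebesgue_on \<Omega>) (\<lambda>z. \<bar>s k z\<bar> powr q)" "smooth_on \<Omega> (s k)" for k
    using assms(6) by (auto simp: W_Cauchy_def W_smooth_iff[OF assms(1,2)])
  show d: "integrable (lebesgue_on \<Omega>) (\<lambda>z. \<bar>s k z - w z\<bar> powr q)" for k
    using assms(3,5) unfolding W_represents_def hat set_integral_lebesgue_on[OF assms(2)] by blast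
  show "(\<lambda>k. LINT z|lebesgue_on \<Omega>. \<bar>s k z - w z\<bar> powr q) \<longlonglongrightarrow> 0"
    using assms(3,5) unfolding W_represents_def hat set_integral_lebesgue_on[OF assms(2)] by blast
  have "integrable (lebesgue_on \<Omega>) (\<lambda>z. \<bar>s 0 z - (s 0 z - w z)\<bar> powr q)"
    using assms(1) measurable_lebesgue_on[OF assms(4), of \<Omega>] smooth_on_measurable[OF assms(2) s(2)]
    by (intro integrable_powr_diff s(1) d borel_measurable_diff) auto
  then show "integrable (lebesgue_on \<Omega>) (\<lambda>z. \<bar>w z\<bar> powr q)" by simp
qed

section \<open>Test functions built from the approximating sequence\<close>

lemma smooth_energy_integrable:
  fixes \<psi> :: "'n::finite spacetime \<Rightarrow> real"
  assumes "standing_assumptions a A" "open \<Omega>" "bounded \<Omega>" "smooth_on UNIV \<psi>"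
  shows "integrable (lebesgue_on \<Omega>) (a_form a \<psi> \<psi>)"
proof -
  have K: "compact (closure \<Omega>)" using assms(3) by simp
  have "bounded (A ` closure \<Omega>)"
    using assms(1) K by (auto simp: standing_assumptions_def locally_bounded_def)
  then obtain CA where CA: "\<And>z. z \<in> closure \<Omega> \<Longrightarrow> \<bar>A z\<bar> \<le> CA" by (auto simp: bounded_iff)
  have "continuous_on UNIV (grad_x \<psi>)"
    unfolding grad_x_def[abs_def] by (intro continuous_on_vec_lambda continuous_on_D assms)
  then have "bounded (grad_x \<psi> ` closure \<Omega>)"
    using K by (meson compact_continuous_image compact_imp_bounded continuous_on_subset top_greatest)
  then obtain CG where CG: "\<And>z. z \<in> closure \<Omega> \<Longrightarrow> norm (grad_x \<psi> z) \<le> CG" by (auto simp: bounded_iff)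
  interpret finite_measure "lebesgue_on \<Omega>" by (rule bounded_open_finite_measure[OF assms(2,3)])
  show ?thesis
  proof (rule integrable_const_bound[where B="CA * CG\<^sup>2"])
    show "a_form a \<psi> \<psi> \<in> borel_measurable (lebesgue_on \<Omega>)"
      using assms smooth_on_subset by (intro a_form_measurable) auto
    show "AE z in lebesgue_on \<Omega>. norm (a_form a \<psi> \<psi> z) \<le> CA * CG\<^sup>2"
      using AE_lebesgue_on[OF assms(2) form_bounds_AE[OF assms(1)]] AE_lebesgue_on_mem[OF assms(2)]
    proof eventually_elim
      case (elim z)
      have z: "z \<in> closure \<Omega>" using elim(2) closure_subset by blast
      have "a_form a \<psi> \<psi> z \<le> A z * (norm (grad_x \<psi> z))\<^sup>2"
        using elim(1) by (simp add: a_form_bil form_bounds_def)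
      also have "\<dots> \<le> CA * CG\<^sup>2"
        using CA[OF z] CG[OF z] by (intro mult_mono power_mono) auto
      finally show ?case using bil_nonneg[OF elim(1)] by (simp add: a_form_bil)
    qed
  qed
qed

lemma smooth_on_cutoff_product:
  fixes g \<psi> :: "'n::finite spacetime \<Rightarrow> real"
  assumes "open \<Omega>" "smooth_on \<Omega> g" "smooth_on UNIV \<psi>" "compact K" "K \<subseteq> \<Omega>" "\<And>z. z \<notin> K \<Longrightarrow> \<psi> z = 0"
  shows "smooth_on UNIV (\<lambda>z. g z * \<psi> z)"
proof -
  have K: "open (- K)" using assms(4) by (simp add: compact_imp_closed open_Compl)
  have "smooth_on \<Omega> (\<lambda>z. g z * \<psi> z)"
    using assms smooth_on_subset[OF assms(3)] by (intro smooth_on_mult) auto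
  moreover have "smooth_on (- K) (\<lambda>z. g z * \<psi> z)"
    by (rule smooth_on_cong[OF K _ smooth_on_const[of _ 0]]) (simp add: assms(6))
  ultimately have "smooth_on (\<Omega> \<union> - K) (\<lambda>z. g z * \<psi> z)"
    by (intro smooth_on_Un assms(1) K)
  moreover have "\<Omega> \<union> - K = UNIV" using assms(5) by auto
  ultimately show ?thesis by simp
qed

lemma
  fixes \<phi> :: "'n::finite spacetime \<Rightarrow> real"
  assumes "smooth_on UNIV \<phi>" "compact K" "\<And>z. z \<notin> K \<Longrightarrow> \<phi> z = 0"
  shows test_funI: "test_fun \<phi>"
    and support_closure_subset: "closure (support_on UNIV \<phi>) \<subseteq> K"
proof -
  have "support_on UNIV \<phi> \<subseteq> K" using assms(3) by (auto simp: support_on_def)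
  then show cl: "closure (support_on UNIV \<phi>) \<subseteq> K"
    using assms(2) by (simp add: closure_minimal compact_imp_closed)
  then have "compact (closure (support_on UNIV \<phi>))"
    using assms(2) closed_Int_compact[OF closed_closure assms(2), of "support_on UNIV \<phi>"] by (simp add: inf.absorb1)
  then show "test_fun \<phi>" using assms(1) by (simp add: test_fun_def)
qed

lemma weak_form_eq_pairing:
  assumes "open \<Omega>" "\<And>z. z \<notin> \<Omega> \<Longrightarrow> \<phi> z = 0"
  shows "weak_form a q \<Omega> s w \<phi> = lim (\<lambda>k. pairing a \<Omega> \<phi> (s k)) -
    (LINT z|lebesgue_on \<Omega>. signed_powr q (w z) * \<phi> z)"
proof -
  have "(\<lambda>z. indicator \<Omega> z *\<^sub>R (signed_powr q (w z) * \<phi> z)) = (\<lambda>z. signed_powr q (w z) * \<phi> z)"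
  proof
    fix z show "indicator \<Omega> z *\<^sub>R (signed_powr q (w z) * \<phi> z) = signed_powr q (w z) * \<phi> z"
      using assms(2)[of z] by (cases "z \<in> \<Omega>") auto
  qed
  then show ?thesis
    using assms(1) by (simp add: weak_form_def pairing_def set_integral_lebesgue_on integral_restrict_space)
qed

text \<open>The energy of $f(w)\psi$ is controlled by those of $w$ and $\psi$; this is where $f'$ has to
  be bounded.\<close>

lemma composed_test_energy:
  fixes w \<psi> :: "'n::finite spacetime \<Rightarrow> real"
  assumes std: "standing_assumptions a A" and q: "1 < q" and \<Omega>: "open \<Omega>" "bounded \<Omega>"
    and w: "w \<in> W_smooth a q \<Omega>"
    and f: "smooth_on UNIV f" "\<And>s. \<bar>f s\<bar> \<le> M" "\<And>s. (f has_real_derivative f' s) (at s)" "\<And>s. \<bar>f' s\<bar> \<le> L"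
    and \<psi>: "smooth_on UNIV \<psi>" "\<And>z. \<bar>\<psi> z\<bar> \<le> P"
  shows "smooth_on \<Omega> (\<lambda>z. f (w z) * \<psi> z)"
    and "integrable (lebesgue_on \<Omega>) (a_form a (\<lambda>z. f (w z) * \<psi> z) (\<lambda>z. f (w z) * \<psi> z))"
    and "energy a \<Omega> (\<lambda>z. f (w z) * \<psi> z) \<le>
      2 * M\<^sup>2 * energy a \<Omega> \<psi> +
      2 * (P * L)\<^sup>2 * energy a \<Omega> w"
proof -
  let ?\<phi> = "\<lambda>z. f (w z) * \<psi> z"
  note w' = w[unfolded W_smooth_iff[OF q \<Omega>(1)]]
  have fw: "smooth_on \<Omega> (\<lambda>z. f (w z))"
    using w' f(1) \<Omega> by (intro smooth_on_compose[of \<Omega> UNIV f w]) auto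
  show \<phi>: "smooth_on \<Omega> ?\<phi>"
    using fw \<Omega> smooth_on_subset[OF \<psi>(1)] by (intro smooth_on_mult) auto
  have bd: "AE z in lebesgue_on \<Omega>. 0 \<le> a_form a ?\<phi> ?\<phi> z \<and>
      a_form a ?\<phi> ?\<phi> z \<le> 2 * M\<^sup>2 * a_form a \<psi> \<psi> z + 2 * (P * L)\<^sup>2 * a_form a w w z"
    using AE_lebesgue_on[OF \<Omega>(1) form_bounds_AE[OF std]] AE_lebesgue_on_mem[OF \<Omega>(1)]
  proof eventually_elim
    case (elim z)
    have dw: "w differentiable (at z)" and d\<psi>: "\<psi> differentiable (at z)"
      using w' elim(2) \<psi>(1) smooth_on_differentiable by blast+
    have "grad_x ?\<phi> z = f (w z) *\<^sub>R grad_x \<psi> z + (\<psi> z * f' (w z)) *\<^sub>R grad_x w z"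
      using grad_x_mult[OF differentiable_chain_real[OF dw f(3)] d\<psi>] grad_x_chain[OF dw f(3)] by simp
    then have "a_form a ?\<phi> ?\<phi> z \<le> 2 * ((f (w z))\<^sup>2 * a_form a \<psi> \<psi> z) + 2 * ((\<psi> z * f' (w z))\<^sup>2 * a_form a w w z)"
      using bil_add_le(1)[OF elim(1), of "f (w z) *\<^sub>R grad_x \<psi> z" "(\<psi> z * f' (w z)) *\<^sub>R grad_x w z"]
      by (simp add: a_form_bil bil_scale power2_eq_square mult_ac)
    also have "\<dots> \<le> 2 * (M\<^sup>2 * a_form a \<psi> \<psi> z) + 2 * ((P * L)\<^sup>2 * a_form a w w z)"
    proof (intro add_mono mult_left_mono mult_right_mono)
      show "(f (w z))\<^sup>2 \<le> M\<^sup>2"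
        using power_mono[OF f(2)[of "w z"], of 2] by simp
      have "\<bar>\<psi> z * f' (w z)\<bar> \<le> P * L"
        using \<psi>(2)[of z] f(4)[of "w z"] unfolding abs_mult by (intro mult_mono) auto
      from power_mono[OF this, of 2] show "(\<psi> z * f' (w z))\<^sup>2 \<le> (P * L)\<^sup>2" by simp
    qed (use bil_nonneg[OF elim(1)] in \<open>auto simp: a_form_bil\<close>)
    finally show ?case using bil_nonneg[OF elim(1)] by (simp add: a_form_bil)
  qed
  have int: "integrable (lebesgue_on \<Omega>) (\<lambda>z. 2 * M\<^sup>2 * a_form a \<psi> \<psi> z + 2 * (P * L)\<^sup>2 * a_form a w w z)"
    using w' smooth_energy_integrable[OF std \<Omega> \<psi>(1)] by auto
  show E: "integrable (lebesgue_on \<Omega>) (a_form a ?\<phi> ?\<phi>)"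
    by (rule Bochner_Integration.integrable_bound[OF int a_form_measurable[OF std \<Omega>(1) \<phi> \<phi>]])
       (use bd in eventually_elim, auto)
  have "energy a \<Omega> ?\<phi> \<le>
    (LINT z|lebesgue_on \<Omega>. 2 * M\<^sup>2 * a_form a \<psi> \<psi> z + 2 * (P * L)\<^sup>2 * a_form a w w z)"
    using bd by (intro integral_mono_AE[OF E int]) auto
  also have "\<dots> = 2 * M\<^sup>2 * energy a \<Omega> \<psi> +
      2 * (P * L)\<^sup>2 * energy a \<Omega> w"
    using w' smooth_energy_integrable[OF std \<Omega> \<psi>(1)] by simp
  finally show "energy a \<Omega> ?\<phi> \<le>
      2 * M\<^sup>2 * energy a \<Omega> \<psi> +
      2 * (P * L)\<^sup>2 * energy a \<Omega> w" .
qed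

lemma W_loc_measurable: "W_loc a q X w \<Longrightarrow> w \<in> borel_measurable lebesgue"
  by (simp add: W_loc_def)

lemma tendsto_integral_powr_diff:
  fixes s r :: "nat \<Rightarrow> 'a \<Rightarrow> real" and u v :: "'a \<Rightarrow> real"
  assumes "q \<ge> 0" "\<And>k. integrable M (\<lambda>z. \<bar>s k z - u z\<bar> powr q)" "\<And>k. integrable M (\<lambda>z. \<bar>r k z - v z\<bar> powr q)"
    "(\<lambda>k. LINT z|M. \<bar>s k z - u z\<bar> powr q) \<longlonglongrightarrow> 0" "(\<lambda>k. LINT z|M. \<bar>r k z - v z\<bar> powr q) \<longlonglongrightarrow> 0"
    "\<And>k. s k \<in> borel_measurable M" "\<And>k. r k \<in> borel_measurable M" "u \<in> borel_measurable M" "v \<in> borel_measurable M"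
  shows "integrable M (\<lambda>z. \<bar>(s k z - r k z) - (u z - v z)\<bar> powr q)"
    and "(\<lambda>k. LINT z|M. \<bar>(s k z - r k z) - (u z - v z)\<bar> powr q) \<longlonglongrightarrow> 0"
proof -
  have eq: "(s k z - r k z) - (u z - v z) = (s k z - u z) - (r k z - v z)" for k z by simp
  show int: "integrable M (\<lambda>z. \<bar>(s k z - r k z) - (u z - v z)\<bar> powr q)" for k
    unfolding eq by (intro integrable_powr_diff borel_measurable_diff assms)
  have "(\<lambda>k. 2 powr q * ((LINT z|M. \<bar>s k z - u z\<bar> powr q) + (LINT z|M. \<bar>r k z - v z\<bar> powr q))) \<longlonglongrightarrow>
      2 powr q * (0 + 0)"
    by (intro tendsto_intros assms)
  then have lim: "(\<lambda>k. 2 powr q * ((LINT z|M. \<bar>s k z - u z\<bar> powr q) + (LINT z|M. \<bar>r k z - v z\<bar> powr q))) \<longlonglongrightarrow> 0"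
    by simp
  have le: "(LINT z|M. \<bar>(s k z - r k z) - (u z - v z)\<bar> powr q) \<le>
      2 powr q * ((LINT z|M. \<bar>s k z - u z\<bar> powr q) + (LINT z|M. \<bar>r k z - v z\<bar> powr q))" for k
  proof -
    have "(LINT z|M. \<bar>(s k z - r k z) - (u z - v z)\<bar> powr q) \<le>
      (LINT z|M. 2 powr q * (\<bar>s k z - u z\<bar> powr q + \<bar>r k z - v z\<bar> powr q))"
      using abs_diff_powr_le[OF assms(1), of "s k z - u z" "r k z - v z" for z] int assms(2,3)
      by (intro integral_mono) (auto simp: eq)
    also have "\<dots> = 2 powr q * ((LINT z|M. \<bar>s k z - u z\<bar> powr q) + (LINT z|M. \<bar>r k z - v z\<bar> powr q))"
      using assms(2,3) by simp
    finally show ?thesis .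
  qed
  show "(\<lambda>k. LINT z|M. \<bar>(s k z - r k z) - (u z - v z)\<bar> powr q) \<longlonglongrightarrow> 0"
    by (rule tendsto_sandwich[OF _ _ tendsto_const lim]) (use le in auto)
qed

text \<open>The members $s_k$ and $r_k$ of representing sequences of \<open>u\<close> and \<open>v\<close> are smooth, so with
  $w_k = s_k - r_k$ the function $\varphi_k = f(w_k)\psi$ is an admissible test function. Inserted into
  the inequality it produces the limits of the pairings of $\varphi_k$ with $s_l$ and $r_l$ as
  $l \to \infty$. The energies of the $\varphi_k$ are bounded uniformly, so these limits are close to
  the pairings with $s_k$ and $r_k$, and one obtains the pairing of $f(w_k)\psi$ with the same $w_k$, for
  which integration by parts and the sign of $f'$ are available. The gradient of the limit
  function never appears; it need not exist, since the form may fail to be closable.\<close>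

lemma composed_test_inequality:
  fixes u v \<psi> :: "'n::finite spacetime \<Rightarrow> real"
  assumes std: "standing_assumptions a A" and q: "1 < q" and sol: "weak_solution a q u v"
    and \<Omega>: "bounded_domain \<Omega>"
    and f: "smooth_on UNIV f" "\<And>s. 0 \<le> f s" "\<And>s. f s \<le> M" "\<And>s. (f has_real_derivative f' s) (at s)"
      "\<And>s. \<bar>f' s\<bar> \<le> L"
    and \<psi>: "smooth_on UNIV \<psi>" "\<And>z. 0 \<le> \<psi> z" "\<And>z. \<psi> z \<le> P"
    and K: "compact K" "K \<subseteq> \<Omega>" "\<And>z. z \<notin> K \<Longrightarrow> \<psi> z = 0"
  obtains w where "\<forall>k. w k \<in> W_smooth a q \<Omega>"
    "\<forall>k. integrable (lebesgue_on \<Omega>) (\<lambda>z. \<bar>w k z - (u z - v z)\<bar> powr q)"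
    "(\<lambda>k. LINT z|lebesgue_on \<Omega>. \<bar>w k z - (u z - v z)\<bar> powr q) \<longlonglongrightarrow> 0"
    "integrable (lebesgue_on \<Omega>) (\<lambda>z. \<bar>u z - v z\<bar> powr q)"
    "\<forall>B \<phi>. smooth_on \<Omega> \<phi> \<longrightarrow> (\<forall>z. \<bar>\<phi> z\<bar> \<le> B) \<longrightarrow> integrable (lebesgue_on \<Omega>) (\<lambda>z. (signed_powr q (u z) - signed_powr q (v z)) * \<phi> z)"
    "\<forall>e>0. \<exists>N. \<forall>k\<ge>N. (LINT z|lebesgue_on \<Omega>. (signed_powr q (u z) - signed_powr q (v z)) * (f (w k z) * \<psi> z)) \<le>
      e + pairing a \<Omega> (\<lambda>z. f (w k z) * \<psi> z) (w k)"
proof -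
  have o: "open \<Omega>" and b: "bounded \<Omega>" using \<Omega> by (simp_all add: bounded_domain_def)
  obtain X Y where X: "W_loc a q X u" and Y: "W_loc a q Y v" and XY: "\<forall>\<phi> \<Omega>. test_fun \<phi> \<longrightarrow>
      (\<forall>z. 0 \<le> \<phi> z) \<longrightarrow> bounded_domain \<Omega> \<longrightarrow> closure (support_on UNIV \<phi>) \<subseteq> \<Omega> \<longrightarrow>
      (\<forall>s\<in>X \<Omega>. \<forall>r\<in>Y \<Omega>. weak_form a q \<Omega> s u \<phi> \<ge> weak_form a q \<Omega> r v \<phi>)"
    using sol unfolding weak_solution_def by (elim exE conjE) (rule that)
  have ineq: "weak_form a q \<Omega> s u \<phi> \<ge> weak_form a q \<Omega> r v \<phi>" if "test_fun \<phi>" "\<And>z. 0 \<le> \<phi> z"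
      "closure (support_on UNIV \<phi>) \<subseteq> \<Omega>" "s \<in> X \<Omega>" "r \<in> Y \<Omega>" for \<phi> s r
    using XY[rule_format, OF that(1,2) \<Omega> that(3-5)] .
  have rep: "W_represents a q \<Omega> (X \<Omega>) u" "W_represents a q \<Omega> (Y \<Omega>) v"
    using X Y \<Omega> unfolding W_loc_def by metis+
  obtain s where s: "s \<in> X \<Omega>" "s \<in> W_Cauchy a q \<Omega>" using W_representative[OF rep(1)] by blast
  obtain r where r: "r \<in> Y \<Omega>" "r \<in> W_Cauchy a q \<Omega>" using W_representative[OF rep(2)] by blast
  have sW: "s k \<in> W_smooth a q \<Omega>" and rW: "r k \<in> W_smooth a q \<Omega>" for k
    using s(2) r(2) by (auto simp: W_Cauchy_def)
  have sm: "s k \<in> borel_measurable (lebesgue_on \<Omega>)" and rm: "r k \<in> borel_measurable (lebesgue_on \<Omega>)" for k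
    using sW[of k] rW[of k] smooth_on_measurable[OF o] by (auto simp: W_smooth_iff[OF q o])
  have um: "u \<in> borel_measurable (lebesgue_on \<Omega>)" and vm: "v \<in> borel_measurable (lebesgue_on \<Omega>)"
    using W_loc_measurable[OF X] W_loc_measurable[OF Y] measurable_lebesgue_on by blast+
  note su = W_represents_integrable[OF q o rep(1) W_loc_measurable[OF X] s]
    and rv = W_represents_integrable[OF q o rep(2) W_loc_measurable[OF Y] r]
  interpret finite_measure "lebesgue_on \<Omega>" by (rule bounded_open_finite_measure[OF o b])
  define w where "w k z = s k z - r k z" for k z
  have q0: "q \<ge> 0" using q by simp
  note w_lim = tendsto_integral_powr_diff[OF q0 su(2) rv(2) su(3) rv(3) sm rm um vm, folded w_def]
  have wW: "w k \<in> W_smooth a q \<Omega>" for k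
    unfolding w_def[abs_def] by (rule W_smooth_diff(1)[OF std q o sW rW])
  note Tint = powr_signed_integrable[OF um su(1)]
    powr_signed_integrable[OF vm rv(1)]
  have Tint': "integrable (lebesgue_on \<Omega>)
       (\<lambda>z. (signed_powr q (u z) - signed_powr q (v z)) * \<phi> z)"
    "(LINT z|lebesgue_on \<Omega>. (signed_powr q (u z) - signed_powr q (v z)) * \<phi> z) =
      (LINT z|lebesgue_on \<Omega>. signed_powr q (u z) * \<phi> z) -
      (LINT z|lebesgue_on \<Omega>. signed_powr q (v z) * \<phi> z)"
    if "smooth_on \<Omega> \<phi>" "\<And>z. \<bar>\<phi> z\<bar> \<le> B" for \<phi> B
    unfolding left_diff_distrib
    using Tint[OF smooth_on_measurable[OF o that(1)] that(2)] by simp_all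
  have "M \<ge> 0" using f(2,3) by (rule order_trans)
  have "P \<ge> 0" using \<psi>(2,3) by (rule order_trans)
  define \<phi> where "\<phi> k z = f (w k z) * \<psi> z" for k z
  have fM: "\<bar>f s\<bar> \<le> M" for s using f(2,3)[of s] by simp
  have \<psi>P: "\<bar>\<psi> z\<bar> \<le> P" for z using \<psi>(2,3)[of z] by simp
  note comp = composed_test_energy[OF std q o b wW f(1) fM f(4,5) \<psi>(1) \<psi>P, folded \<phi>_def]
  have \<phi>_bd: "\<bar>\<phi> k z\<bar> \<le> M * P" for k z
    unfolding \<phi>_def abs_mult using fM \<psi>P \<open>M \<ge> 0\<close> by (intro mult_mono) auto
  have \<phi>_smooth: "smooth_on UNIV (\<phi> k)" for k
    unfolding \<phi>_def[abs_def]
  proof (rule smooth_on_cutoff_product[OF o _ \<psi>(1) K])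
    show "smooth_on \<Omega> (\<lambda>z. f (w k z))"
      using wW[of k] f(1) o by (intro smooth_on_compose[of \<Omega> UNIV f "w k"]) (auto simp: W_smooth_iff[OF q o])
  qed
  have \<phi>0: "\<phi> k z = 0" if "z \<notin> K" for k z using K(3)[OF that] by (simp add: \<phi>_def)
  have \<phi>_nonneg: "0 \<le> \<phi> k z" for k z using f(2) \<psi>(2) by (simp add: \<phi>_def)
  obtain S1 N1 where S1: "S1 \<ge> 0" "\<And>k. k \<ge> N1 \<Longrightarrow> energy a \<Omega> (s k) \<le> S1"
    using W_Cauchy_energy_bounded[OF std q o s(2)] by blast
  obtain S2 N2 where S2: "S2 \<ge> 0" "\<And>k. k \<ge> N2 \<Longrightarrow> energy a \<Omega> (r k) \<le> S2"
    using W_Cauchy_energy_bounded[OF std q o r(2)] by blast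
  define S where "S = 2 * M\<^sup>2 * energy a \<Omega> \<psi> + 2 * (P * L)\<^sup>2 * (2 * S1 + 2 * S2)"
  have S0: "S \<ge> 0" unfolding S_def using energy_nonneg[OF std o] S1 S2 by simp
  have S: "energy a \<Omega> (\<phi> k) \<le> S" if "k \<ge> N1" "k \<ge> N2" for k
  proof -
    have "energy a \<Omega> (w k) \<le> 2 * S1 + 2 * S2"
      using W_smooth_diff(2)[OF std q o sW rW, of k k, folded w_def] S1(2)[OF that(1)] S2(2)[OF that(2)] by simp
    then have "2 * (P * L)\<^sup>2 * energy a \<Omega> (w k) \<le> 2 * (P * L)\<^sup>2 * (2 * S1 + 2 * S2)"
      by (intro mult_left_mono) auto
    then show ?thesis using comp(3)[of k] by (simp add: S_def)
  qed
  show ?thesis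
  proof (rule that[of w])
    show "\<forall>k. w k \<in> W_smooth a q \<Omega>" using wW by blast
    show "\<forall>k. integrable (lebesgue_on \<Omega>) (\<lambda>z. \<bar>w k z - (u z - v z)\<bar> powr q)" using w_lim(1) by blast
    show "(\<lambda>k. LINT z|lebesgue_on \<Omega>. \<bar>w k z - (u z - v z)\<bar> powr q) \<longlonglongrightarrow> 0" by (rule w_lim(2))
    show "integrable (lebesgue_on \<Omega>) (\<lambda>z. \<bar>u z - v z\<bar> powr q)"
      by (rule integrable_powr_diff[OF q0 su(1) rv(1) um vm])
    show "\<forall>B \<phi>. smooth_on \<Omega> \<phi> \<longrightarrow> (\<forall>z. \<bar>\<phi> z\<bar> \<le> B) \<longrightarrow> integrable (lebesgue_on \<Omega>) (\<lambda>z. (signed_powr q (u z) - signed_powr q (v z)) * \<phi> z)"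
      using Tint'(1) by blast
    show "\<forall>e>0. \<exists>N. \<forall>k\<ge>N. (LINT z|lebesgue_on \<Omega>. (signed_powr q (u z) - signed_powr q (v z)) * (f (w k z) * \<psi> z)) \<le>
      e + pairing a \<Omega> (\<lambda>z. f (w k z) * \<psi> z) (w k)"
    proof (intro allI impI)
      fix e :: real assume "e > 0"
      then have e: "e / 2 > 0" by simp
      have MP: "M * P \<ge> 0" using \<open>M \<ge> 0\<close> \<open>P \<ge> 0\<close> by simp
      obtain N3 where N3: "\<And>k \<phi>. k \<ge> N3 \<Longrightarrow> smooth_on \<Omega> \<phi> \<Longrightarrow> (\<forall>z. \<bar>\<phi> z\<bar> \<le> M * P) \<Longrightarrow>
        integrable (lebesgue_on \<Omega>) (a_form a \<phi> \<phi>) \<Longrightarrow> energy a \<Omega> \<phi> \<le> S \<Longrightarrow>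
        \<bar>pairing a \<Omega> \<phi> (s k) - lim (\<lambda>l. pairing a \<Omega> \<phi> (s l))\<bar> \<le> e / 2"
        using pairing_lim_close[OF std q o s(2) e MP S0] by blast
      obtain N4 where N4: "\<And>k \<phi>. k \<ge> N4 \<Longrightarrow> smooth_on \<Omega> \<phi> \<Longrightarrow> (\<forall>z. \<bar>\<phi> z\<bar> \<le> M * P) \<Longrightarrow>
        integrable (lebesgue_on \<Omega>) (a_form a \<phi> \<phi>) \<Longrightarrow> energy a \<Omega> \<phi> \<le> S \<Longrightarrow>
        \<bar>pairing a \<Omega> \<phi> (r k) - lim (\<lambda>l. pairing a \<Omega> \<phi> (r l))\<bar> \<le> e / 2"
        using pairing_lim_close[OF std q o r(2) e MP S0] by blast
      have "(LINT z|lebesgue_on \<Omega>. (signed_powr q (u z) - signed_powr q (v z)) * \<phi> k z) \<le>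
        e + pairing a \<Omega> (\<phi> k) (w k)" if k: "k \<ge> Max {N1, N2, N3, N4}" for k
      proof -
        have k': "k \<ge> N1" "k \<ge> N2" "k \<ge> N3" "k \<ge> N4" using k by auto
        have \<phi>_bd': "\<forall>z. \<bar>\<phi> k z\<bar> \<le> M * P" using \<phi>_bd by blast
        have out: "\<phi> k z = 0" if "z \<notin> \<Omega>" for z using \<phi>0 that K(2) by blast
        have "weak_form a q \<Omega> s u (\<phi> k) \<ge> weak_form a q \<Omega> r v (\<phi> k)"
          using test_funI[OF \<phi>_smooth K(1) \<phi>0] support_closure_subset[OF \<phi>_smooth K(1) \<phi>0] K(2) \<phi>_nonneg s(1) r(1)
          by (intro ineq) auto
        then have "(LINT z|lebesgue_on \<Omega>. signed_powr q (u z) * \<phi> k z) -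
            (LINT z|lebesgue_on \<Omega>. signed_powr q (v z) * \<phi> k z) \<le>
            lim (\<lambda>l. pairing a \<Omega> (\<phi> k) (s l)) - lim (\<lambda>l. pairing a \<Omega> (\<phi> k) (r l))"
          by (simp add: weak_form_eq_pairing[OF o out])
        also have "\<dots> \<le> e + (pairing a \<Omega> (\<phi> k) (s k) - pairing a \<Omega> (\<phi> k) (r k))"
          using N3[OF k'(3) comp(1) \<phi>_bd' comp(2) S[OF k'(1,2)]] N4[OF k'(4) comp(1) \<phi>_bd' comp(2) S[OF k'(1,2)]]
          by linarith
        also have "pairing a \<Omega> (\<phi> k) (s k) - pairing a \<Omega> (\<phi> k) (r k) = pairing a \<Omega> (\<phi> k) (w k)"
          unfolding w_def[abs_def] by (rule pairing_diff[OF std q o sW rW comp(1) \<phi>_bd comp(2), symmetric])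
        finally show ?thesis using Tint'(2)[OF comp(1) \<phi>_bd] by simp
      qed
      then show "\<exists>N. \<forall>k\<ge>N.
        (LINT z|lebesgue_on \<Omega>. (signed_powr q (u z) - signed_powr q (v z)) * (f (w k z) * \<psi> z)) \<le>
        e + pairing a \<Omega> (\<lambda>z. f (w k z) * \<psi> z) (w k)"
        unfolding \<phi>_def by blast
    qed
  qed
qed

section \<open>Absorbing the energy\<close>

text \<open>The constant is that of completing the square in \<open>\<zeta> \<eta>\<close>; the Young parameter is
  chosen so that the energy of \<open>\<eta>\<close> comes out with exactly the weight \<open>h\<close>.\<close>

lemma energy_absorption:
  fixes h :: real
  assumes "form_bounds m b" "h > 0" "F > 0" "c > 0"
  shows "F * c * \<zeta> * bil m \<xi> \<eta> \<le> h * \<zeta>\<^sup>2 * bil m \<eta> \<eta> + F\<^sup>2 * c\<^sup>2 / (4 * h) * bil m \<xi> \<xi>"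
proof -
  let ?s = "F * c / (2 * h)"
  have s: "?s > 0" using assms by simp
  have "F * c * \<zeta> * bil m \<xi> \<eta> = (F * c / 2) * (2 * bil m \<xi> (\<zeta> *\<^sub>R \<eta>))"
    by (simp add: bil_scale)
  also have "\<dots> \<le> (F * c / 2) * (?s * bil m \<xi> \<xi> + bil m (\<zeta> *\<^sub>R \<eta>) (\<zeta> *\<^sub>R \<eta>) / ?s)"
    using bil_young[OF assms(1) s, of \<xi> "\<zeta> *\<^sub>R \<eta>"] assms by (intro mult_left_mono) auto
  also have "\<dots> = h * \<zeta>\<^sup>2 * bil m \<eta> \<eta> + F\<^sup>2 * c\<^sup>2 / (4 * h) * bil m \<xi> \<xi>"
    using assms(2-4) by (simp add: bil_scale power2_eq_square field_simps)
  finally show ?thesis .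
qed

lemma one_plus_square_powr_le:
  fixes x p :: real
  assumes "p \<ge> 0"
  shows "(1 + x\<^sup>2) powr (p / 2) \<le> (1 + \<bar>x\<bar>) powr p"
proof -
  have "(1 + x\<^sup>2) powr (p / 2) \<le> ((1 + \<bar>x\<bar>)\<^sup>2) powr (p / 2)"
    using assms by (intro powr_mono2) (auto simp: power2_eq_square algebra_simps add_nonneg_nonneg)
  also have "\<dots> = (1 + \<bar>x\<bar>) powr p"
    by (simp add: powr_powr flip: powr_numeral)
  finally show ?thesis .
qed

lemma integrable_powr_shift:
  fixes w :: "'a \<Rightarrow> real"
  assumes "finite_measure M" "0 \<le> p" "p \<le> q" "\<epsilon> > 0" "w \<in> borel_measurable M"
    "integrable M (\<lambda>z. \<bar>w z\<bar> powr q)"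
  shows "integrable M (\<lambda>z. (1 + \<bar>w z\<bar> / \<epsilon>) powr p)"
proof -
  interpret finite_measure M by (rule assms(1))
  show ?thesis
  proof (rule Bochner_Integration.integrable_bound)
    show "integrable M (\<lambda>z. 2 powr q * (1 + (1 / \<epsilon>) powr q * \<bar>w z\<bar> powr q))"
      using assms(6) by simp
    show "(\<lambda>z. (1 + \<bar>w z\<bar> / \<epsilon>) powr p) \<in> borel_measurable M"
      using assms(5) by measurable
    have "(1 + \<bar>w z\<bar> / \<epsilon>) powr p \<le> 2 powr q * (1 + (1 / \<epsilon>) powr q * \<bar>w z\<bar> powr q)" for z
    proof -
      have "(1 + \<bar>w z\<bar> / \<epsilon>) powr p \<le> (1 + \<bar>w z\<bar> / \<epsilon>) powr q"
        using assms by (intro powr_mono) auto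
      also have "\<dots> \<le> 2 powr q * (1 powr q + (\<bar>w z\<bar> / \<epsilon>) powr q)"
        using assms by (intro powr_add_le) auto
      also have "(\<bar>w z\<bar> / \<epsilon>) powr q = (1 / \<epsilon>) powr q * \<bar>w z\<bar> powr q"
        using assms(4) by (simp add: powr_divide)
      finally show ?thesis by simp
    qed
    moreover have "2 powr q * (1 + (1 / \<epsilon>) powr q * \<bar>w z\<bar> powr q) \<ge> 0" for z
      by simp
    ultimately show "AE z in M. norm ((1 + \<bar>w z\<bar> / \<epsilon>) powr p) \<le>
        norm (2 powr q * (1 + (1 / \<epsilon>) powr q * \<bar>w z\<bar> powr q))"
      by (intro always_eventually allI) (simp only: real_norm_def abs_of_nonneg powr_ge_zero)
  qed
qed

lemma profile_derivative_le:
  fixes \<epsilon> p s :: real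
  assumes "p \<ge> 0" "\<epsilon> > 0"
  shows "\<bar>- (1 / \<epsilon>) * (1 + (s / \<epsilon>)\<^sup>2) powr (- p / 2)\<bar> \<le> 1 / \<epsilon>"
proof -
  have ge: "1 \<le> 1 + (s / \<epsilon>)\<^sup>2" by simp
  then have "1 + (s / \<epsilon>)\<^sup>2 \<noteq> 0" by linarith
  moreover have "(1 + (s / \<epsilon>)\<^sup>2) powr (- p / 2) \<le> (1 + (s / \<epsilon>)\<^sup>2) powr 0"
    using ge assms(1) by (intro powr_mono) auto
  ultimately have "(1 + (s / \<epsilon>)\<^sup>2) powr (- p / 2) \<le> 1" by (simp only: powr_zero_eq_one if_False)
  then show ?thesis using assms(2) by (simp add: abs_mult divide_right_mono)
qed

text \<open>The time derivative contributes $w_t f(w)\zeta^m = (F(w)\zeta^m)_t - F(w)(\zeta^m)_t$, whose first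
  part integrates to 0. In the second-order term the energy $f'(w)\zeta^m\,a(\nabla w,\nabla w)$ is
  nonpositive and absorbs the cross term $f(w)\,a(\nabla\zeta^m,\nabla w)$ at the cost of
  $f(w)^2\,a(\nabla\zeta,\nabla\zeta)\,\zeta^{m-2}/|f'(w)|$. What is left is carried by the derivatives of \<open>\<zeta>\<close> and
  grows like the power \<open>p\<close> of $w$. Here $m = n + 2$, and \<open>\<kappa>\<close> is a common bound for $|\zeta_t|$ and
  $a(\nabla\zeta,\nabla\zeta)$.\<close>

lemma pairing_upper_bound:
  fixes w \<zeta> :: "'n::finite spacetime \<Rightarrow> real"
  assumes std: "standing_assumptions a A" and q: "1 < q" and p: "1 \<le> p" "p \<le> q"
    and \<Omega>: "open \<Omega>" "bounded \<Omega>" and w: "w \<in> W_smooth a q \<Omega>" and \<epsilon>: "\<epsilon> > 0"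
    and f: "smooth_on UNIV f" "\<And>s. 1 \<le> f s" "\<And>s. f s \<le> M"
      "\<And>s. (f has_real_derivative - (1 / \<epsilon>) * (1 + (s / \<epsilon>)\<^sup>2) powr (- p / 2)) (at s)"
    and F: "\<And>s. (F has_real_derivative f s) (at s)" "\<And>s. \<bar>F s\<bar> \<le> M * \<bar>s\<bar>"
    and \<zeta>: "smooth_on UNIV \<zeta>" "\<And>z. 0 \<le> \<zeta> z" "\<And>z. \<zeta> z \<le> 1"
    and K: "compact K" "K \<subseteq> \<Omega>" "\<And>z. z \<notin> K \<Longrightarrow> \<zeta> z = 0"
    and B: "B \<in> sets lebesgue" "\<kappa> \<ge> 0" "\<And>z. \<bar>D_t \<zeta> z\<bar> \<le> \<kappa> * indicator B z"
      "AE z in lebesgue. a_form a \<zeta> \<zeta> z \<le> \<kappa> * indicator B z"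
  shows "pairing a \<Omega> (\<lambda>z. f (w z) * \<zeta> z ^ (n + 2)) w \<le> 2 * M\<^sup>2 * (real (n + 2))\<^sup>2 * \<kappa> * \<epsilon> *
     (LINT z|lebesgue_on \<Omega>. indicator B z * (\<zeta> z ^ n * (1 + \<bar>w z\<bar> / \<epsilon>) powr p))"
    and "integrable (lebesgue_on \<Omega>) (\<lambda>z. indicator B z * (\<zeta> z ^ n * (1 + \<bar>w z\<bar> / \<epsilon>) powr p))"
proof -
  define m where "m = real (n + 2)"
  have m: "m \<ge> 1" by (simp add: m_def)
  have M: "M \<ge> 1" using f(2,3)[of 0] by simp
  define C where "C = 2 * M\<^sup>2 * m\<^sup>2 * \<kappa> * \<epsilon>"
  let ?\<psi> = "\<lambda>z. \<zeta> z ^ (n + 2)" and ?\<phi> = "\<lambda>z. f (w z) * \<zeta> z ^ (n + 2)"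
  let ?G = "\<lambda>z. F (w z) * \<zeta> z ^ (n + 2)"
  let ?r = "\<lambda>z. indicator B z * (\<zeta> z ^ n * (1 + \<bar>w z\<bar> / \<epsilon>) powr p)"
  note w' = w[unfolded W_smooth_iff[OF q \<Omega>(1)]]
  have \<psi>: "smooth_on UNIV ?\<psi>" by (intro smooth_on_power \<zeta>(1)) simp
  have \<psi>1: "\<bar>?\<psi> z\<bar> \<le> 1" for z
    using power_le_one[OF \<zeta>(2,3), of z "n + 2"] zero_le_power[OF \<zeta>(2), of z "n + 2"] by linarith
  have fM: "\<bar>f s\<bar> \<le> M" for s using f(2,3)[of s] by simp
  have pos: "1 + (s / \<epsilon>)\<^sup>2 \<ge> 1" for s by simp
  have ne: "1 + (s / \<epsilon>)\<^sup>2 \<noteq> 0" for s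
    using pos[of s] by linarith
  have p0: "p \<ge> 0" using p(1) by simp
  note \<phi> = composed_test_energy(1,2)[OF std q \<Omega> w f(1) fM f(4) profile_derivative_le[OF p0 \<epsilon>] \<psi> \<psi>1]
  have \<phi>M: "\<bar>?\<phi> z\<bar> \<le> M * 1" for z
    unfolding abs_mult using fM \<psi>1[of z] M by (intro mult_mono) auto
  note \<phi>_int = pairing_integrable[OF std q \<Omega>(1) w \<phi>(1) \<phi>M \<phi>(2)]
  have "smooth_on UNIV F"
    using smooth_on_antiderivative[OF _ f(1) F(1)] by simp
  then have "smooth_on \<Omega> (\<lambda>z. F (w z))"
    using w' \<Omega> by (intro smooth_on_compose[of \<Omega> UNIV F w]) auto
  then have G: "smooth_on \<Omega> ?G"
    using \<Omega> smooth_on_subset[OF \<psi>] by (intro smooth_on_mult) auto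
  have Gout: "?G z = 0" if "z \<notin> K" for z using K(3)[OF that] by simp
  note G0 = integral_D_t_eq_0[OF \<Omega>(1) K(1,2) smooth_on_differentiable[OF G] continuous_on_D(1)[OF G] Gout]
  interpret finite_measure "lebesgue_on \<Omega>" by (rule bounded_open_finite_measure[OF \<Omega>])
  have wm: "w \<in> borel_measurable (lebesgue_on \<Omega>)"
    using w' smooth_on_measurable[OF \<Omega>(1)] by blast
  have \<zeta>m: "\<zeta> \<in> borel_measurable (lebesgue_on \<Omega>)"
    using smooth_on_measurable[OF \<Omega>(1)] smooth_on_subset[OF \<zeta>(1)] by blast
  have Bm: "indicator B \<in> borel_measurable (lebesgue_on \<Omega>)"
    using B(1) by (intro measurable_lebesgue_on) simp
  show r_int: "integrable (lebesgue_on \<Omega>) ?r"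
  proof (rule Bochner_Integration.integrable_bound)
    show "integrable (lebesgue_on \<Omega>) (\<lambda>z. (1 + \<bar>w z\<bar> / \<epsilon>) powr p)"
      using w' p by (intro integrable_powr_shift[OF finite_measure_axioms _ p(2) \<epsilon> wm]) auto
    show "?r \<in> borel_measurable (lebesgue_on \<Omega>)"
      using wm \<zeta>m Bm by measurable
    have "\<bar>?r z\<bar> \<le> (1 + \<bar>w z\<bar> / \<epsilon>) powr p" for z
    proof -
      have "\<bar>\<zeta> z ^ n * (1 + \<bar>w z\<bar> / \<epsilon>) powr p\<bar> \<le> 1 * (1 + \<bar>w z\<bar> / \<epsilon>) powr p"
        unfolding abs_mult using \<zeta>(2,3)[of z] by (intro mult_mono) (auto simp: power_le_one)
      then show ?thesis by (auto simp: indicator_def)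
    qed
    then show "AE z in lebesgue_on \<Omega>. norm (?r z) \<le> norm ((1 + \<bar>w z\<bar> / \<epsilon>) powr p)" by simp
  qed
  have bd: "AE z in lebesgue_on \<Omega>. D_t w z * ?\<phi> z + a_form a ?\<phi> w z \<le> D_t ?G z + C * ?r z"
    using AE_lebesgue_on[OF \<Omega>(1) form_bounds_AE[OF std]] AE_lebesgue_on_mem[OF \<Omega>(1)]
      AE_lebesgue_on[OF \<Omega>(1) B(4)]
  proof eventually_elim
    case (elim z)
    let ?b = "bil (a z) (grad_x \<zeta> z) (grad_x w z)" and ?Q = "bil (a z) (grad_x w z) (grad_x w z)"
    let ?S = "bil (a z) (grad_x \<zeta> z) (grad_x \<zeta> z)"
    define h where "h = (1 / \<epsilon>) * (1 + (w z / \<epsilon>)\<^sup>2) powr (- p / 2)"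
    define y where "y = (1 + \<bar>w z\<bar> / \<epsilon>) powr p"
    have h: "h > 0"
      unfolding h_def using \<epsilon> ne[of "w z"] by (intro mult_pos_pos powr_gt_zero[THEN iffD2]) simp_all
    have dw: "w differentiable (at z)" and d\<zeta>: "\<zeta> differentiable (at z)" and d\<psi>: "?\<psi> differentiable (at z)"
      using w' elim(2) \<zeta>(1) \<psi> smooth_on_differentiable by blast+
    have pw: "((\<lambda>x. x ^ (n + 2)) has_real_derivative m * \<zeta> z ^ (n + 1)) (at (\<zeta> z))"
    proof -
      have "n + 2 - Suc 0 = n + 1" by simp
      with DERIV_pow[of "n + 2" "\<zeta> z" UNIV] show ?thesis by (simp only: m_def)
    qed
    have D\<psi>: "D_t ?\<psi> z = m * \<zeta> z ^ (n + 1) * D_t \<zeta> z" "grad_x ?\<psi> z = (m * \<zeta> z ^ (n + 1)) *\<^sub>R grad_x \<zeta> z"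
      using D_t_chain[OF d\<zeta> pw] grad_x_chain[OF d\<zeta> pw] by simp_all
    have DG: "D_t ?G z = F (w z) * (m * \<zeta> z ^ (n + 1) * D_t \<zeta> z) + f (w z) * D_t w z * ?\<psi> z"
      using D_t_mult[OF differentiable_chain_real[OF dw F(1)] d\<psi>] D_t_chain[OF dw F(1)] D\<psi>(1) by simp
    have f': "(f has_real_derivative - h) (at (w z))" using f(4)[of "w z"] by (simp add: h_def)
    have g\<phi>: "grad_x ?\<phi> z = f (w z) *\<^sub>R ((m * \<zeta> z ^ (n + 1)) *\<^sub>R grad_x \<zeta> z) + ?\<psi> z *\<^sub>R ((- h) *\<^sub>R grad_x w z)"
      using grad_x_mult[OF differentiable_chain_real[OF dw f'] d\<psi>] grad_x_chain[OF dw f'] D\<psi>(2) by simp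
    have form: "a_form a ?\<phi> w z = \<zeta> z ^ n * (f (w z) * m * \<zeta> z * ?b - h * (\<zeta> z)\<^sup>2 * ?Q)"
      unfolding a_form_bil g\<phi> by (simp add: bil_simps power2_eq_square algebra_simps)
    have y1: "y \<ge> 1" "\<bar>w z\<bar> \<le> \<epsilon> * y"
    proof -
      have "1 + \<bar>w z\<bar> / \<epsilon> \<ge> 1" using \<epsilon> by simp
      then have y: "1 + \<bar>w z\<bar> / \<epsilon> \<le> y"
        unfolding y_def using powr_mono[OF p(1), of "1 + \<bar>w z\<bar> / \<epsilon>"] by simp
      then show "y \<ge> 1" using \<open>1 + \<bar>w z\<bar> / \<epsilon> \<ge> 1\<close> by linarith
      have "\<bar>w z\<bar> / \<epsilon> \<le> y" using y by linarith
      then show "\<bar>w z\<bar> \<le> \<epsilon> * y" using \<epsilon> by (simp add: field_simps)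
    qed
    have hy: "1 / h \<le> \<epsilon> * y"
    proof -
      have "1 / h = \<epsilon> * (1 + (w z / \<epsilon>)\<^sup>2) powr (p / 2)"
        using powr_minus_divide[of "1 + (w z / \<epsilon>)\<^sup>2" "p / 2"] \<epsilon> unfolding h_def
        by (simp only: minus_divide_left divide_divide_eq_right times_divide_eq_right mult_1_right mult_1_left) simp
      also have "\<dots> \<le> \<epsilon> * (1 + \<bar>w z / \<epsilon>\<bar>) powr p"
        using p(1) \<epsilon> by (intro mult_left_mono one_plus_square_powr_le) auto
      finally show ?thesis using \<epsilon> by (simp add: y_def abs_div)
    qed
    have S0: "0 \<le> ?S" and S: "?S \<le> \<kappa> * indicator B z"
      using bil_nonneg[OF elim(1)] elim(3) by (simp_all add: a_form_bil)
    have e1: "f (w z) * m * \<zeta> z * ?b - h * (\<zeta> z)\<^sup>2 * ?Q \<le> M\<^sup>2 * m\<^sup>2 * \<epsilon> * y * (\<kappa> * indicator B z)"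
    proof -
      have "f (w z) * m * \<zeta> z * ?b - h * (\<zeta> z)\<^sup>2 * ?Q \<le> (f (w z))\<^sup>2 * m\<^sup>2 / (4 * h) * ?S"
        using energy_absorption[OF elim(1) h, of "f (w z)" m "\<zeta> z" "grad_x \<zeta> z" "grad_x w z"] f(2)[of "w z"] m
        by simp
      also have "\<dots> = (f (w z))\<^sup>2 * (m\<^sup>2 / 4) * (1 / h) * ?S" by simp
      also have "\<dots> \<le> M\<^sup>2 * m\<^sup>2 * (\<epsilon> * y) * (\<kappa> * indicator B z)"
        using power_mono[OF fM[of "w z"], of 2] hy h S S0 y1(1) \<epsilon>
        by (intro mult_mono) auto
      finally show ?thesis by (simp add: mult_ac)
    qed
    have e2: "- F (w z) * (m * \<zeta> z ^ (n + 1) * D_t \<zeta> z) \<le> \<zeta> z ^ n * (M\<^sup>2 * m\<^sup>2 * \<epsilon> * y * (\<kappa> * indicator B z))"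
    proof -
      have "- F (w z) * (m * \<zeta> z ^ (n + 1) * D_t \<zeta> z) \<le> \<bar>F (w z)\<bar> * (m * (\<zeta> z ^ n * \<zeta> z) * \<bar>D_t \<zeta> z\<bar>)"
        using abs_ge_self[of "- F (w z) * (m * \<zeta> z ^ (n + 1) * D_t \<zeta> z)"] \<zeta>(2)[of z] m
        by (simp add: abs_mult mult_ac)
      also have "\<dots> \<le> (M\<^sup>2 * (\<epsilon> * y)) * (m\<^sup>2 * (\<zeta> z ^ n * 1) * (\<kappa> * indicator B z))"
      proof (intro mult_mono)
        have "\<bar>F (w z)\<bar> \<le> M * \<bar>w z\<bar>" by (rule F(2))
        also have "\<dots> \<le> M\<^sup>2 * (\<epsilon> * y)"
          using y1(2) M by (intro mult_mono) (auto simp: power2_eq_square)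
        finally show "\<bar>F (w z)\<bar> \<le> M\<^sup>2 * (\<epsilon> * y)" .
        show "m \<le> m\<^sup>2" using m by (simp add: power2_eq_square)
      qed (use \<zeta>(2,3)[of z] B(2) B(3)[of z] m y1(1) \<epsilon> in auto)
      finally show ?thesis by (simp add: mult_ac)
    qed
    have "D_t w z * ?\<phi> z + a_form a ?\<phi> w z = D_t ?G z - F (w z) * (m * \<zeta> z ^ (n + 1) * D_t \<zeta> z) +
        \<zeta> z ^ n * (f (w z) * m * \<zeta> z * ?b - h * (\<zeta> z)\<^sup>2 * ?Q)"
      unfolding DG form by (simp add: mult_ac)
    also have "\<dots> \<le> D_t ?G z + \<zeta> z ^ n * (M\<^sup>2 * m\<^sup>2 * \<epsilon> * y * (\<kappa> * indicator B z)) +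
        \<zeta> z ^ n * (M\<^sup>2 * m\<^sup>2 * \<epsilon> * y * (\<kappa> * indicator B z))"
      using e2 mult_left_mono[OF e1 zero_le_power[OF \<zeta>(2)], of z n] by linarith
    also have "\<dots> = D_t ?G z + C * ?r z"
      unfolding C_def y_def by (simp add: algebra_simps)
    finally show ?case .
  qed
  have "pairing a \<Omega> ?\<phi> w \<le> (LINT z|lebesgue_on \<Omega>. D_t ?G z + C * ?r z)"
    unfolding pairing_def using bd \<phi>_int G0(1) r_int by (intro integral_mono_AE) auto
  also have "\<dots> = C * (LINT z|lebesgue_on \<Omega>. ?r z)"
    using G0 r_int by simp
  finally show "pairing a \<Omega> ?\<phi> w \<le> 2 * M\<^sup>2 * (real (n + 2))\<^sup>2 * \<kappa> * \<epsilon> * (LINT z|lebesgue_on \<Omega>. ?r z)"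
    by (simp only: C_def m_def)
qed

section \<open>The limit of the approximating sequence\<close>

text \<open>A small power is small where $x$ is small and is dominated by the larger power elsewhere; this
  passes $L^q$ convergence on to $L^p$ on a space of finite measure.\<close>

lemma powr_le_const_add:
  fixes p q \<theta> :: real
  assumes "0 < p" "p < q" "\<theta> > 0"
  obtains C where "C \<ge> 0" "\<And>x. x \<ge> 0 \<Longrightarrow> x powr p \<le> \<theta> + C * x powr q"
proof
  let ?c = "(\<theta> powr (1 / p)) powr (q - p)"
  show "1 / ?c \<ge> 0" by simp
  fix x :: real assume x: "x \<ge> 0"
  show "x powr p \<le> \<theta> + 1 / ?c * x powr q"
  proof (cases "x powr p \<le> \<theta>")
    case True
    then show ?thesis by (simp add: add_increasing2)
  next
    case False
    have "\<theta> powr (1 / p) \<le> (x powr p) powr (1 / p)"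
      using False assms by (intro powr_mono2) auto
    then have "\<theta> powr (1 / p) \<le> x" using assms x by (simp add: powr_powr)
    then have c: "?c \<le> x powr (q - p)" using assms by (intro powr_mono2) auto
    have "?c > 0" using assms(3) by simp
    have "x powr p * ?c \<le> x powr p * x powr (q - p)" using c by (intro mult_left_mono) auto
    also have "\<dots> = x powr q" by (simp flip: powr_add)
    finally have "x powr p \<le> x powr q / ?c" using \<open>?c > 0\<close> by (simp only: pos_le_divide_eq)
    then show ?thesis using assms(3) by simp
  qed
qed

text \<open>The opposite distribution of the small constant: it makes the lower power absorbable by the higher
  one.\<close>

lemma powr_le_add_const:
  fixes p q \<eta> :: real
  assumes "0 < p" "p < q" "\<eta> > 0"
  obtains C where "C \<ge> 0" "\<And>x. x \<ge> 0 \<Longrightarrow> x powr p \<le> \<eta> * x powr q + C"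
proof -
  let ?c = "(1 / \<eta>) powr (1 / (q - p))"
  show ?thesis
  proof (rule that[of "?c powr p"])
    show "?c powr p \<ge> 0" by simp
    fix x :: real assume x: "x \<ge> 0"
    show "x powr p \<le> \<eta> * x powr q + ?c powr p"
    proof (cases "x \<le> ?c")
      case True
      then have "x powr p \<le> ?c powr p" using assms x by (intro powr_mono2) auto
      then show ?thesis using assms(3) by (simp add: add_increasing)
    next
      case False
      then have "?c powr (q - p) \<le> x powr (q - p)" using assms by (intro powr_mono2) auto
      then have "1 / \<eta> \<le> x powr (q - p)" using assms by (simp add: powr_powr)
      then have "1 \<le> \<eta> * x powr (q - p)" using assms(3) by (simp add: field_simps)
      then have "x powr p * 1 \<le> x powr p * (\<eta> * x powr (q - p))" by (intro mult_left_mono) auto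
      also have "\<dots> = \<eta> * x powr q" by (simp add: mult.left_commute flip: powr_add)
      finally show ?thesis by (simp add: add_increasing2)
    qed
  qed
qed

lemma tendsto_integral_lower_powr:
  fixes d :: "nat \<Rightarrow> 'a \<Rightarrow> real"
  assumes "finite_measure M" "0 < p" "p < q" "\<And>k. d k \<in> borel_measurable M"
    "\<And>k. integrable M (\<lambda>z. \<bar>d k z\<bar> powr q)" "(\<lambda>k. LINT z|M. \<bar>d k z\<bar> powr q) \<longlonglongrightarrow> 0"
  shows "integrable M (\<lambda>z. \<bar>d k z\<bar> powr p)" "(\<lambda>k. LINT z|M. \<bar>d k z\<bar> powr p) \<longlonglongrightarrow> 0"
proof -
  interpret finite_measure M by (rule assms(1))
  show int: "integrable M (\<lambda>z. \<bar>d k z\<bar> powr p)" for k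
  proof (rule Bochner_Integration.integrable_bound)
    show "integrable M (\<lambda>z. (1 + \<bar>d k z\<bar> / 1) powr p)"
      using assms by (intro integrable_powr_shift[of M p q]) auto
    show "(\<lambda>z. \<bar>d k z\<bar> powr p) \<in> borel_measurable M" using assms(4)[of k] by measurable
    have "\<bar>d k z\<bar> powr p \<le> (1 + \<bar>d k z\<bar> / 1) powr p" for z
      using assms(2) by (intro powr_mono2) auto
    then show "AE z in M. norm (\<bar>d k z\<bar> powr p) \<le> norm ((1 + \<bar>d k z\<bar> / 1) powr p)" by simp
  qed
  show "(\<lambda>k. LINT z|M. \<bar>d k z\<bar> powr p) \<longlonglongrightarrow> 0"
  proof (rule LIMSEQ_I)
    fix e :: real assume e: "e > 0"
    let ?m = "measure M (space M)"
    define \<theta> where "\<theta> = e / 2 / (?m + 1)"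
    have m: "?m + 1 > 0" by (simp add: add_nonneg_pos)
    have "?m + 1 \<noteq> 0" using m by linarith
    then have \<theta>: "\<theta> > 0" "\<theta> * (?m + 1) = e / 2"
      using e m nonzero_eq_divide_eq[THEN iffD1, OF _ \<theta>_def] by (simp_all add: \<theta>_def)
    obtain C where C: "C \<ge> 0" "\<And>x. x \<ge> 0 \<Longrightarrow> x powr p \<le> \<theta> + C * x powr q"
      using powr_le_const_add[OF assms(2,3) \<theta>(1)] by blast
    have le: "(LINT z|M. \<bar>d k z\<bar> powr p) \<le> \<theta> * ?m + C * (LINT z|M. \<bar>d k z\<bar> powr q)" for k
    proof -
      have "(LINT z|M. \<bar>d k z\<bar> powr p) \<le> (LINT z|M. \<theta> + C * \<bar>d k z\<bar> powr q)"
        using int assms(5) C(2) by (intro integral_mono) auto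
      then show ?thesis using assms(5) by (simp add: mult.commute)
    qed
    have "(\<lambda>k. C * (LINT z|M. \<bar>d k z\<bar> powr q)) \<longlonglongrightarrow> C * 0"
      by (intro tendsto_intros assms(6))
    then obtain N where N: "\<And>k. k \<ge> N \<Longrightarrow> norm (C * (LINT z|M. \<bar>d k z\<bar> powr q) - C * 0) < e / 2"
      using LIMSEQ_D[of _ "C * 0" "e / 2"] e by (metis half_gt_zero)
    show "\<exists>N. \<forall>k\<ge>N. norm ((LINT z|M. \<bar>d k z\<bar> powr p) - 0) < e"
    proof (intro exI[of _ N] allI impI)
      fix k assume "k \<ge> N"
      then have "C * (LINT z|M. \<bar>d k z\<bar> powr q) < e / 2"
        using N[of k] by simp
      moreover have "\<theta> * ?m \<le> e / 2" using \<theta> by (simp add: algebra_simps)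
      moreover have "0 \<le> (LINT z|M. \<bar>d k z\<bar> powr p)" by simp
      ultimately show "norm ((LINT z|M. \<bar>d k z\<bar> powr p) - 0) < e"
        using le[of k] by simp
    qed
  qed
qed

text \<open>For arguments of equal sign this is the superadditivity of $x^q$; for opposite signs
  the difference is a sum of two powers, and the factor $2^{-q}$ comes from comparing it with the
  power of the sum.\<close>

lemma signed_powr_diff_lower_bound:
  fixes x y q :: real
  assumes "1 < q" "y \<le> x"
  shows "2 powr (- q) * \<bar>x - y\<bar> powr q \<le> signed_powr q x - signed_powr q y"
proof -
  have abs_pow: "\<bar>s\<bar> powr (q - 1) * \<bar>s\<bar> = \<bar>s\<bar> powr q" for s :: real
    using powr_mult_base[of "\<bar>s\<bar>" "q - 1"] by (simp add: mult.commute)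
  have two: "2 powr (- q) \<le> 1"
    using powr_mono[of "- q" 0 2] assms(1) by simp
  have super: "d powr q + s powr q \<le> (d + s) powr q" if "d \<ge> 0" "s \<ge> 0" for d s :: real
  proof -
    have "d powr q + s powr q = d * d powr (q - 1) + s * s powr (q - 1)"
      using that powr_mult_base[of d "q - 1"] powr_mult_base[of s "q - 1"] by simp
    also have "\<dots> \<le> d * (d + s) powr (q - 1) + s * (d + s) powr (q - 1)"
      using that assms(1) by (intro add_mono mult_left_mono powr_mono2) auto
    also have "\<dots> = (d + s) powr q"
      using that powr_mult_base[of "d + s" "q - 1"] by (simp add: distrib_right)
    finally show ?thesis .
  qed
  consider "y \<ge> 0" | "x \<le> 0" | "y < 0" "0 < x" by linarith
  then show ?thesis
  proof cases
    case 1
    have "2 powr (- q) * \<bar>x - y\<bar> powr q \<le> 1 * (x - y) powr q"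
      using two assms(2) by (intro mult_mono) auto
    also have "\<dots> \<le> x powr q - y powr q"
      using super[of "x - y" y] 1 assms(2) by simp
    finally show ?thesis using abs_pow[of x] abs_pow[of y] 1 assms(2) by simp
  next
    case 2
    have "2 powr (- q) * \<bar>x - y\<bar> powr q \<le> 1 * (x - y) powr q"
      using two assms(2) by (intro mult_mono) auto
    also have "\<dots> \<le> (- y) powr q - (- x) powr q"
      using super[of "x - y" "- x"] 2 assms(2) by simp
    finally show ?thesis using abs_pow[of x] abs_pow[of y] 2 assms(2) by simp
  next
    case 3
    have "2 powr (- q) * \<bar>x - y\<bar> powr q \<le> 2 powr (- q) * (2 powr q * (x powr q + (- y) powr q))"
      using powr_add_le[of q x "- y"] 3 assms by (intro mult_left_mono) auto
    also have "\<dots> = x powr q + (- y) powr q"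
      by (simp add: powr_minus)
    finally show ?thesis using abs_pow[of x] abs_pow[of y] 3 by simp
  qed
qed

text \<open>As the profile is at least 1 and the reaction term is nonnegative, the left-hand side of the
  inequality for $w_k$ is bounded below independently of $k$. On the right, convergence in
  $L^q$ implies convergence in $L^p$, so $w_k$ can be replaced by $u - v$ up to a factor.\<close>

lemma reaction_bound:
  fixes u v \<zeta> :: "'n::finite spacetime \<Rightarrow> real"
  assumes std: "standing_assumptions a A" and q: "1 < q" and p: "1 < p" "p < q"
    and sol: "weak_solution a q u v" and uv: "AE z in lebesgue. u z \<ge> v z"
    and \<Omega>: "bounded_domain \<Omega>" and \<epsilon>: "\<epsilon> > 0"
    and f: "smooth_on UNIV f" "\<And>s. 1 \<le> f s" "\<And>s. f s \<le> M"
      "\<And>s. (f has_real_derivative - (1 / \<epsilon>) * (1 + (s / \<epsilon>)\<^sup>2) powr (- p / 2)) (at s)"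
    and F: "\<And>s. (F has_real_derivative f s) (at s)" "\<And>s. \<bar>F s\<bar> \<le> M * \<bar>s\<bar>"
    and \<zeta>: "smooth_on UNIV \<zeta>" "\<And>z. 0 \<le> \<zeta> z" "\<And>z. \<zeta> z \<le> 1"
    and K: "compact K" "K \<subseteq> \<Omega>" "\<And>z. z \<notin> K \<Longrightarrow> \<zeta> z = 0"
    and B: "B \<in> sets lebesgue" "\<kappa> \<ge> 0" "\<And>z. \<bar>D_t \<zeta> z\<bar> \<le> \<kappa> * indicator B z"
      "AE z in lebesgue. a_form a \<zeta> \<zeta> z \<le> \<kappa> * indicator B z"
  shows "integrable (lebesgue_on \<Omega>) (\<lambda>z. \<bar>u z - v z\<bar> powr q)"
    and "2 powr (- q) * (LINT z|lebesgue_on \<Omega>. \<bar>u z - v z\<bar> powr q * \<zeta> z ^ (n + 2)) \<le>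
      2 powr p * (2 * M\<^sup>2 * (real (n + 2))\<^sup>2 * \<kappa> * \<epsilon>) *
      (LINT z|lebesgue_on \<Omega>. indicator B z * (\<zeta> z ^ n * (1 + \<bar>u z - v z\<bar> / \<epsilon>) powr p))"
proof -
  have o: "open \<Omega>" and b: "bounded \<Omega>" using \<Omega> by (simp_all add: bounded_domain_def)
  define \<omega> where "\<omega> z = u z - v z" for z
  define g where "g z = signed_powr q (u z) - signed_powr q (v z)" for z
  define C where "C = 2 * M\<^sup>2 * (real (n + 2))\<^sup>2 * \<kappa> * \<epsilon>"
  let ?\<psi> = "\<lambda>z. \<zeta> z ^ (n + 2)"
  have M: "M \<ge> 1" using f(2,3)[of 0] by simp
  have C: "C \<ge> 0" using B(2) \<epsilon> by (simp add: C_def)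
  have \<psi>: "smooth_on UNIV ?\<psi>" by (intro smooth_on_power \<zeta>(1)) simp
  have \<psi>01: "0 \<le> ?\<psi> z" "?\<psi> z \<le> 1" for z
    using zero_le_power[OF \<zeta>(2)] power_le_one[OF \<zeta>(2,3)] by blast+
  have \<psi>K: "?\<psi> z = 0" if "z \<notin> K" for z using K(3)[OF that] by simp
  have f0: "0 \<le> f s" and fM: "\<bar>f s\<bar> \<le> M" for s using f(2,3)[of s] by simp_all
  have p0: "0 < p" using p by simp
  obtain w where wW': "\<forall>k. w k \<in> W_smooth a q \<Omega>"
    and conv: "\<forall>k. integrable (lebesgue_on \<Omega>) (\<lambda>z. \<bar>w k z - (u z - v z)\<bar> powr q)"
      "(\<lambda>k. LINT z|lebesgue_on \<Omega>. \<bar>w k z - (u z - v z)\<bar> powr q) \<longlonglongrightarrow> 0"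
      "integrable (lebesgue_on \<Omega>) (\<lambda>z. \<bar>u z - v z\<bar> powr q)"
    and g_int': "\<forall>B \<phi>. smooth_on \<Omega> \<phi> \<longrightarrow> (\<forall>z. \<bar>\<phi> z\<bar> \<le> B) \<longrightarrow> integrable (lebesgue_on \<Omega>) (\<lambda>z. (signed_powr q (u z) - signed_powr q (v z)) * \<phi> z)"
    and main': "\<forall>e>0. \<exists>N. \<forall>k\<ge>N. (LINT z|lebesgue_on \<Omega>. (signed_powr q (u z) - signed_powr q (v z)) * (f (w k z) * ?\<psi> z)) \<le>
      e + pairing a \<Omega> (\<lambda>z. f (w k z) * ?\<psi> z) (w k)"
    by (rule composed_test_inequality[OF std q sol \<Omega> f(1) f0 f(3,4) profile_derivative_le[OF less_imp_le[OF p0] \<epsilon>] \<psi> \<psi>01 K(1,2) \<psi>K], assumption)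
      (rule that; assumption)
  have wW: "w k \<in> W_smooth a q \<Omega>" for k using wW' by blast
  have g_int: "integrable (lebesgue_on \<Omega>) (\<lambda>z. g z * \<phi> z)"
    if "smooth_on \<Omega> \<phi>" "\<And>z. \<bar>\<phi> z\<bar> \<le> B" for B \<phi>
    using g_int' that unfolding g_def by blast
  note d_int = conv(1)[rule_format, folded \<omega>_def] and d_lim = conv(2)[folded \<omega>_def] and \<omega>_int = conv(3)[folded \<omega>_def]
  note main = main'[rule_format, folded g_def]
  show "integrable (lebesgue_on \<Omega>) (\<lambda>z. \<bar>u z - v z\<bar> powr q)"
    using \<omega>_int by (simp only: \<omega>_def)
  interpret finite_measure "lebesgue_on \<Omega>" by (rule bounded_open_finite_measure[OF o b])
  have wm: "w k \<in> borel_measurable (lebesgue_on \<Omega>)" for k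
    using wW[of k] smooth_on_measurable[OF o] by (simp add: W_smooth_iff[OF q o])
  have \<omega>m: "\<omega> \<in> borel_measurable (lebesgue_on \<Omega>)"
  proof -
    obtain X Y where "W_loc a q X u" "W_loc a q Y v" using sol unfolding weak_solution_def by metis
    then have "u \<in> borel_measurable lebesgue" "v \<in> borel_measurable lebesgue" using W_loc_measurable by blast+
    then show ?thesis unfolding \<omega>_def[abs_def]
      by (intro borel_measurable_diff measurable_lebesgue_on)
  qed
  have \<zeta>m: "\<zeta> \<in> borel_measurable (lebesgue_on \<Omega>)"
    using smooth_on_measurable[OF o] smooth_on_subset[OF \<zeta>(1)] by blast
  have Bm: "indicator B \<in> borel_measurable (lebesgue_on \<Omega>)"
    using B(1) by (intro measurable_lebesgue_on) simp
  have dm: "(\<lambda>z. w k z - \<omega> z) \<in> borel_measurable (lebesgue_on \<Omega>)" for k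
    using wm \<omega>m by (rule borel_measurable_diff)
  note dp = tendsto_integral_lower_powr[OF finite_measure_axioms p0 p(2) dm d_int d_lim]
  let ?I = "LINT z|lebesgue_on \<Omega>. indicator B z * (\<zeta> z ^ n * (1 + \<bar>\<omega> z\<bar> / \<epsilon>) powr p)"
  let ?D = "\<lambda>k. LINT z|lebesgue_on \<Omega>. \<bar>w k z - \<omega> z\<bar> powr p"
  have I_int: "integrable (lebesgue_on \<Omega>) (\<lambda>z. indicator B z * (\<zeta> z ^ n * (1 + \<bar>\<omega> z\<bar> / \<epsilon>) powr p))"
  proof (rule Bochner_Integration.integrable_bound)
    show "integrable (lebesgue_on \<Omega>) (\<lambda>z. (1 + \<bar>\<omega> z\<bar> / \<epsilon>) powr p)"
      using p by (intro integrable_powr_shift[OF finite_measure_axioms _ _ \<epsilon> \<omega>m \<omega>_int]) auto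
    show "(\<lambda>z. indicator B z * (\<zeta> z ^ n * (1 + \<bar>\<omega> z\<bar> / \<epsilon>) powr p)) \<in> borel_measurable (lebesgue_on \<Omega>)"
      using \<omega>m \<zeta>m Bm by measurable
    have "\<bar>indicator B z * (\<zeta> z ^ n * (1 + \<bar>\<omega> z\<bar> / \<epsilon>) powr p)\<bar> \<le> 1 * (1 * (1 + \<bar>\<omega> z\<bar> / \<epsilon>) powr p)" for z
      unfolding abs_mult using \<zeta>(2,3)[of z] by (intro mult_mono) (auto simp: power_le_one indicator_def)
    then show "AE z in lebesgue_on \<Omega>. norm (indicator B z * (\<zeta> z ^ n * (1 + \<bar>\<omega> z\<bar> / \<epsilon>) powr p)) \<le>
        norm ((1 + \<bar>\<omega> z\<bar> / \<epsilon>) powr p)" by simp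
  qed
  have bound: "(LINT z|lebesgue_on \<Omega>. indicator B z * (\<zeta> z ^ n * (1 + \<bar>w k z\<bar> / \<epsilon>) powr p)) \<le>
      2 powr p * (?I + (1 / \<epsilon>) powr p * ?D k)" for k
  proof -
    have "(LINT z|lebesgue_on \<Omega>. indicator B z * (\<zeta> z ^ n * (1 + \<bar>w k z\<bar> / \<epsilon>) powr p)) \<le>
      (LINT z|lebesgue_on \<Omega>. 2 powr p * (indicator B z * (\<zeta> z ^ n * (1 + \<bar>\<omega> z\<bar> / \<epsilon>) powr p) +
        (1 / \<epsilon>) powr p * \<bar>w k z - \<omega> z\<bar> powr p))"
    proof (rule integral_mono)
      show "integrable (lebesgue_on \<Omega>) (\<lambda>z. indicator B z * (\<zeta> z ^ n * (1 + \<bar>w k z\<bar> / \<epsilon>) powr p))"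
        using pairing_upper_bound(2)[OF std q _ _ o b wW \<epsilon> f F \<zeta> K B] p by simp
      fix z
      have "(1 + \<bar>w k z\<bar> / \<epsilon>) powr p \<le> ((1 + \<bar>\<omega> z\<bar> / \<epsilon>) + \<bar>w k z - \<omega> z\<bar> / \<epsilon>) powr p"
      proof (rule powr_mono2)
        have "\<bar>w k z\<bar> / \<epsilon> \<le> (\<bar>\<omega> z\<bar> + \<bar>w k z - \<omega> z\<bar>) / \<epsilon>"
          using \<epsilon> by (intro divide_right_mono) auto
        then show "1 + \<bar>w k z\<bar> / \<epsilon> \<le> 1 + \<bar>\<omega> z\<bar> / \<epsilon> + \<bar>w k z - \<omega> z\<bar> / \<epsilon>"
          by (simp add: add_divide_distrib)
      qed (use p \<epsilon> in auto)
      also have "\<dots> \<le> 2 powr p * ((1 + \<bar>\<omega> z\<bar> / \<epsilon>) powr p + (\<bar>w k z - \<omega> z\<bar> / \<epsilon>) powr p)"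
        using p \<epsilon> by (intro powr_add_le) auto
      also have "(\<bar>w k z - \<omega> z\<bar> / \<epsilon>) powr p = (1 / \<epsilon>) powr p * \<bar>w k z - \<omega> z\<bar> powr p"
        using \<epsilon> by (simp add: powr_divide)
      finally have "indicator B z * (\<zeta> z ^ n * (1 + \<bar>w k z\<bar> / \<epsilon>) powr p) \<le>
          indicator B z * (\<zeta> z ^ n * (2 powr p * ((1 + \<bar>\<omega> z\<bar> / \<epsilon>) powr p + (1 / \<epsilon>) powr p * \<bar>w k z - \<omega> z\<bar> powr p)))"
        using \<zeta>(2)[of z] by (intro mult_left_mono) auto
      also have "\<dots> = 2 powr p * (indicator B z * (\<zeta> z ^ n * (1 + \<bar>\<omega> z\<bar> / \<epsilon>) powr p) +
          (indicator B z * \<zeta> z ^ n) * ((1 / \<epsilon>) powr p * \<bar>w k z - \<omega> z\<bar> powr p))"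
        by (simp only: distrib_left mult_ac)
      also have "\<dots> \<le> 2 powr p * (indicator B z * (\<zeta> z ^ n * (1 + \<bar>\<omega> z\<bar> / \<epsilon>) powr p) +
          1 * ((1 / \<epsilon>) powr p * \<bar>w k z - \<omega> z\<bar> powr p))"
        using power_le_one[OF \<zeta>(2,3), of z n]
        by (intro mult_left_mono add_left_mono mult_right_mono) (auto simp: indicator_def)
      finally show "indicator B z * (\<zeta> z ^ n * (1 + \<bar>w k z\<bar> / \<epsilon>) powr p) \<le>
          2 powr p * (indicator B z * (\<zeta> z ^ n * (1 + \<bar>\<omega> z\<bar> / \<epsilon>) powr p) +
          (1 / \<epsilon>) powr p * \<bar>w k z - \<omega> z\<bar> powr p)" by simp
    qed (use I_int dp(1) in simp)
    also have "\<dots> = 2 powr p * (?I + (1 / \<epsilon>) powr p * ?D k)"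
      using I_int dp(1) by simp
    finally show ?thesis .
  qed
  let ?L = "2 powr (- q) * (LINT z|lebesgue_on \<Omega>. \<bar>\<omega> z\<bar> powr q * ?\<psi> z)"
  have lower: "?L \<le> (LINT z|lebesgue_on \<Omega>. g z * (f (w k z) * ?\<psi> z))" for k
  proof -
    have wk: "smooth_on \<Omega> (\<lambda>z. f (w k z) * ?\<psi> z)"
      using wW[of k] f(1) o smooth_on_subset[OF \<psi>]
      by (intro smooth_on_mult smooth_on_compose[of \<Omega> UNIV f "w k"]) (auto simp: W_smooth_iff[OF q o])
    have \<phi>M: "\<bar>f (w k z) * ?\<psi> z\<bar> \<le> M * 1" for z
      unfolding abs_mult using fM \<psi>01[of z] M by (intro mult_mono) auto
    have L_int: "integrable (lebesgue_on \<Omega>) (\<lambda>z. \<bar>\<omega> z\<bar> powr q * ?\<psi> z)"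
    proof (rule Bochner_Integration.integrable_bound[OF \<omega>_int])
      show "(\<lambda>z. \<bar>\<omega> z\<bar> powr q * ?\<psi> z) \<in> borel_measurable (lebesgue_on \<Omega>)"
        using \<omega>m \<zeta>m by measurable
      have "norm (\<bar>\<omega> z\<bar> powr q * ?\<psi> z) \<le> norm (\<bar>\<omega> z\<bar> powr q)" for z
      proof -
        have "\<bar>\<omega> z\<bar> powr q * ?\<psi> z \<le> \<bar>\<omega> z\<bar> powr q * 1" by (intro mult_left_mono \<psi>01) auto
        moreover have "0 \<le> \<bar>\<omega> z\<bar> powr q * ?\<psi> z" by (intro mult_nonneg_nonneg \<psi>01) auto
        ultimately show ?thesis by (simp only: real_norm_def abs_of_nonneg powr_ge_zero mult_1_right)
      qed
      then show "AE z in lebesgue_on \<Omega>. norm (\<bar>\<omega> z\<bar> powr q * ?\<psi> z) \<le> norm (\<bar>\<omega> z\<bar> powr q)" by simp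
    qed
    have "?L = (LINT z|lebesgue_on \<Omega>. 2 powr (- q) * (\<bar>\<omega> z\<bar> powr q * ?\<psi> z))" by simp
    also have "\<dots> \<le> (LINT z|lebesgue_on \<Omega>. g z * (f (w k z) * ?\<psi> z))"
    proof (rule integral_mono_AE)
      show "integrable (lebesgue_on \<Omega>) (\<lambda>z. 2 powr (- q) * (\<bar>\<omega> z\<bar> powr q * ?\<psi> z))" using L_int by simp
      show "integrable (lebesgue_on \<Omega>) (\<lambda>z. g z * (f (w k z) * ?\<psi> z))" by (rule g_int[OF wk \<phi>M])
      show "AE z in lebesgue_on \<Omega>. 2 powr (- q) * (\<bar>\<omega> z\<bar> powr q * ?\<psi> z) \<le> g z * (f (w k z) * ?\<psi> z)"
        using AE_lebesgue_on[OF o uv]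
      proof eventually_elim
        case (elim z)
        have g: "2 powr (- q) * \<bar>\<omega> z\<bar> powr q \<le> g z"
          unfolding \<omega>_def g_def by (rule signed_powr_diff_lower_bound[OF q elim])
        moreover have "0 \<le> 2 powr (- q) * \<bar>\<omega> z\<bar> powr q" by simp
        ultimately have g0: "0 \<le> g z" by linarith
        have "2 powr (- q) * \<bar>\<omega> z\<bar> powr q * (1 * ?\<psi> z) \<le> g z * (f (w k z) * ?\<psi> z)"
          using g g0 f(2) f0 \<psi>01[of z] by (intro mult_mono) auto
        then show ?case by (simp add: mult.assoc)
      qed
    qed
    finally show ?thesis .
  qed
  have "?L \<le> C * (2 powr p * ?I)"
  proof (rule field_le_epsilon)
    fix e :: real assume e: "e > 0"
    obtain N where N: "\<forall>k\<ge>N. (LINT z|lebesgue_on \<Omega>. g z * (f (w k z) * ?\<psi> z)) \<le>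
        e + pairing a \<Omega> (\<lambda>z. f (w k z) * ?\<psi> z) (w k)"
      using main[OF e] ..
    have "?L \<le> e + C * (2 powr p * (?I + (1 / \<epsilon>) powr p * ?D k))" if "k \<ge> N" for k
    proof -
      have "?L \<le> e + pairing a \<Omega> (\<lambda>z. f (w k z) * ?\<psi> z) (w k)"
        using lower[of k] N that by (meson order_trans)
      also have "pairing a \<Omega> (\<lambda>z. f (w k z) * ?\<psi> z) (w k) \<le>
          C * (LINT z|lebesgue_on \<Omega>. indicator B z * (\<zeta> z ^ n * (1 + \<bar>w k z\<bar> / \<epsilon>) powr p))"
        unfolding C_def using p by (intro pairing_upper_bound(1)[OF std q _ _ o b wW \<epsilon> f F \<zeta> K B]) auto
      also have "\<dots> \<le> C * (2 powr p * (?I + (1 / \<epsilon>) powr p * ?D k))"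
        using C by (intro mult_left_mono bound)
      finally show ?thesis by simp
    qed
    moreover have "(\<lambda>k. e + C * (2 powr p * (?I + (1 / \<epsilon>) powr p * ?D k))) \<longlonglongrightarrow>
        e + C * (2 powr p * (?I + (1 / \<epsilon>) powr p * 0))"
      by (intro tendsto_intros dp(2))
    ultimately have "?L \<le> e + C * (2 powr p * (?I + (1 / \<epsilon>) powr p * 0))"
      by (intro LIMSEQ_le_const[of _ _ ?L]) auto
    then show "?L \<le> C * (2 powr p * ?I) + e" by simp
  qed
  then show "2 powr (- q) * (LINT z|lebesgue_on \<Omega>. \<bar>u z - v z\<bar> powr q * \<zeta> z ^ (n + 2)) \<le>
      2 powr p * (2 * M\<^sup>2 * (real (n + 2))\<^sup>2 * \<kappa> * \<epsilon>) *
      (LINT z|lebesgue_on \<Omega>. indicator B z * (\<zeta> z ^ n * (1 + \<bar>u z - v z\<bar> / \<epsilon>) powr p))"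
    by (simp only: \<omega>_def C_def mult.assoc mult.left_commute[of "2 powr p"])
qed

section \<open>Cylinders and the scaled estimate\<close>

definition cyl :: "real \<Rightarrow> real \<Rightarrow> 'n::finite spacetime set" where
  "cyl T R = cball 0 T \<times> cball 0 R"

lemma mem_cyl: "(t, x) \<in> cyl T R \<longleftrightarrow> \<bar>t\<bar> \<le> T \<and> norm x \<le> R"
  by (auto simp: cyl_def)

lemma compact_cyl: "compact (cyl T R)"
  unfolding cyl_def by (intro compact_Times compact_cball)

lemma cyl_lmeasurable: "cyl T R \<in> lmeasurable"
  by (intro lmeasurable_compact compact_cyl)

lemma cyl_sets [measurable]: "cyl T R \<in> sets lebesgue"
  using cyl_lmeasurable by (rule fmeasurableD)

lemma measure_cyl_le:
  obtains V where "V > 0" "\<And>T R. T > 0 \<Longrightarrow> R > 0 \<Longrightarrow>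
    measure lebesgue (cyl T R :: 'n::finite spacetime set) \<le> V * T * R ^ CARD('n)"
proof (rule that[of "2 * unit_ball_vol (real CARD('n))"])
  show "2 * unit_ball_vol (real CARD('n)) > 0" by (simp add: unit_ball_vol_pos)
  fix T R :: real assume T: "T > 0" and R: "R > 0"
  have "cyl T R \<in> sets (borel :: 'n spacetime measure)"
    by (intro borel_closed compact_imp_closed compact_cyl)
  then have "emeasure lebesgue (cyl T R :: 'n spacetime set) = emeasure (lborel \<Otimes>\<^sub>M lborel) (cyl T R :: 'n spacetime set)"
    by (simp add: lborel_prod)
  also have "\<dots> = emeasure lborel (cball (0::real) T) * emeasure lborel (cball (0::real^'n) R)"
    unfolding cyl_def by (intro lborel.emeasure_pair_measure_Times) auto
  also have "\<dots> = ennreal (2 * T) * ennreal (unit_ball_vol (real CARD('n)) * R ^ CARD('n))"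
    using T R by (simp add: emeasure_cball unit_ball_vol_1)
  also have "\<dots> = ennreal (2 * unit_ball_vol (real CARD('n)) * T * R ^ CARD('n))"
    using T R by (simp add: ennreal_mult[symmetric] mult_ac)
  finally show "measure lebesgue (cyl T R :: 'n spacetime set) \<le> 2 * unit_ball_vol (real CARD('n)) * T * R ^ CARD('n)"
    using T R by (simp add: measure_def)
qed

lemma lebesgue_on_vanishing:
  fixes h :: "'a::euclidean_space \<Rightarrow> real"
  assumes "open \<Omega>" "\<And>z. z \<notin> \<Omega> \<Longrightarrow> h z = 0"
  shows "(LINT z|lebesgue_on \<Omega>. h z) = (LINT z|lebesgue. h z)"
    and "integrable (lebesgue_on \<Omega>) h \<longleftrightarrow> integrable lebesgue h"
proof -
  have "(\<lambda>z. indicator \<Omega> z *\<^sub>R h z) = h"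
  proof
    fix z show "indicator \<Omega> z *\<^sub>R h z = h z" using assms(2)[of z] by (cases "z \<in> \<Omega>") auto
  qed
  then show "(LINT z|lebesgue_on \<Omega>. h z) = (LINT z|lebesgue. h z)"
    and "integrable (lebesgue_on \<Omega>) h \<longleftrightarrow> integrable lebesgue h"
    using assms(1) by (simp_all add: integral_restrict_space integrable_restrict_space)
qed

definition cutoff :: "real \<Rightarrow> real \<Rightarrow> ('n::finite spacetime \<Rightarrow> real) \<Rightarrow> bool" where
  "cutoff T R \<zeta> \<longleftrightarrow> \<zeta> \<in> borel_measurable lebesgue \<and> (\<forall>z. 0 \<le> \<zeta> z \<and> \<zeta> z \<le> 1) \<and>
     (\<forall>z\<in>cyl (T / 2) (R / 2). \<zeta> z = 1) \<and> (\<forall>z. z \<notin> cyl T R \<longrightarrow> \<zeta> z = 0)"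

text \<open>On cylinders of height $R^\alpha$ and radius $R$ the two scales agree: $|\zeta_t|$ is of
  order $R^{-\alpha}$, and so is $a(\nabla\zeta,\nabla\zeta)$, because it is bounded by
  $A\,|\nabla\zeta|^2$ and $A \le c R^{2-\alpha}$ on the annulus that carries $\nabla\zeta$.\<close>

lemma cutoff_estimate:
  fixes u v :: "'n::finite spacetime \<Rightarrow> real"
  assumes std: "standing_assumptions a A" and q: "1 < q" and p: "1 < p" "p < q" and n: "n \<ge> 1"
    and sol: "weak_solution a q u v" and uv: "AE z in lebesgue. u z \<ge> v z" and c: "c > 0"
    and A: "\<And>R. R > 1 \<Longrightarrow>
      esssup (lebesgue_on (UNIV \<times> {x. R / 2 < norm x \<and> norm x < R})) (\<lambda>z. ereal (A z))
        \<le> ereal (c * R powr (2 - \<alpha>))"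
  obtains C where "C > 0" "\<forall>R>1. \<forall>\<epsilon>>0. \<exists>\<zeta> :: 'n spacetime \<Rightarrow> real. cutoff (R powr \<alpha>) R \<zeta> \<and>
    integrable lebesgue (\<lambda>z. indicator (cyl (R powr \<alpha>) R) z * \<bar>u z - v z\<bar> powr q) \<and>
    (LINT z|lebesgue. \<bar>u z - v z\<bar> powr q * \<zeta> z ^ (n + 2)) \<le> C * (R powr (- \<alpha>) * \<epsilon>) *
     (LINT z|lebesgue. indicator (- cyl (R powr \<alpha> / 2) (R / 2)) z * (\<zeta> z ^ n * (1 + \<bar>u z - v z\<bar> / \<epsilon>) powr p))"
proof -
  obtain K where K: "K > 0" and cut: "\<forall>T>0. \<forall>R>0. \<exists>\<zeta> :: 'n spacetime \<Rightarrow> real. scaled_cutoff K T R \<zeta>"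
    by (rule spacetime_cutoff)
  obtain M where M: "M \<ge> 1" and prof: "\<forall>\<epsilon>>0. \<exists>f F. profile \<epsilon> p M f F"
    by (rule decreasing_profile[OF p(1)])
  define \<kappa>0 where "\<kappa>0 = K + c * real CARD('n) * K\<^sup>2"
  have \<kappa>0: "\<kappa>0 > 0" using K c by (simp add: \<kappa>0_def add_pos_nonneg)
  define C where "C = 2 powr q * (2 powr p * (2 * M\<^sup>2 * (real (n + 2))\<^sup>2 * \<kappa>0))"
  have C: "C > 0" using M \<kappa>0 by (simp add: C_def)
  show ?thesis
  proof (rule that[OF C], intro allI impI)
    fix R \<epsilon> :: real assume R: "R > 1" and \<epsilon>: "\<epsilon> > 0"
    let ?T = "R powr \<alpha>"
    have T: "?T > 0" using R by simp
    have R0: "R > 0" using R by simp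
    obtain \<zeta> :: "'n spacetime \<Rightarrow> real" where \<zeta>: "smooth_on UNIV \<zeta>" "\<forall>z. 0 \<le> \<zeta> z \<and> \<zeta> z \<le> 1"
     "\<forall>t x. \<bar>t\<bar> \<le> ?T/2 \<and> norm x \<le> R/2 \<longrightarrow> \<zeta> (t, x) = 1"
     "\<forall>t x. \<bar>t\<bar> > ?T \<or> norm x > R \<longrightarrow> \<zeta> (t, x) = 0"
     "\<forall>t x. \<bar>t\<bar> \<le> ?T/2 \<and> norm x \<le> R/2 \<longrightarrow> D_t \<zeta> (t, x) = 0"
     "\<forall>t x i. norm x \<le> R/2 \<or> norm x \<ge> R \<longrightarrow> D_x i \<zeta> (t, x) = 0"
     "\<forall>z. \<bar>D_t \<zeta> z\<bar> \<le> K / ?T" "\<forall>z i. \<bar>D_x i \<zeta> z\<bar> \<le> K / R"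
      using cut[rule_format, OF T R0] unfolding scaled_cutoff_def by (elim exE conjE) (rule that)
    obtain f F :: "real \<Rightarrow> real" where f: "smooth_on UNIV f" "\<forall>s. 1 \<le> f s \<and> f s \<le> M"
     "\<forall>s. (f has_real_derivative - (1 / \<epsilon>) * (1 + (s / \<epsilon>)\<^sup>2) powr (- p / 2)) (at s)"
     "\<forall>s. (F has_real_derivative f s) (at s)" "\<forall>s. \<bar>F s\<bar> \<le> M * \<bar>s\<bar>"
      using prof[rule_format, OF \<epsilon>] unfolding profile_def by (elim exE conjE) (rule that)
    let ?\<Omega> = "ball (0::real) (?T + 1) \<times> ball (0::real^'n) (R + 1)"
    let ?K = "cyl ?T R :: 'n spacetime set" and ?B = "- cyl (?T / 2) (R / 2) :: 'n spacetime set"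
    let ?\<kappa> = "\<kappa>0 * R powr (- \<alpha>)"
    have T1: "?T + 1 > 0" using T by linarith
    have "convex ?\<Omega>" by (intro convex_Times convex_ball)
    moreover have "(0, 0) \<in> ?\<Omega>" using T1 R by auto
    ultimately have \<Omega>: "bounded_domain ?\<Omega>"
      unfolding bounded_domain_def by (auto intro: open_Times bounded_Times convex_connected)
    have o: "open ?\<Omega>" by (intro open_Times open_ball)
    have K\<Omega>: "?K \<subseteq> ?\<Omega>" by (auto simp: mem_cyl)
    have \<zeta>K: "\<zeta> z = 0" if "z \<notin> ?K" for z
      using \<zeta>(4) that by (cases z) (auto simp: mem_cyl not_le)
    have \<kappa>: "?\<kappa> \<ge> 0" using \<kappa>0 by simp
    have Dt: "\<bar>D_t \<zeta> z\<bar> \<le> ?\<kappa> * indicator ?B z" for z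
    proof (cases "z \<in> ?B")
      case True
      have "K / ?T = K * R powr (- \<alpha>)" by (simp add: powr_minus_divide)
      also have "\<dots> \<le> ?\<kappa>"
        using c by (intro mult_right_mono) (auto simp: \<kappa>0_def)
      finally show ?thesis using \<zeta>(7) True by (metis indicator_simps(1) mult_1_right order_trans)
    next
      case False
      then show ?thesis using \<zeta>(5) \<kappa> by (cases z) (auto simp: mem_cyl)
    qed
    have "AE z in lebesgue_on (UNIV \<times> {x. R / 2 < norm x \<and> norm x < R}). ereal (A z) \<le> ereal (c * R powr (2 - \<alpha>))"
      using esssup_AE by (rule eventually_mono) (rule order_trans[OF _ A[OF R]])
    moreover have "open (UNIV \<times> {x. R / 2 < norm x \<and> norm x < R} :: 'n spacetime set)"
      unfolding Collect_conj_eq by (intro open_Times open_Int open_Collect_less continuous_intros open_UNIV)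
    ultimately have "AE z in lebesgue. z \<in> UNIV \<times> {x. R / 2 < norm x \<and> norm x < R} \<longrightarrow> A z \<le> c * R powr (2 - \<alpha>)"
      by (subst (asm) AE_restrict_space_iff) auto
    with form_bounds_AE[OF std]
    have form: "AE z in lebesgue. a_form a \<zeta> \<zeta> z \<le> ?\<kappa> * indicator ?B z"
    proof eventually_elim
      case (elim z)
      obtain t x where z: "z = (t, x)" by (cases z)
      show ?case
      proof (cases "R / 2 < norm x \<and> norm x < R")
        case True
        have "(norm (grad_x \<zeta> z))\<^sup>2 = (\<Sum>i\<in>UNIV. (D_x i \<zeta> z)\<^sup>2)"
          unfolding power2_norm_eq_inner by (simp add: inner_vec_def grad_x_def power2_eq_square)
        also have "\<dots> \<le> (\<Sum>i\<in>(UNIV::'n set). (K / R)\<^sup>2)"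
        proof (rule sum_mono)
          fix i
          have "\<bar>D_x i \<zeta> z\<bar> \<le> K / R" using \<zeta>(8) by blast
          from power_mono[OF this, of 2] show "(D_x i \<zeta> z)\<^sup>2 \<le> (K / R)\<^sup>2" by simp
        qed
        finally have grad: "(norm (grad_x \<zeta> z))\<^sup>2 \<le> real CARD('n) * (K / R)\<^sup>2" by simp
        have "a_form a \<zeta> \<zeta> z \<le> A z * (norm (grad_x \<zeta> z))\<^sup>2"
          using elim(1) by (simp add: a_form_bil form_bounds_def)
        also have "\<dots> \<le> (c * R powr (2 - \<alpha>)) * (real CARD('n) * (K / R)\<^sup>2)"
          using elim(2) z True grad c by (intro mult_mono) auto
        also have "\<dots> = c * real CARD('n) * K\<^sup>2 * R powr (- \<alpha>)"
        proof -
          have "R powr (2 - \<alpha>) = R\<^sup>2 * R powr (- \<alpha>)"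
            using powr_add[of R 2 "- \<alpha>"] R by simp
          then show ?thesis using R by (simp add: power_divide)
        qed
        also have "\<dots> \<le> ?\<kappa>"
          using K by (intro mult_right_mono) (auto simp: \<kappa>0_def)
        finally show ?thesis using True z by (simp add: mem_cyl)
      next
        case False
        then have "grad_x \<zeta> z = 0" using \<zeta>(6) z by (auto simp: grad_x_def vec_eq_iff not_less)
        then show ?thesis using \<kappa> by (simp add: a_form_bil bil_zero)
      qed
    qed
    have Bs: "?B \<in> sets lebesgue"
      using sets.compl_sets[OF cyl_sets, of "?T / 2" "R / 2"] by (simp add: Compl_eq_Diff_UNIV)
    note RB = reaction_bound[OF std q p sol uv \<Omega> \<epsilon> f(1) f(2)[rule_format, THEN conjunct1]
        f(2)[rule_format, THEN conjunct2] f(3)[rule_format] f(4)[rule_format] f(5)[rule_format]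
        \<zeta>(1) \<zeta>(2)[rule_format, THEN conjunct1] \<zeta>(2)[rule_format, THEN conjunct2]
        compact_cyl K\<Omega> \<zeta>K Bs \<kappa> Dt form]
    have out: "\<zeta> z = 0" if "z \<notin> ?\<Omega>" for z using \<zeta>K K\<Omega> that by blast
    have J: "(LINT z|lebesgue_on ?\<Omega>. \<bar>u z - v z\<bar> powr q * \<zeta> z ^ (n + 2)) =
        (LINT z|lebesgue. \<bar>u z - v z\<bar> powr q * \<zeta> z ^ (n + 2))"
      by (rule lebesgue_on_vanishing(1)[OF o]) (simp add: out)
    have I: "(LINT z|lebesgue_on ?\<Omega>. indicator ?B z * (\<zeta> z ^ n * (1 + \<bar>u z - v z\<bar> / \<epsilon>) powr p)) =
        (LINT z|lebesgue. indicator ?B z * (\<zeta> z ^ n * (1 + \<bar>u z - v z\<bar> / \<epsilon>) powr p))"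
      using n by (intro lebesgue_on_vanishing(1)[OF o]) (simp add: out)
    have "\<zeta> \<in> borel_measurable (lebesgue_on UNIV)"
      using smooth_on_measurable[OF open_UNIV \<zeta>(1)] .
    then have "cutoff ?T R \<zeta>"
      using \<zeta>(2,3) \<zeta>K by (auto simp: cutoff_def mem_cyl lebesgue_on_UNIV_eq)
    moreover have "integrable lebesgue (\<lambda>z. indicator ?K z * \<bar>u z - v z\<bar> powr q)"
    proof -
      have int: "integrable (lebesgue_on ?\<Omega>) (\<lambda>z. indicator ?K z * \<bar>u z - v z\<bar> powr q)"
        using RB(1)
      proof (rule Bochner_Integration.integrable_bound)
        have "indicator ?K \<in> borel_measurable (lebesgue_on ?\<Omega>)"
          by (intro measurable_lebesgue_on borel_measurable_indicator cyl_sets)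
        then show "(\<lambda>z. indicator ?K z * \<bar>u z - v z\<bar> powr q) \<in> borel_measurable (lebesgue_on ?\<Omega>)"
          using borel_measurable_integrable[OF RB(1)] by measurable
      qed (auto simp: indicator_def)
      have van: "(indicator ?K z * \<bar>u z - v z\<bar> powr q :: real) = 0" if "z \<notin> ?\<Omega>" for z
        using K\<Omega> that by (auto simp: indicator_def)
      show ?thesis by (rule lebesgue_on_vanishing(2)[OF o van, THEN iffD1, OF _ int])
    qed
    moreover have "(LINT z|lebesgue. \<bar>u z - v z\<bar> powr q * \<zeta> z ^ (n + 2)) \<le> C * (R powr (- \<alpha>) * \<epsilon>) *
     (LINT z|lebesgue. indicator ?B z * (\<zeta> z ^ n * (1 + \<bar>u z - v z\<bar> / \<epsilon>) powr p))" (is "?J \<le> _ * ?I")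
    proof -
      have "2 powr (- q) * ?J \<le> 2 powr p * (2 * M\<^sup>2 * (real (n + 2))\<^sup>2 * ?\<kappa> * \<epsilon>) * ?I"
        using RB(2)[of n] unfolding J I .
      then have "2 powr q * (2 powr (- q) * ?J) \<le> 2 powr q * (2 powr p * (2 * M\<^sup>2 * (real (n + 2))\<^sup>2 * ?\<kappa> * \<epsilon>) * ?I)"
        by (intro mult_left_mono) auto
      moreover have "2 powr q * (2 powr (- q) * ?J) = ?J"
        by (simp add: powr_minus)
      ultimately show ?thesis by (simp only: C_def mult_ac)
    qed
    ultimately show "\<exists>\<zeta> :: 'n spacetime \<Rightarrow> real. cutoff ?T R \<zeta> \<and>
    integrable lebesgue (\<lambda>z. indicator ?K z * \<bar>u z - v z\<bar> powr q) \<and>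
    (LINT z|lebesgue. \<bar>u z - v z\<bar> powr q * \<zeta> z ^ (n + 2)) \<le> C * (R powr (- \<alpha>) * \<epsilon>) *
     (LINT z|lebesgue. indicator ?B z * (\<zeta> z ^ n * (1 + \<bar>u z - v z\<bar> / \<epsilon>) powr p))"
      by (intro exI[of _ \<zeta>] conjI)
  qed
qed

section \<open>Letting the radius tend to infinity\<close>

lemma cutoffD:
  assumes "cutoff T R \<zeta>"
  shows "\<zeta> \<in> borel_measurable lebesgue" "0 \<le> \<zeta> z" "\<zeta> z \<le> 1"
    "z \<in> cyl (T / 2) (R / 2) \<Longrightarrow> \<zeta> z = 1" "z \<notin> cyl T R \<Longrightarrow> \<zeta> z = 0"
  using assms unfolding cutoff_def by blast+

text \<open>Let $\beta = \alpha/(q-1)$. With $\varepsilon = \delta R^{-\beta}$ the factor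
  $R^{-\alpha}\varepsilon$ equals $\delta^{1-q}\varepsilon^q$. Since $p < q$, the right-hand side is then at
  most a multiple of $\delta^{1-q}\int|\omega|^q$, taken outside the half-size cylinder, plus a multiple
  of $R^{-\alpha}\varepsilon$ times the volume of the cylinder. That volume is of order $R^{\alpha+N}$,
  $N$ being the dimension, and $R^{-\alpha}\varepsilon\,R^{\alpha+N} = \delta R^{N-\beta} \le \delta$;
  this is the only place where the critical exponent enters.

  Taking $\delta = 1$, the power \<open>p\<close> is traded for a small multiple of the power \<open>q\<close> and
  absorbed into the left-hand side, so that $\int|\omega|^q$ over cylinders is bounded uniformly in $R$ and
  $|\omega|^q$ is integrable. With this knowledge $\int|\omega|^q$ over the
  region outside the half-size cylinder tends to 0 for fixed \<open>\<delta>\<close>, which leaves a bound proportional to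
  \<open>\<delta>\<close>.\<close>

lemma vanishing_from_cutoff_estimates:
  fixes \<omega> :: "'n::finite spacetime \<Rightarrow> real"
  assumes p: "1 < p" "p < q" and n: "n \<ge> 1" "real (n + 2) * p \<le> real n * q"
    and \<beta>: "real CARD('n) \<le> \<alpha> / (q - 1)" and \<alpha>: "\<alpha> > 0" and C: "C > 0"
    and \<omega>: "\<omega> \<in> borel_measurable lebesgue"
    and est: "\<And>R \<epsilon>. R > 1 \<Longrightarrow> \<epsilon> > 0 \<Longrightarrow> \<exists>\<zeta> :: 'n spacetime \<Rightarrow> real. cutoff (R powr \<alpha>) R \<zeta> \<and>
    integrable lebesgue (\<lambda>z. indicator (cyl (R powr \<alpha>) R) z * \<bar>\<omega> z\<bar> powr q) \<and>
    (LINT z|lebesgue. \<bar>\<omega> z\<bar> powr q * \<zeta> z ^ (n + 2)) \<le> C * (R powr (- \<alpha>) * \<epsilon>) *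
     (LINT z|lebesgue. indicator (- cyl (R powr \<alpha> / 2) (R / 2)) z * (\<zeta> z ^ n * (1 + \<bar>\<omega> z\<bar> / \<epsilon>) powr p))"
  shows "AE z in lebesgue. \<omega> z = 0"
proof -
  define \<beta> where "\<beta> = \<alpha> / (q - 1)"
  define W where "W z = \<bar>\<omega> z\<bar> powr q" for z
  define Q where "Q R = (cyl (R powr \<alpha> / 2) (R / 2) :: 'n spacetime set)" for R
  define K where "K R = (cyl (R powr \<alpha>) R :: 'n spacetime set)" for R
  have \<beta>N: "real CARD('n) \<le> \<beta>" and \<beta>q: "\<beta> * (q - 1) = \<alpha>"
    using assms(5) p by (simp_all add: \<beta>_def)
  have q: "q > 1" using p by simp
  have W0: "W z \<ge> 0" for z by (simp add: W_def)
  have Wm [measurable]: "W \<in> borel_measurable lebesgue"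
    unfolding W_def[abs_def] using \<omega> by measurable
  have [measurable]: "Q R \<in> sets lebesgue" "K R \<in> sets lebesgue" for R
    by (auto simp: Q_def K_def)
  have Qm [measurable]: "- Q R \<in> sets lebesgue" for R
    using sets.compl_sets[of "Q R" lebesgue] by (simp add: Compl_eq_Diff_UNIV)
  have QK: "Q R \<subseteq> K R" if "R > 1" for R
    using that powr_ge_zero[of R \<alpha>] by (auto simp: Q_def K_def mem_cyl)
  obtain V where V: "V > 0" "\<And>T R. T > 0 \<Longrightarrow> R > 0 \<Longrightarrow>
      measure lebesgue (cyl T R :: 'n spacetime set) \<le> V * T * R ^ CARD('n)"
    using measure_cyl_le by metis
  have K_int: "integrable lebesgue (indicator (K R) :: _ \<Rightarrow> real)" for R
  proof -
    have "emeasure lebesgue (K R) < \<infinity>"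
    proof -
      have "K R \<in> lmeasurable" unfolding K_def by (rule cyl_lmeasurable)
      then show ?thesis by (simp only: fmeasurable_def mem_Collect_eq)
    qed
    then show ?thesis by (intro integrable_real_indicator) auto
  qed
  have KW_int: "integrable lebesgue (\<lambda>z. indicator (K R) z * W z)" if "R > 1" for R
    using est[OF that zero_less_one] by (auto simp: K_def W_def)
  have scale1: "R powr (- \<alpha>) * (\<delta> * R powr (- \<beta>)) * (\<delta> * R powr (- \<beta>)) powr (- q) = \<delta> powr (1 - q)"
    if "R > 1" "\<delta> > 0" for R \<delta>
  proof -
    let ?e = "\<delta> * R powr (- \<beta>)"
    have e: "?e > 0" using that by simp
    have "?e * ?e powr (- q) = ?e powr (1 - q)"
      using powr_add[of ?e 1 "- q"] e by simp
    also have "\<dots> = \<delta> powr (1 - q) * (R powr (- \<beta>)) powr (1 - q)"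
      by (rule powr_mult)
    also have "(R powr (- \<beta>)) powr (1 - q) = R powr \<alpha>"
    proof -
      have "- \<beta> * (1 - q) = \<alpha>" using \<beta>q by (simp add: algebra_simps)
      then show ?thesis by (simp only: powr_powr)
    qed
    finally have eq: "?e * ?e powr (- q) = \<delta> powr (1 - q) * R powr \<alpha>" .
    have "R powr (- \<alpha>) * ?e * ?e powr (- q) = R powr (- \<alpha>) * (\<delta> powr (1 - q) * R powr \<alpha>)"
      unfolding eq[symmetric] by (simp only: mult.assoc)
    also have "\<dots> = \<delta> powr (1 - q) * (R powr (- \<alpha>) * R powr \<alpha>)"
      by (simp only: mult.left_commute)
    also have "R powr (- \<alpha>) * R powr \<alpha> = 1" using that by (simp flip: powr_add)
    finally show ?thesis by simp
  qed
  have scale2: "R powr (- \<alpha>) * (\<delta> * R powr (- \<beta>)) * measure lebesgue (K R) \<le> V * \<delta>"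
    if "R > 1" "\<delta> > 0" for R \<delta>
  proof -
    have "R powr (- \<alpha>) * (\<delta> * R powr (- \<beta>)) * measure lebesgue (K R) \<le>
        R powr (- \<alpha>) * (\<delta> * R powr (- \<beta>)) * (V * R powr \<alpha> * R ^ CARD('n))"
      unfolding K_def using that by (intro mult_left_mono V(2)) auto
    also have "\<dots> = V * \<delta> * (R powr (- \<alpha>) * R powr \<alpha> * (R powr (- \<beta>) * R powr real CARD('n)))"
      using powr_realpow[of R "CARD('n)"] that by (simp only: mult_ac)
    also have "R powr (- \<alpha>) * R powr \<alpha> = 1" using that by (simp flip: powr_add)
    also have "R powr (- \<beta>) * R powr real CARD('n) = R powr (real CARD('n) - \<beta>)"
      by (simp flip: powr_add)
    also have "V * \<delta> * (1 * R powr (real CARD('n) - \<beta>)) \<le> V * \<delta> * (1 * R powr 0)"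
      using that \<beta>N V(1) by (intro mult_left_mono powr_mono) auto
    finally show ?thesis using that by simp
  qed
  have y_le: "(1 + \<bar>\<omega> z\<bar> / \<epsilon>) powr q \<le> 2 powr q * (1 + \<epsilon> powr (- q) * W z)" if "\<epsilon> > 0" for \<epsilon> z
  proof -
    have "(\<bar>\<omega> z\<bar> / \<epsilon>) powr q = \<epsilon> powr (- q) * W z"
      using that by (simp add: W_def powr_divide powr_minus_divide)
    then show ?thesis
      using powr_add_le[of q 1 "\<bar>\<omega> z\<bar> / \<epsilon>"] that q by simp
  qed
  have lower: "(LINT z|lebesgue. indicator (Q R) z * W z) \<le> (LINT z|lebesgue. W z * \<zeta> z ^ (n + 2))"
    "integrable lebesgue (\<lambda>z. W z * \<zeta> z ^ (n + 2))" "integrable lebesgue (\<lambda>z. indicator (Q R) z * W z)"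
    if R: "R > 1" and \<zeta>: "cutoff (R powr \<alpha>) R \<zeta>" for R \<zeta>
  proof -
    have \<zeta>m [measurable]: "\<zeta> \<in> borel_measurable lebesgue" and \<zeta>01: "0 \<le> \<zeta> z" "\<zeta> z \<le> 1" for z
      using cutoffD(1-3)[OF \<zeta>] by blast+
    have \<zeta>K: "\<zeta> z = 0" if "z \<notin> K R" for z using cutoffD(5)[OF \<zeta>] that by (simp add: K_def)
    have \<zeta>Q: "\<zeta> z = 1" if "z \<in> Q R" for z using cutoffD(4)[OF \<zeta>] that by (simp add: Q_def)
    show i: "integrable lebesgue (\<lambda>z. W z * \<zeta> z ^ (n + 2))"
    proof (rule Bochner_Integration.integrable_bound[OF KW_int[OF R]])
      show "(\<lambda>z. W z * \<zeta> z ^ (n + 2)) \<in> borel_measurable lebesgue" by measurable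
      have "W z * \<zeta> z ^ (n + 2) \<le> indicator (K R) z * W z" for z
      proof (cases "z \<in> K R")
        case True
        have "W z * \<zeta> z ^ (n + 2) \<le> W z * 1"
          by (intro mult_left_mono power_le_one \<zeta>01 W0)
        with True show ?thesis by simp
      qed (simp add: \<zeta>K)
      moreover have "0 \<le> W z * \<zeta> z ^ (n + 2)" for z
        by (intro mult_nonneg_nonneg zero_le_power \<zeta>01 W0)
      moreover have "0 \<le> indicator (K R) z * W z" for z using W0 by simp
      ultimately show "AE z in lebesgue. norm (W z * \<zeta> z ^ (n + 2)) \<le> norm (indicator (K R) z * W z)"
        by (intro always_eventually allI) (simp only: real_norm_def abs_of_nonneg)
    qed
    show i': "integrable lebesgue (\<lambda>z. indicator (Q R) z * W z)"
    proof (rule Bochner_Integration.integrable_bound[OF KW_int[OF R]])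
      show "(\<lambda>z. indicator (Q R) z * W z) \<in> borel_measurable lebesgue" by measurable
    qed (use QK[OF R] in \<open>auto simp: indicator_def\<close>)
    show "(LINT z|lebesgue. indicator (Q R) z * W z) \<le> (LINT z|lebesgue. W z * \<zeta> z ^ (n + 2))"
    proof (rule integral_mono[OF i' i])
      fix z
      show "indicator (Q R) z * W z \<le> W z * \<zeta> z ^ (n + 2)"
        using \<zeta>Q[of z] W0[of z] \<zeta>01[of z] by (cases "z \<in> Q R") auto
    qed
  qed
  have p0: "0 < p" using p by simp
  \<comment> \<open>this choice makes the coefficient of the absorbed term equal to $1/2$\<close>
  define \<eta> where "\<eta> = 1 / (2 * (C * 2 powr q))"
  have \<eta>: "\<eta> > 0" using C by (simp add: \<eta>_def)
  obtain D where D: "D \<ge> 0" "\<And>x. x \<ge> 0 \<Longrightarrow> x powr p \<le> \<eta> * x powr q + D"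
    using powr_le_add_const[OF p0 p(2) \<eta>] by blast
  define C1 where "C1 = 2 * (C * ((2 powr q * \<eta> + D) * V))"
  have bounded: "(LINT z|lebesgue. indicator (Q R) z * W z) \<le> C1" if R: "R > 1" for R
  proof -
    define \<epsilon> where "\<epsilon> = R powr (- \<beta>)"
    have \<epsilon>: "\<epsilon> > 0" using R by (simp add: \<epsilon>_def)
    obtain \<zeta> where \<zeta>: "cutoff (R powr \<alpha>) R \<zeta>" and
      le: "(LINT z|lebesgue. W z * \<zeta> z ^ (n + 2)) \<le> C * (R powr (- \<alpha>) * \<epsilon>) *
        (LINT z|lebesgue. indicator (- Q R) z * (\<zeta> z ^ n * (1 + \<bar>\<omega> z\<bar> / \<epsilon>) powr p))"
      using est[OF R \<epsilon>] by (auto simp: W_def Q_def)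
    have \<zeta>m [measurable]: "\<zeta> \<in> borel_measurable lebesgue" and \<zeta>01: "0 \<le> \<zeta> z" "\<zeta> z \<le> 1" for z
      using cutoffD(1-3)[OF \<zeta>] by blast+
    have \<zeta>K: "\<zeta> z = 0" if "z \<notin> K R" for z using cutoffD(5)[OF \<zeta>] that by (simp add: K_def)
    let ?J = "LINT z|lebesgue. W z * \<zeta> z ^ (n + 2)"
    let ?rhs = "\<lambda>z. (2 powr q * \<eta> + D) * indicator (K R) z + 2 powr q * \<eta> * \<epsilon> powr (- q) * (W z * \<zeta> z ^ (n + 2))"
    note J_int = lower(2)[OF R \<zeta>]
    have pw: "indicator (- Q R) z * (\<zeta> z ^ n * (1 + \<bar>\<omega> z\<bar> / \<epsilon>) powr p) \<le> ?rhs z" for z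
    proof (cases "\<zeta> z = 0")
      case True
      then show ?thesis using n(1) \<eta> D(1) by (simp add: power_0_left)
    next
      case False
      then have \<zeta>0: "\<zeta> z > 0" using \<zeta>01(1)[of z] by simp
      have zK: "z \<in> K R" using \<zeta>K False by blast
      let ?y = "1 + \<bar>\<omega> z\<bar> / \<epsilon>"
      have y: "?y \<ge> 1" using \<epsilon> by simp
      define r where "r = real (n + 2) / q"
      \<comment> \<open>as \<open>\<zeta> \<le> 1\<close> and \<open>n\<close> is large, the power of \<open>\<zeta>\<close> can be lowered until the pair is a \<open>p\<close>-th
        power; its \<open>q\<close>-th power then carries exactly the weight \<open>\<zeta> ^ (n + 2)\<close> of the left-hand side\<close>
      have "indicator (- Q R) z * (\<zeta> z ^ n * ?y powr p) \<le> \<zeta> z powr real n * ?y powr p"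
        using \<zeta>0 by (simp add: indicator_def powr_realpow)
      also have "\<dots> \<le> \<zeta> z powr (r * p) * ?y powr p"
      proof (intro mult_right_mono powr_mono')
        show "r * p \<le> real n" using n(2) q by (simp add: r_def field_simps)
      qed (use \<zeta>01 in auto)
      also have "\<dots> = (\<zeta> z powr r * ?y) powr p"
        using \<zeta>0 y by (simp add: powr_mult powr_powr)
      also have "\<dots> \<le> \<eta> * (\<zeta> z powr r * ?y) powr q + D"
        using y by (intro D(2)) auto
      also have "(\<zeta> z powr r * ?y) powr q = \<zeta> z powr (r * q) * ?y powr q"
        using \<zeta>0 y by (simp add: powr_mult powr_powr)
      also have "\<zeta> z powr (r * q) = \<zeta> z ^ (n + 2)"
        using \<zeta>0 q powr_realpow[OF \<zeta>0, of "n + 2"] by (simp add: r_def)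
      also have "\<eta> * (\<zeta> z ^ (n + 2) * ?y powr q) + D \<le>
          \<eta> * (\<zeta> z ^ (n + 2) * (2 powr q * (1 + \<epsilon> powr (- q) * W z))) + D"
        using \<eta> \<zeta>0 by (intro add_right_mono mult_left_mono y_le \<epsilon>) auto
      also have "\<dots> = 2 powr q * \<eta> * \<zeta> z ^ (n + 2) + 2 powr q * \<eta> * \<epsilon> powr (- q) * (W z * \<zeta> z ^ (n + 2)) + D"
        by (simp add: algebra_simps)
      also have "2 powr q * \<eta> * \<zeta> z ^ (n + 2) \<le> 2 powr q * \<eta> * 1"
        using \<eta> by (intro mult_left_mono power_le_one \<zeta>01) auto
      finally show ?thesis using zK by simp
    qed
    have rhs_int: "integrable lebesgue ?rhs"
      using K_int J_int by (intro Bochner_Integration.integrable_add integrable_mult_right) auto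
    have "(LINT z|lebesgue. indicator (- Q R) z * (\<zeta> z ^ n * (1 + \<bar>\<omega> z\<bar> / \<epsilon>) powr p)) \<le> (LINT z|lebesgue. ?rhs z)"
    proof (rule integral_mono'[OF rhs_int pw])
      show "0 \<le> ?rhs z" for z
        using \<eta> D(1) W0[of z] \<zeta>01(1)[of z] by (intro add_nonneg_nonneg mult_nonneg_nonneg) auto
    qed
    also have "\<dots> = (2 powr q * \<eta> + D) * measure lebesgue (K R) + 2 powr q * \<eta> * \<epsilon> powr (- q) * ?J"
      using K_int J_int by (subst Bochner_Integration.integral_add) auto
    finally have "?J \<le> C * (R powr (- \<alpha>) * \<epsilon>) *
        ((2 powr q * \<eta> + D) * measure lebesgue (K R) + 2 powr q * \<eta> * \<epsilon> powr (- q) * ?J)"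
      using le C \<epsilon> by (meson mult_left_mono mult_nonneg_nonneg less_imp_le order_trans powr_ge_zero)
    also have "\<dots> = C * ((2 powr q * \<eta> + D) * (R powr (- \<alpha>) * \<epsilon> * measure lebesgue (K R))) +
        C * 2 powr q * \<eta> * (R powr (- \<alpha>) * \<epsilon> * \<epsilon> powr (- q)) * ?J"
      by (simp add: algebra_simps)
    also have "R powr (- \<alpha>) * \<epsilon> * \<epsilon> powr (- q) = 1"
      using scale1[OF R zero_less_one] by (simp add: \<epsilon>_def)
    also have "C * 2 powr q * \<eta> * 1 * ?J = ?J / 2"
      using C by (simp add: \<eta>_def)
    also have "C * ((2 powr q * \<eta> + D) * (R powr (- \<alpha>) * \<epsilon> * measure lebesgue (K R))) \<le> C * ((2 powr q * \<eta> + D) * V)"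
      using scale2[OF R zero_less_one] C \<eta> D(1) by (intro mult_left_mono) (auto simp: \<epsilon>_def)
    finally have "?J \<le> C1" by (simp add: C1_def)
    then show ?thesis using lower(1)[OF R \<zeta>] by linarith
  qed
  \<comment> \<open>the estimates hold for radii above 1 only\<close>
  define R where "R j = real j + 2" for j :: nat
  have R1: "R j > 1" for j by (simp add: R_def)
  have Q_mono: "Q (R i) \<subseteq> Q (R j)" if "i \<le> j" for i j
  proof -
    have "R i powr \<alpha> \<le> R j powr \<alpha>"
      using that \<alpha> by (intro powr_mono2) (auto simp: R_def)
    then show ?thesis using that by (auto simp: Q_def mem_cyl R_def)
  qed
  have Q_eventually: "\<exists>N. \<forall>j\<ge>N. z \<in> Q (R j)" for z
  proof -
    obtain t x where z: "z = (t, x)" by (cases z)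
    have lim: "filterlim R at_top sequentially"
      by (rule filterlim_at_top_mono[OF filterlim_real_sequentially]) (simp add: R_def)
    have "eventually (\<lambda>j. (2 * \<bar>t\<bar>) powr (1 / \<alpha>) \<le> R j) sequentially"
      using lim by (simp add: filterlim_at_top)
    then have "eventually (\<lambda>j. 2 * \<bar>t\<bar> \<le> R j powr \<alpha>) sequentially"
    proof eventually_elim
      case (elim j)
      then have "((2 * \<bar>t\<bar>) powr (1 / \<alpha>)) powr \<alpha> \<le> R j powr \<alpha>"
        using \<alpha> by (intro powr_mono2) auto
      then show ?case using \<alpha> by (simp add: powr_powr)
    qed
    moreover have "eventually (\<lambda>j. 2 * norm x \<le> R j) sequentially"
      using lim by (simp add: filterlim_at_top)
    ultimately have "eventually (\<lambda>j. z \<in> Q (R j)) sequentially"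
      by eventually_elim (simp add: z Q_def mem_cyl)
    then show ?thesis by (simp add: eventually_sequentially)
  qed
  let ?w = "\<lambda>j z. indicator (Q (R j)) z * W z"
  have w_int: "integrable lebesgue (?w j)" for j
    using lower(3)[OF R1] est[OF R1 zero_less_one] by blast
  have w_mono: "?w i z \<le> ?w j z" if "i \<le> j" for i j z
    using Q_mono[OF that] W0[of z] by (auto simp: indicator_def)
  have w_lim: "(\<lambda>j. ?w j z) \<longlonglongrightarrow> W z" for z
  proof -
    obtain N where "\<forall>j\<ge>N. z \<in> Q (R j)" using Q_eventually by blast
    then have "eventually (\<lambda>j. ?w j z = W z) sequentially"
      by (auto simp: eventually_sequentially intro!: exI[of _ N])
    then show ?thesis by (rule tendsto_eventually)
  qed
  have "incseq (\<lambda>j. LINT z|lebesgue. ?w j z)"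
    using w_int w_mono by (auto simp: incseq_def intro!: integral_mono)
  then obtain L where L: "(\<lambda>j. LINT z|lebesgue. ?w j z) \<longlonglongrightarrow> L"
    using incseq_convergent[of _ C1] bounded[OF R1] by blast
  have mono_AE: "AE z in lebesgue. mono (\<lambda>j. ?w j z)" using w_mono by (simp add: mono_def)
  have lim_AE: "AE z in lebesgue. (\<lambda>j. ?w j z) \<longlonglongrightarrow> W z" using w_lim by simp
  note mct = integrable_monotone_convergence[OF w_int mono_AE lim_AE L Wm]
    integral_monotone_convergence[OF w_int mono_AE lim_AE L Wm]
  have small: "L \<le> C * 2 powr q * V * \<delta>" if \<delta>: "\<delta> > 0" for \<delta>
  proof -
    have "(LINT z|lebesgue. ?w j z) \<le> C * 2 powr q * V * \<delta> + C * 2 powr q * \<delta> powr (1 - q) * (L - (LINT z|lebesgue. ?w j z))" for j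
    proof -
      let ?R = "R j"
      define \<epsilon> where "\<epsilon> = \<delta> * ?R powr (- \<beta>)"
      have \<epsilon>: "\<epsilon> > 0" using R1[of j] \<delta> by (simp add: \<epsilon>_def)
      obtain \<zeta> where \<zeta>: "cutoff (?R powr \<alpha>) ?R \<zeta>" and
        le: "(LINT z|lebesgue. W z * \<zeta> z ^ (n + 2)) \<le> C * (?R powr (- \<alpha>) * \<epsilon>) *
          (LINT z|lebesgue. indicator (- Q ?R) z * (\<zeta> z ^ n * (1 + \<bar>\<omega> z\<bar> / \<epsilon>) powr p))"
        using est[OF R1 \<epsilon>] by (auto simp: W_def Q_def)
      have \<zeta>01: "0 \<le> \<zeta> z" "\<zeta> z \<le> 1" for z using cutoffD(1-3)[OF \<zeta>] by blast+
      have \<zeta>K: "\<zeta> z = 0" if "z \<notin> K ?R" for z using cutoffD(5)[OF \<zeta>] that by (simp add: K_def)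
      let ?rhs = "\<lambda>z. 2 powr q * indicator (K ?R) z + 2 powr q * \<epsilon> powr (- q) * (W z - ?w j z)"
      have wW: "?w j z \<le> W z" for z using W0[of z] by (simp add: indicator_def)
      have pw: "indicator (- Q ?R) z * (\<zeta> z ^ n * (1 + \<bar>\<omega> z\<bar> / \<epsilon>) powr p) \<le> ?rhs z" for z
      proof (cases "z \<in> K ?R \<and> z \<notin> Q ?R")
        case True
        let ?y = "1 + \<bar>\<omega> z\<bar> / \<epsilon>"
        have y: "?y \<ge> 1" using \<epsilon> by simp
        have "indicator (- Q ?R) z * (\<zeta> z ^ n * ?y powr p) \<le> 1 * (1 * ?y powr q)"
          using y p \<zeta>01[of z] by (intro mult_mono powr_mono power_le_one) (auto simp: indicator_def)
        also have "\<dots> \<le> 2 powr q * (1 + \<epsilon> powr (- q) * W z)" using y_le[OF \<epsilon>] by simp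
        finally show ?thesis using True by (simp add: algebra_simps)
      next
        case False
        then have "indicator (- Q ?R) z * (\<zeta> z ^ n * (1 + \<bar>\<omega> z\<bar> / \<epsilon>) powr p) = 0"
          using \<zeta>K[of z] n(1) by (auto simp: indicator_def power_0_left)
        moreover have "0 \<le> ?rhs z" using wW[of z] by (intro add_nonneg_nonneg mult_nonneg_nonneg) auto
        ultimately show ?thesis by linarith
      qed
      have d_int: "integrable lebesgue (\<lambda>z. W z - ?w j z)" using mct(1) w_int by simp
      have rhs_int: "integrable lebesgue ?rhs"
        using K_int d_int by (intro Bochner_Integration.integrable_add integrable_mult_right) auto
      have "(LINT z|lebesgue. indicator (- Q ?R) z * (\<zeta> z ^ n * (1 + \<bar>\<omega> z\<bar> / \<epsilon>) powr p)) \<le> (LINT z|lebesgue. ?rhs z)"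
      proof (rule integral_mono'[OF rhs_int pw])
        show "0 \<le> ?rhs z" for z using wW[of z] by (intro add_nonneg_nonneg mult_nonneg_nonneg) auto
      qed
      also have "\<dots> = 2 powr q * measure lebesgue (K ?R) + 2 powr q * \<epsilon> powr (- q) * (LINT z|lebesgue. W z - ?w j z)"
        using K_int d_int by (subst Bochner_Integration.integral_add) auto
      also have "(LINT z|lebesgue. W z - ?w j z) = L - (LINT z|lebesgue. ?w j z)"
        using mct w_int by simp
      finally have "(LINT z|lebesgue. W z * \<zeta> z ^ (n + 2)) \<le> C * (?R powr (- \<alpha>) * \<epsilon>) *
          (2 powr q * measure lebesgue (K ?R) + 2 powr q * \<epsilon> powr (- q) * (L - (LINT z|lebesgue. ?w j z)))"
        using le C \<epsilon> by (meson mult_left_mono mult_nonneg_nonneg less_imp_le order_trans powr_ge_zero)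
      also have "\<dots> = C * 2 powr q * (?R powr (- \<alpha>) * \<epsilon> * measure lebesgue (K ?R)) +
          C * 2 powr q * (?R powr (- \<alpha>) * \<epsilon> * \<epsilon> powr (- q)) * (L - (LINT z|lebesgue. ?w j z))"
        by (simp add: algebra_simps)
      also have "?R powr (- \<alpha>) * \<epsilon> * \<epsilon> powr (- q) = \<delta> powr (1 - q)"
        using scale1[OF R1 \<delta>] by (simp add: \<epsilon>_def)
      also have "C * 2 powr q * (?R powr (- \<alpha>) * \<epsilon> * measure lebesgue (K ?R)) \<le> C * 2 powr q * (V * \<delta>)"
        using scale2[OF R1 \<delta>] C by (intro mult_left_mono) (auto simp: \<epsilon>_def)
      finally show ?thesis using lower(1)[OF R1 \<zeta>] by (simp add: mult.assoc)
    qed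
    moreover have "(\<lambda>j. C * 2 powr q * V * \<delta> + C * 2 powr q * \<delta> powr (1 - q) * (L - (LINT z|lebesgue. ?w j z))) \<longlonglongrightarrow>
        C * 2 powr q * V * \<delta> + C * 2 powr q * \<delta> powr (1 - q) * (L - L)"
      by (intro tendsto_intros L)
    ultimately have "L \<le> C * 2 powr q * V * \<delta> + C * 2 powr q * \<delta> powr (1 - q) * (L - L)"
      by (intro LIMSEQ_le[OF L]) auto
    then show ?thesis by simp
  qed
  have "L \<le> 0"
  proof (rule field_le_epsilon)
    fix e :: real assume e: "e > 0"
    define c where "c = C * 2 powr q * V"
    have c: "c > 0" using C V(1) by (simp add: c_def)
    have "L \<le> c * (e / c)"
      unfolding c_def using c e by (intro small divide_pos_pos) (simp_all add: c_def)
    also have "\<dots> = e" using c by simp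
    finally show "L \<le> 0 + e" by simp
  qed
  moreover have "L \<ge> 0" unfolding mct(2)[symmetric] using W0 by (intro Bochner_Integration.integral_nonneg) auto
  ultimately have "(LINT z|lebesgue. W z) = 0" using mct(2) by simp
  then have "AE z in lebesgue. W z = 0"
    using integral_nonneg_eq_0_iff_AE[OF mct(1)] W0 by simp
  then show ?thesis by eventually_elim (simp add: W_def)
qed

theorem theorem1:
  fixes a :: "'n::finite spacetime \<Rightarrow> real ^ 'n ^ 'n"
    and A u v :: "'n spacetime \<Rightarrow> real"
    and \<alpha> q c :: real
  assumes "\<alpha> > 0"
    and "1 < q" and "q \<le> 1 + \<alpha> / real CARD('n)"
    and "standing_assumptions a A"
    and "c > 0"
    and "\<And>R. R > 1 \<Longrightarrow>
      esssup (lebesgue_on (UNIV \<times> {x. R / 2 < norm x \<and> norm x < R})) (\<lambda>z. ereal (A z))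
        \<le> ereal (c * R powr (2 - \<alpha>))"
    and "weak_solution a q u v"
    and "AE z in lebesgue. u z \<ge> v z"
  shows "AE z in lebesgue. u z = v z"
proof -
  \<comment> \<open>any exponent strictly between 1 and \<open>q\<close> would do; \<open>n\<close> is then taken so large that the cutoff
    survives the absorption of the power \<open>p\<close> into the power \<open>q\<close>\<close>
  define p where "p = (1 + q) / 2"
  have p: "1 < p" "p < q" using assms(2) by (simp_all add: p_def)
  obtain m :: nat where m: "2 * p / (q - p) \<le> real m" using real_arch_simple by blast
  define n where "n = Suc m"
  have n: "n \<ge> 1" by (simp add: n_def)
  have "2 * p \<le> real n * (q - p)"
  proof -
    have "2 * p \<le> real m * (q - p)" using m p by (simp add: pos_divide_le_eq)
    also have "\<dots> \<le> real n * (q - p)" using p by (intro mult_right_mono) (auto simp: n_def)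
    finally show ?thesis .
  qed
  then have np: "real (n + 2) * p \<le> real n * q" by (simp add: algebra_simps)
  have \<beta>: "real CARD('n) \<le> \<alpha> / (q - 1)"
  proof -
    have N: "real CARD('n) > 0" by simp
    have "q - 1 \<le> \<alpha> / real CARD('n)" using assms(3) by simp
    then have "(q - 1) * real CARD('n) \<le> \<alpha>" using N by (simp only: pos_le_divide_eq)
    then show ?thesis using assms(2) by (simp add: pos_le_divide_eq mult.commute)
  qed
  obtain X Y where "W_loc a q X u" "W_loc a q Y v"
    using assms(7) unfolding weak_solution_def by metis
  then have meas: "(\<lambda>z. u z - v z) \<in> borel_measurable lebesgue"
    using W_loc_measurable by (intro borel_measurable_diff) blast+
  obtain C where C: "C > 0" and est: "\<forall>R>1. \<forall>\<epsilon>>0. \<exists>\<zeta> :: 'n spacetime \<Rightarrow> real. cutoff (R powr \<alpha>) R \<zeta> \<and>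
    integrable lebesgue (\<lambda>z. indicator (cyl (R powr \<alpha>) R) z * \<bar>u z - v z\<bar> powr q) \<and>
    (LINT z|lebesgue. \<bar>u z - v z\<bar> powr q * \<zeta> z ^ (n + 2)) \<le> C * (R powr (- \<alpha>) * \<epsilon>) *
     (LINT z|lebesgue. indicator (- cyl (R powr \<alpha> / 2) (R / 2)) z * (\<zeta> z ^ n * (1 + \<bar>u z - v z\<bar> / \<epsilon>) powr p))"
    by (rule cutoff_estimate[OF assms(4,2) p n assms(7,8,5,6)], assumption) (rule that; assumption)
  have "AE z in lebesgue. u z - v z = 0"
    by (rule vanishing_from_cutoff_estimates[OF p n np \<beta> assms(1) C meas est[rule_format]])
  then show ?thesis by eventually_elim simp
qed

end
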